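(* Let $k>15$ be a fixed integer and let $\varepsilon>0$. Let $T$ be the threshold constant described in the context. If $p=p(n)$ satisfies $p<(T-\varepsilon)/n^{k-1}$, then the random system $F(n,p)$ of equations modulo $3$ is satisfiable with probability $1-o(1)$ as $n\to\infty$.
   Context: Fix an integer $k\ge 3$ and $n$ variables $x_1,\dots,x_n$. An equation is $y_1+\dots+y_k=a \pmod 3$, where $(y_1,\dots,y_k)$ is an ordered $k$-tuple of variables and $a\in\{0,1,2\}$. The random formula $F(n,p)$ is obtained by including each of the possible equations independently with probability $p$; it is satisfiable if some assignment $\{x_1,\dots,x_n\}\to\{0,1,2\}$ satisfies all included equations. The $2$-core of a formula is obtained by repeatedly deleting all variables occurring at most once together with the equations containing them; its density is its number of equations divided by its number of variables. It is known that there is a constant $T$ (depending on $k$) such that for $p=c/n^{k-1}$ and every $\varepsilon>0$: if $c\le T-\varepsilon$ then with probability $1-o(1)$ the $2$-core of $F(n,p)$ has density $\le 1-\varepsilon$, and if $c\ge T+\varepsilon$ then with probability $1-o(1)$ it has density $\ge 1+\varepsilon$. *)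

theory Defs
  imports "HOL-Probability.Probability" "HOL-Number_Theory.Cong"
begin

(* The equation y_1 + ... + y_k = a (mod 3) is the pair of the list [y_1, ..., y_k] and a;
   the variable x_i is its index i.  As the tuples are arbitrary, a variable may occur
   repeatedly in one equation. *)
type_synonym equation = "nat list \<times> nat"

definition equations :: "nat \<Rightarrow> nat \<Rightarrow> equation set" where
  "equations k n = {(ys, a). length ys = k \<and> set ys \<subseteq> {1..n} \<and> a \<in> {0, 1, 2}}"

definition satisfies :: "(nat \<Rightarrow> nat) \<Rightarrow> equation \<Rightarrow> bool" where
  "satisfies \<sigma> e \<longleftrightarrow> [(\<Sum>y\<leftarrow>fst e. \<sigma> y) = snd e] (mod 3)"

definition satisfiable :: "nat \<Rightarrow> equation set \<Rightarrow> bool" where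
  "satisfiable n F \<longleftrightarrow> (\<exists>\<sigma> \<in> {1..n} \<rightarrow> {0, 1, 2}. \<forall>e\<in>F. satisfies \<sigma> e)"

definition random_formula :: "nat \<Rightarrow> nat \<Rightarrow> real \<Rightarrow> equation set pmf" where
  "random_formula k n p =
     map_pmf (\<lambda>b. {e \<in> equations k n. b e})
       (Pi_pmf (equations k n) False (\<lambda>_. bernoulli_pmf p))"

(* Repeated occurrences within one equation are counted separately. *)
definition occurrences :: "equation set \<Rightarrow> nat \<Rightarrow> nat" where
  "occurrences F x = (\<Sum>e\<in>F. count_list (fst e) x)"

definition delete_low :: "nat set \<times> equation set \<Rightarrow> nat set \<times> equation set" where
  "delete_low = (\<lambda>(V, F).
     let L = {x \<in> V. occurrences F x \<le> 1}
     in (V - L, {e \<in> F. set (fst e) \<inter> L = {}}))"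

(* A deletion round that changes anything removes a variable, so n rounds reach the fixed
   point; see delete_low_two_core below. *)
definition two_core :: "nat \<Rightarrow> equation set \<Rightarrow> nat set \<times> equation set" where
  "two_core n F = (delete_low ^^ n) ({1..n}, F)"

(* The density of the empty 2-core is 0, by the convention x / 0 = 0. *)
definition core_density :: "nat \<Rightarrow> equation set \<Rightarrow> real" where
  "core_density n F = real (card (snd (two_core n F))) / real (card (fst (two_core n F)))"

(* At most one T has this property. *)
definition core_threshold :: "nat \<Rightarrow> real \<Rightarrow> bool" where
  "core_threshold k T \<longleftrightarrow>
     (\<forall>\<epsilon>>0. \<forall>c\<ge>0.
        (c \<le> T - \<epsilon> \<longrightarrow>
           (\<lambda>n. measure_pmf.prob (random_formula k n (c / real n ^ (k - 1)))
                  {F. core_density n F \<le> 1 - \<epsilon>}) \<longlonglongrightarrow> 1) \<and>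
        (c \<ge> T + \<epsilon> \<longrightarrow>
           (\<lambda>n. measure_pmf.prob (random_formula k n (c / real n ^ (k - 1)))
                  {F. core_density n F \<ge> 1 + \<epsilon>}) \<longlonglongrightarrow> 1))"

lemma delete_low_cases:
  assumes "finite (fst S)"
  shows "delete_low S = S \<or> card (fst (delete_low S)) < card (fst S)"
proof (cases "{x \<in> fst S. occurrences (snd S) x \<le> 1} = {}")
  case True
  then show ?thesis by (cases S) (auto simp: delete_low_def Let_def)
next
  case False
  then have "fst (delete_low S) \<subset> fst S"
    by (cases S) (auto simp: delete_low_def Let_def)
  with assms show ?thesis by (simp add: psubset_card_mono)
qed

lemma delete_low_two_core: "delete_low (two_core n F) = two_core n F"
proof -
  have fin: "finite (fst ((delete_low ^^ i) ({1..n}, F)))" for i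
    by (induction i) (auto simp: delete_low_def Let_def split: prod.splits)
  have "delete_low ((delete_low ^^ i) ({1..n}, F)) = (delete_low ^^ i) ({1..n}, F) \<or>
        card (fst ((delete_low ^^ i) ({1..n}, F))) + i \<le> n" for i
  proof (induction i)
    case (Suc i)
    then show ?case using delete_low_cases[OF fin[of i]] by auto
  qed simp
  from this[of n] show ?thesis
  proof
    assume "card (fst ((delete_low ^^ n) ({1..n}, F))) + n \<le> n"
    then have "card (fst ((delete_low ^^ n) ({1..n}, F))) = 0" by simp
    then show ?thesis using delete_low_cases[OF fin[of n]] unfolding two_core_def by auto
  qed (simp add: two_core_def)
qed

end

(* Put c = T - \<epsilon>.  Deleting equations preserves satisfiability, so let p = c / n^(k-1); an
   unsatisfiable system has a nonzero vector l of coefficients modulo 3 with l * A = 0, where A is the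
   matrix of the system.  Here c <= 1/3, since for c > 1/3 there are more equations than variables and the
   density of the 2-core exceeds 1.  A first moment computation with characters of Z/3 shows that with high
   probability the nonzero kernel vectors all have at least (2/3 - 1/(10k)) n nonzero entries.

   Suppose that the kernel is nontrivial with probability not tending to 0.  Resampling one equation
   at a time, either the kernel often grows, or already almost every possible equation has its left-hand
   side in the row span.  Averaging over kernel vectors, 2/3 of whose entries are nonzero, more than a
   (1 - 1/(4k)) fraction of the equations are redundant, so after finitely many enlargements of the
   kernel the latter holds.  Then all but n/(4k) variables are frozen, that is, their pairwise
   differences are determined by the homogeneous system.

   Up to a bounded expected number of exceptions near short cycles, a variable of the 2-core survives t
   rounds of local exploration.  Deleting all equations at a random variable x leaves almost the same
   random formula, and x is surviving but not frozen in the original formula only if some equation at x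
   leads to a surviving variable that is not frozen and no equation at x has all its other variables
   frozen.  For k > 15 this makes the number of surviving non-frozen variables contract by the factor
   1/2 in each round.  Hence almost all variables of the 2-core are frozen, so the 2-core has at least
   as many equations as variables up to o(n), whereas below the threshold its density is at most
   1 - \<epsilon>. *)
theory Submission
  imports Defs "HOL-Real_Asymp.Real_Asymp"
begin

subsection \<open>Linear algebra modulo 3\<close>

text \<open>Nothing is known about \<open>T\<close> beyond the density of the core, so it is never
  computed. The first moment gives nothing near weight 2n/3, and the probability of a nontrivial
  kernel is unknown; hence nothing is ever conditioned on it. All estimates are expectations
  weighted with the indicator of an increasing event, since monotonicity survives the insertion and
  deletion of equations. The constants fit as follows. (1 - 1/(4k))^k >= 3/4, so most equations
  still have only frozen variables. The weight margin 1/(10k) makes 3/2 of the minimal weight equal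
  to (1 - 3/(20k)) n, and a kernel of size 20k turns this into more than (1 - 1/(4k)) n redundant
  equations. The contraction factor is 3 c k^2 e^(-9ck/4), at most 1/2 for c >= 3/10; for smaller c
  there are too few equations to freeze that many variables. The core could have o(n) variables,
  where a density gap would say nothing. It is the kernel that excludes this: its vectors are
  supported on the equations of the core and have linear weight.\<close>

lemma square_cong_1_mod_3:
  fixes w :: int
  assumes "\<not> 3 dvd w"
  shows "[w * w = 1] (mod 3)"
proof -
  have "w mod 3 = 1 \<or> w mod 3 = 2" using assms by presburger
  then have "[w = 1] (mod 3) \<or> [w = 2] (mod 3)" by (simp add: cong_def)
  then have "[w * w = 1 * 1] (mod 3) \<or> [w * w = 2 * 2] (mod 3)" by (meson cong_mult)
  then show ?thesis by (simp add: cong_def)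
qed

text \<open>Linear independence over the field with 3 elements. Integers under congruence stand in
  for the field throughout, so that the entries can be plain occurrence counts.\<close>

definition indep_mod3 :: "('e \<Rightarrow> 'v \<Rightarrow> int) \<Rightarrow> 'v set \<Rightarrow> 'e set \<Rightarrow> bool" where
  "indep_mod3 r V F \<longleftrightarrow>
     (\<forall>l. (\<forall>x\<in>V. [(\<Sum>e\<in>F. l e * r e x) = 0] (mod 3)) \<longrightarrow> (\<forall>e\<in>F. [l e = 0] (mod 3)))"

text \<open>Induction on the rows, as in Gram-Schmidt. Independence makes the new row nonzero at
  some column \<open>x\<close> after its components \<open>c f\<close> along the old rows are
  subtracted. The unit vector at \<open>x\<close>, projected to the annihilator of the old rows,
  then becomes the new dual vector \<open>u\<close>, and the old dual vectors are corrected by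
  multiples of \<open>u\<close>.\<close>

lemma dual_basis_mod3:
  fixes r :: "'e \<Rightarrow> 'v \<Rightarrow> int"
  assumes "finite F" "finite V" "indep_mod3 r V F"
  shows "\<exists>v. \<forall>e\<in>F. \<forall>f\<in>F. [(\<Sum>x\<in>V. r e x * v f x) = (if e = f then 1 else 0)] (mod 3)"
  using assms(1,3)
proof (induction F rule: finite_induct)
  case empty
  then show ?case by simp
next
  case (insert e F)
  have "indep_mod3 r V F"
    unfolding indep_mod3_def
  proof (intro allI impI ballI)
    fix l :: "'e \<Rightarrow> int" and f
    assume l: "\<forall>x\<in>V. [(\<Sum>e\<in>F. l e * r e x) = 0] (mod 3)" and f: "f \<in> F"
    have "(\<Sum>g\<in>insert e F. (l(e := 0)) g * r g x) = (\<Sum>g\<in>F. l g * r g x)" for x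
      using insert.hyps by (auto intro!: sum.cong)
    then have "[(l(e := 0)) f = 0] (mod 3)"
      using insert.prems l f unfolding indep_mod3_def by (metis insertCI)
    then show "[l f = 0] (mod 3)" using f insert.hyps by (cases "f = e") auto
  qed
  then obtain v where
    v: "\<And>g f. g \<in> F \<Longrightarrow> f \<in> F \<Longrightarrow> [(\<Sum>x\<in>V. r g x * v f x) = (if g = f then 1 else 0)] (mod 3)"
    using insert.IH by blast
  define c where "c f = (\<Sum>x\<in>V. r e x * v f x)" for f
  have "\<exists>x\<in>V. \<not> 3 dvd (r e x - (\<Sum>f\<in>F. c f * r f x))"
  proof (rule ccontr)
    assume *: "\<not> ?thesis"
    define l where "l g = (if g = e then 1 else - c g)" for g
    have "(\<Sum>g\<in>insert e F. l g * r g x) = r e x - (\<Sum>f\<in>F. c f * r f x)" for x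
    proof -
      have "(\<Sum>g\<in>F. l g * r g x) = (\<Sum>g\<in>F. - (c g * r g x))"
        using insert.hyps by (intro sum.cong) (auto simp: l_def)
      then show ?thesis using insert.hyps by (simp add: l_def sum_negf)
    qed
    then have "[l e = 0] (mod 3)"
      using insert.prems * unfolding indep_mod3_def cong_0_iff by (metis insertCI)
    then show False by (simp add: l_def cong_def)
  qed
  then obtain x where x: "x \<in> V" and nd: "\<not> 3 dvd (r e x - (\<Sum>f\<in>F. c f * r f x))" by blast
  define w where "w = r e x - (\<Sum>f\<in>F. c f * r f x)"
  have ww: "[w * w = 1] (mod 3)" using square_cong_1_mod_3 nd by (simp add: w_def)
  \<comment> \<open>Without the factor \<open>w\<close> the pairing with \<open>r e\<close> would be
    \<open>w\<close>; as \<open>w\<close> is its own inverse modulo 3, the factor normalises it to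
    1.\<close>
  define u where "u y = w * ((if y = x then 1 else 0) - (\<Sum>f\<in>F. r f x * v f y))" for y
  have dot: "(\<Sum>y\<in>V. r g y * u y) = w * (r g x - (\<Sum>f\<in>F. r f x * (\<Sum>y\<in>V. r g y * v f y)))" for g
  proof -
    have "(\<Sum>y\<in>V. r g y * u y)
        = (\<Sum>y\<in>V. w * (if y = x then r g y else 0) - w * (\<Sum>f\<in>F. r f x * (r g y * v f y)))"
      unfolding u_def by (intro sum.cong) (auto simp: algebra_simps sum_distrib_left)
    also have "\<dots> = w * r g x - w * (\<Sum>y\<in>V. \<Sum>f\<in>F. r f x * (r g y * v f y))"
      using x assms(2) by (simp add: sum_subtractf sum_distrib_left[symmetric] sum.delta')
    also have "(\<Sum>y\<in>V. \<Sum>f\<in>F. r f x * (r g y * v f y))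
        = (\<Sum>f\<in>F. r f x * (\<Sum>y\<in>V. r g y * v f y))"
      by (subst sum.swap) (simp add: sum_distrib_left)
    finally show ?thesis by (simp add: algebra_simps)
  qed
  have ug: "[(\<Sum>y\<in>V. r g y * u y) = 0] (mod 3)" if g: "g \<in> F" for g
  proof -
    have "[(\<Sum>f\<in>F. r f x * (\<Sum>y\<in>V. r g y * v f y)) = (\<Sum>f\<in>F. r f x * (if g = f then 1 else 0))] (mod 3)"
      by (intro cong_sum cong_mult v g) auto
    also have "(\<Sum>f\<in>F. r f x * (if g = f then 1 else 0)) = r g x"
      using g insert.hyps by (simp add: if_distrib cong: if_cong)
    finally have "[w * (r g x - (\<Sum>f\<in>F. r f x * (\<Sum>y\<in>V. r g y * v f y))) = w * (r g x - r g x)] (mod 3)"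
      by (intro cong_mult cong_diff) auto
    then show ?thesis by (simp add: dot)
  qed
  have ue: "[(\<Sum>y\<in>V. r e y * u y) = 1] (mod 3)"
    using ww unfolding dot w_def c_def by (simp add: mult.commute)
  define v' where "v' f y = (if f = e then u y else v f y - c f * u y)" for f y
  have "[(\<Sum>y\<in>V. r g y * v' f y) = (if g = f then 1 else 0)] (mod 3)"
    if g: "g \<in> insert e F" and f: "f \<in> insert e F" for g f
  proof (cases "f = e")
    case True
    then show ?thesis using ug ue g insert.hyps by (auto simp: v'_def)
  next
    case False
    then have f: "f \<in> F" using f by simp
    have eq: "(\<Sum>y\<in>V. r g y * v' f y) = (\<Sum>y\<in>V. r g y * v f y) - c f * (\<Sum>y\<in>V. r g y * u y)"
      using False by (simp add: v'_def algebra_simps sum_subtractf sum_distrib_left)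
    show ?thesis
    proof (cases "g = e")
      case True
      have "[c f - c f * (\<Sum>y\<in>V. r g y * u y) = c f - c f * 1] (mod 3)"
        using ue True by (intro cong_diff cong_mult) auto
      then show ?thesis using eq True False by (simp add: c_def)
    next
      case g': False
      then have "g \<in> F" using g by simp
      then have "[(\<Sum>y\<in>V. r g y * v f y) - c f * (\<Sum>y\<in>V. r g y * u y) = (if g = f then 1 else 0) - c f * 0] (mod 3)"
        using f by (intro cong_diff cong_mult v ug) auto
      then show ?thesis using eq by simp
    qed
  qed
  then show ?case by blast
qed

lemma indep_mod3_solvable:
  fixes r :: "'e \<Rightarrow> 'v \<Rightarrow> int"
  assumes "finite F" "finite V" "indep_mod3 r V F"
  obtains s where "\<And>e. e \<in> F \<Longrightarrow> [(\<Sum>x\<in>V. r e x * s x) = a e] (mod 3)"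
proof -
  obtain v where v: "\<And>e f. e \<in> F \<Longrightarrow> f \<in> F \<Longrightarrow>
      [(\<Sum>x\<in>V. r e x * v f x) = (if e = f then 1 else 0)] (mod 3)"
    using dual_basis_mod3[OF assms] by blast
  show ?thesis
  proof
    fix e assume e: "e \<in> F"
    have "(\<Sum>x\<in>V. r e x * (\<Sum>f\<in>F. a f * v f x)) = (\<Sum>f\<in>F. a f * (\<Sum>x\<in>V. r e x * v f x))"
      unfolding sum_distrib_left by (subst sum.swap) (simp add: algebra_simps)
    also have "[\<dots> = (\<Sum>f\<in>F. a f * (if e = f then 1 else 0))] (mod 3)"
      by (intro cong_sum cong_mult v e) auto
    also have "(\<Sum>f\<in>F. a f * (if e = f then 1 else 0)) = a e"
      using e assms(1) by (simp add: if_distrib cong: if_cong)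
    finally show "[(\<Sum>x\<in>V. r e x * (\<Sum>f\<in>F. a f * v f x)) = a e] (mod 3)" .
  qed
qed

section \<open>Row span and left kernel of a system\<close>

definition row :: "equation \<Rightarrow> nat \<Rightarrow> int" where
  "row e x = int (count_list (fst e) x)"

definition comb :: "equation set \<Rightarrow> (equation \<Rightarrow> int) \<Rightarrow> nat \<Rightarrow> int" where
  "comb F l x = (\<Sum>e\<in>F. l e * row e x)"

definition in_span :: "equation set \<Rightarrow> (nat \<Rightarrow> int) \<Rightarrow> bool" where
  "in_span F w \<longleftrightarrow> (\<exists>l. \<forall>x. [w x = comb F l x] (mod 3))"

text \<open>Coefficients in {0, 1, 2}, extensional outside \<open>F\<close>, give each kernel vector
  a single representative. The kernel is then a finite set, and its dimension \<open>d\<close> is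
  only ever measured through its cardinality \<open>3 ^ d\<close>.\<close>

definition left_ker :: "equation set \<Rightarrow> (equation \<Rightarrow> int) set" where
  "left_ker F = {l \<in> F \<rightarrow>\<^sub>E {0, 1, 2}. \<forall>x. [comb F l x = 0] (mod 3)}"

definition reduce :: "equation set \<Rightarrow> (equation \<Rightarrow> int) \<Rightarrow> equation \<Rightarrow> int" where
  "reduce F l = restrict (\<lambda>e. l e mod 3) F"

lemma mod_3_in: "(a::int) mod 3 \<in> {0, 1, 2}"
proof -
  have "0 \<le> a mod 3" "a mod 3 < 3" by auto
  then show ?thesis by auto
qed

lemma reduce_PiE: "reduce F l \<in> F \<rightarrow>\<^sub>E {0, 1, 2}"
  using mod_3_in by (auto simp: reduce_def)

lemma comb_cong_mod3:
  assumes "\<And>e. e \<in> F \<Longrightarrow> [l e = l' e] (mod 3)"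
  shows "[comb F l x = comb F l' x] (mod 3)"
  unfolding comb_def using assms by (intro cong_sum cong_mult) auto

lemma comb_reduce: "[comb F (reduce F l) x = comb F l x] (mod 3)"
  by (intro comb_cong_mod3) (auto simp: reduce_def cong_def)

lemma comb_linear: "comb F (\<lambda>e. a * l e + b * m e) x = a * comb F l x + b * comb F m x"
  by (simp add: comb_def sum.distrib sum_distrib_left algebra_simps)

lemma comb_mono_zero:
  assumes "F \<subseteq> G" "finite G" "\<And>e. e \<in> G - F \<Longrightarrow> l e = 0"
  shows "comb G l x = comb F l x"
  unfolding comb_def using assms by (intro sum.mono_neutral_right) auto

lemma left_ker_undefined: "l \<in> left_ker F \<Longrightarrow> e \<notin> F \<Longrightarrow> l e = undefined"
  unfolding left_ker_def by (rule PiE_arb[of _ _ "\<lambda>_. {0, 1, 2}"]) auto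

lemma left_ker_values: "l \<in> left_ker F \<Longrightarrow> e \<in> F \<Longrightarrow> l e \<in> {0, 1, 2}"
  unfolding left_ker_def by (rule PiE_mem) auto

lemma finite_left_ker: "finite F \<Longrightarrow> finite (left_ker F)"
  unfolding left_ker_def by (auto intro!: finite_PiE)

lemma reduce_in_left_ker:
  assumes "\<And>x. [comb F l x = 0] (mod 3)"
  shows "reduce F l \<in> left_ker F"
  unfolding left_ker_def using reduce_PiE cong_trans[OF comb_reduce assms] by blast

lemma zero_in_left_ker: "restrict (\<lambda>_. 0) F \<in> left_ker F"
  unfolding left_ker_def comb_def by auto

lemma in_span_linear:
  assumes "in_span F v" "in_span F w"
  shows "in_span F (\<lambda>x. a * v x + b * w x)"
proof -
  obtain l m where "\<And>x. [v x = comb F l x] (mod 3)" "\<And>x. [w x = comb F m x] (mod 3)"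
    using assms unfolding in_span_def by blast
  then have "[a * v x + b * w x = comb F (\<lambda>e. a * l e + b * m e) x] (mod 3)" for x
    unfolding comb_linear by (intro cong_add cong_mult) auto
  then show ?thesis unfolding in_span_def by blast
qed

lemma in_span_cong:
  assumes "in_span F v" "\<And>x. [w x = v x] (mod 3)"
  shows "in_span F w"
  using assms(1) cong_trans[OF assms(2)] unfolding in_span_def by blast

lemma in_span_add: "in_span F v \<Longrightarrow> in_span F w \<Longrightarrow> in_span F (\<lambda>x. v x + w x)"
  using in_span_linear[of F v w 1 1] by simp

lemma in_span_diff: "in_span F v \<Longrightarrow> in_span F w \<Longrightarrow> in_span F (\<lambda>x. v x - w x)"
  using in_span_linear[of F v w 1 "-1"] by simp

lemma in_span_scale: "in_span F v \<Longrightarrow> in_span F (\<lambda>x. a * v x)"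
  using in_span_linear[of F v v a 0] by simp

lemma in_span_zero: "in_span F (\<lambda>x. 0)"
  unfolding in_span_def comb_def by (auto intro!: exI[of _ "\<lambda>_. 0"])

lemma in_span_mono:
  assumes "in_span F w" "F \<subseteq> G" "finite G"
  shows "in_span G w"
proof -
  obtain l where l: "\<And>x. [w x = comb F l x] (mod 3)"
    using assms unfolding in_span_def by blast
  have "comb G (\<lambda>e. if e \<in> F then l e else 0) x = comb F (\<lambda>e. if e \<in> F then l e else 0) x" for x
    using assms by (intro comb_mono_zero) auto
  also have "comb F (\<lambda>e. if e \<in> F then l e else 0) x = comb F l x" for x
    unfolding comb_def by (intro sum.cong) auto
  finally show ?thesis unfolding in_span_def using l by metis
qed

lemma in_span_row:
  assumes "e \<in> F" "finite F"
  shows "in_span F (row e)"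
  unfolding in_span_def comb_def
  using assms by (intro exI[of _ "\<lambda>f. if f = e then 1 else 0"])
    (auto simp: if_distrib[of "\<lambda>a. a * _"] sum.delta cong: if_cong)

text \<open>The relation can be solved for \<open>row e\<close>, since the nonzero coefficient
  \<open>l e\<close> is its own inverse modulo 3.\<close>

lemma left_ker_in_span:
  assumes "l \<in> left_ker F" "e \<in> F" "l e \<noteq> 0" "finite F"
  shows "in_span (F - {e}) (row e)"
proof -
  have "[l e * row e x + comb (F - {e}) l x = 0] (mod 3)" for x
    using assms unfolding left_ker_def comb_def by (simp add: sum.remove)
  then have *: "[l e * row e x = - comb (F - {e}) l x] (mod 3)" for x
    by (metis add_eq_0_iff2 add.inverse_inverse cong_add_rcancel_0 cong_diff_iff_cong_0 diff_minus_eq_add)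
  have "l e \<in> {0, 1, 2}" using assms unfolding left_ker_def by (auto simp: PiE_iff)
  then have "\<not> 3 dvd l e" using assms by auto
  then have "[row e x * 1 = row e x * (l e * l e)] (mod 3)" for x
    by (intro cong_mult) (auto intro: cong_sym square_cong_1_mod_3)
  moreover have "[l e * (l e * row e x) = l e * (- comb (F - {e}) l x)] (mod 3)" for x
    using * by (intro cong_mult) auto
  ultimately have "[row e x = l e * (- comb (F - {e}) l x)] (mod 3)" for x
    by (metis (no_types, lifting) ab_semigroup_mult_class.mult_ac(1) cong_trans mult.commute mult.right_neutral)
  moreover have "l e * (- comb (F - {e}) l x) = comb (F - {e}) (\<lambda>f. (- l e) * l f + 0 * l f) x" for x
    unfolding comb_linear by simp
  ultimately show ?thesis unfolding in_span_def by metis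
qed

text \<open>Let \<open>m\<close> express \<open>row e\<close> by the rows of \<open>F\<close>. A
  kernel vector \<open>l\<close> of \<open>F\<close> and a free coefficient \<open>c\<close> at
  \<open>e\<close> combine to the kernel vector that is \<open>l - c * m\<close> on \<open>F\<close>
  and \<open>c\<close> at \<open>e\<close>. This tripling is what lets the kernel grow step by
  step.\<close>

lemma card_left_ker_insert:
  assumes "in_span F (row e)" "e \<notin> F" "finite F"
  shows "3 * card (left_ker F) \<le> card (left_ker (insert e F))"
proof -
  obtain m where m: "\<And>x. [row e x = comb F m x] (mod 3)"
    using assms unfolding in_span_def by blast
  define \<phi> where "\<phi> = (\<lambda>(c, l). reduce (insert e F) (\<lambda>f. if f = e then c else l f - c * m f))"
  have "inj_on \<phi> ({0, 1, 2} \<times> left_ker F)"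
  proof (rule inj_onI, clarify)
    fix c l c' l'
    assume c: "c \<in> {0, 1, 2::int}" "c' \<in> {0, 1, 2}" and l: "l \<in> left_ker F" "l' \<in> left_ker F"
      and eq: "\<phi> (c, l) = \<phi> (c', l')"
    have "\<phi> (c, l) e = \<phi> (c', l') e" using eq by simp
    then have cc: "c = c'" using c by (auto simp: \<phi>_def reduce_def)
    have "l f = l' f" for f
    proof (cases "f \<in> F")
      case True
      then have "f \<noteq> e" using assms by auto
      moreover have "\<phi> (c, l) f = \<phi> (c', l') f" using eq by simp
      ultimately have "[l f - c * m f = l' f - c * m f] (mod 3)"
        using True cc by (simp add: \<phi>_def reduce_def cong_def)
      then have "[l f = l' f] (mod 3)"
        using cong_add[OF _ cong_refl[of "c * m f" 3]] by fastforce
      moreover have "l f \<in> {0, 1, 2}" "l' f \<in> {0, 1, 2}"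
        using l True unfolding left_ker_def by (auto simp: PiE_iff)
      ultimately show ?thesis by (auto simp: cong_def)
    next
      case False
      then show ?thesis using l by (simp add: left_ker_undefined)
    qed
    then show "c = c' \<and> l = l'" using cc by auto
  qed
  moreover have "\<phi> ` ({0, 1, 2} \<times> left_ker F) \<subseteq> left_ker (insert e F)"
  proof clarify
    fix c l assume l: "l \<in> left_ker F"
    have "[comb (insert e F) (\<lambda>f. if f = e then c else l f - c * m f) x = 0] (mod 3)" for x
    proof -
      have "comb (insert e F) (\<lambda>f. if f = e then c else l f - c * m f) x
          = c * row e x + comb F (\<lambda>f. 1 * l f + (- c) * m f) x"
        using assms unfolding comb_def by (auto intro!: sum.cong)
      also have "\<dots> = c * row e x + (comb F l x - c * comb F m x)"
        unfolding comb_linear by simp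
      also have "[\<dots> = c * comb F m x + (0 - c * comb F m x)] (mod 3)"
        using l m unfolding left_ker_def by (intro cong_add cong_diff cong_mult) auto
      finally show ?thesis by simp
    qed
    then show "\<phi> (c, l) \<in> left_ker (insert e F)"
      unfolding \<phi>_def by (auto intro: reduce_in_left_ker)
  qed
  ultimately have "card ({0, 1, 2::int} \<times> left_ker F) \<le> card (left_ker (insert e F))"
    using assms by (intro card_inj_on_le[of \<phi>]) (auto intro: finite_left_ker)
  then show ?thesis by (simp add: card_cartesian_product)
qed

lemma card_left_ker_mono:
  assumes "F \<subseteq> G" "finite G"
  shows "card (left_ker F) \<le> card (left_ker G)"
proof -
  define \<phi> where "\<phi> l = restrict (\<lambda>e. if e \<in> F then l e else 0) G" for l :: "equation \<Rightarrow> int"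
  have "inj_on \<phi> (left_ker F)"
  proof (rule inj_onI)
    fix l l' assume l: "l \<in> left_ker F" "l' \<in> left_ker F" and eq: "\<phi> l = \<phi> l'"
    have "l e = l' e" for e
    proof (cases "e \<in> F")
      case True
      then show ?thesis using fun_cong[OF eq, of e] assms by (auto simp: \<phi>_def)
    next
      case False
      then show ?thesis using l by (simp add: left_ker_undefined)
    qed
    then show "l = l'" by auto
  qed
  moreover have "\<phi> ` left_ker F \<subseteq> left_ker G"
  proof clarify
    fix l assume l: "l \<in> left_ker F"
    have "comb G (\<phi> l) x = comb F l x" for x
    proof -
      have "comb G (\<phi> l) x = comb F (\<phi> l) x"
        using assms by (intro comb_mono_zero) (auto simp: \<phi>_def)
      also have "\<dots> = comb F l x"
        using assms unfolding comb_def by (intro sum.cong) (auto simp: \<phi>_def)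
      finally show ?thesis .
    qed
    moreover have "\<phi> l \<in> G \<rightarrow>\<^sub>E {0, 1, 2}"
      using l by (auto simp: \<phi>_def left_ker_def PiE_iff)
    ultimately show "\<phi> l \<in> left_ker G" using l unfolding left_ker_def by auto
  qed
  ultimately show ?thesis using assms by (intro card_inj_on_le) (auto intro: finite_left_ker)
qed

subsection \<open>Supports and the 2-core\<close>

definition supp :: "equation set \<Rightarrow> (equation \<Rightarrow> int) \<Rightarrow> equation set" where
  "supp F l = {e \<in> F. l e \<noteq> 0}"

definition redundant :: "equation set \<Rightarrow> equation set" where
  "redundant F = {e \<in> F. \<exists>l\<in>left_ker F. l e \<noteq> 0}"

text \<open>The value at \<open>e\<close> is a linear functional on the kernel. Subtracting a fixed
  \<open>m\<close> with \<open>m e = c\<close> maps the fibre over \<open>c\<close> injectively into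
  the fibre over 0, so the two nonzero fibres make up at most 2/3 of the kernel.\<close>

lemma card_left_ker_coordinate:
  assumes "finite F" "e \<in> F"
  shows "3 * card {l \<in> left_ker F. l e \<noteq> 0} \<le> 2 * card (left_ker F)"
proof -
  let ?K = "\<lambda>c. {l \<in> left_ker F. l e = c}"
  have fin: "finite (left_ker F)" using assms finite_left_ker by blast
  have le: "card (?K c) \<le> card (?K 0)" for c
  proof (cases "?K c = {}")
    case False
    then obtain m where m: "m \<in> left_ker F" "m e = c" by auto
    define \<phi> where "\<phi> l = reduce F (\<lambda>f. 1 * l f + (-1) * m f)" for l
    have "inj_on \<phi> (?K c)"
    proof (rule inj_onI)
      fix l l' assume l: "l \<in> ?K c" "l' \<in> ?K c" and eq: "\<phi> l = \<phi> l'"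
      have "l f = l' f" for f
      proof (cases "f \<in> F")
        case True
        then have "(l f - m f) mod 3 = (l' f - m f) mod 3"
          using fun_cong[OF eq, of f] by (simp add: \<phi>_def reduce_def)
        then have "l f mod 3 = l' f mod 3"
          by presburger
        moreover have "l f \<in> {0, 1, 2}" "l' f \<in> {0, 1, 2}" using l True left_ker_values by blast+
        ultimately show ?thesis by auto
      next
        case False
        then show ?thesis using l left_ker_undefined[of l F f] left_ker_undefined[of l' F f] by simp
      qed
      then show "l = l'" by auto
    qed
    moreover have "\<phi> ` ?K c \<subseteq> ?K 0"
    proof clarify
      fix l assume l: "l \<in> left_ker F" "c = l e"
      have "[comb F (\<lambda>f. 1 * l f + (-1) * m f) x = 0] (mod 3)" for x
      proof -
        have "[comb F l x = 0] (mod 3)" "[comb F m x = 0] (mod 3)"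
          using l m unfolding left_ker_def by auto
        then have "[1 * comb F l x + (-1) * comb F m x = 1 * 0 + (-1) * 0] (mod 3)"
          by (intro cong_add cong_mult) auto
        then show ?thesis unfolding comb_linear by simp
      qed
      moreover have "\<phi> l e = 0" using l m assms by (simp add: \<phi>_def reduce_def)
      ultimately show "\<phi> l \<in> left_ker F \<and> \<phi> l e = 0"
        unfolding \<phi>_def using reduce_in_left_ker by blast
    qed
    ultimately show ?thesis using fin by (intro card_inj_on_le) auto
  next
    case True
    then show ?thesis by (simp only: True card.empty)
  qed
  have "{l \<in> left_ker F. l e \<noteq> 0} \<subseteq> ?K 1 \<union> ?K 2"
    using left_ker_values assms by blast
  then have "card {l \<in> left_ker F. l e \<noteq> 0} \<le> card (?K 1 \<union> ?K 2)"
    using fin by (intro card_mono) auto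
  also have "\<dots> \<le> card (?K 1) + card (?K 2)" by (rule card_Un_le)
  also have "\<dots> \<le> 2 * card (?K 0)" using le[of 1] le[of 2] by simp
  finally have *: "card {l \<in> left_ker F. l e \<noteq> 0} \<le> 2 * card (?K 0)" .
  have "card (left_ker F) = card ({l \<in> left_ker F. l e \<noteq> 0} \<union> ?K 0)"
    by (intro arg_cong[where f = card]) auto
  also have "\<dots> = card {l \<in> left_ker F. l e \<noteq> 0} + card (?K 0)"
    using fin by (intro card_Un_disjoint) auto
  finally show ?thesis using * by linarith
qed

lemma left_ker_eqI:
  assumes "l \<in> left_ker F" "supp F l = {}"
  shows "l = restrict (\<lambda>_. 0) F"
proof
  fix e show "l e = restrict (\<lambda>_. 0) F e"
  proof (cases "e \<in> F")
    case True
    then have "l e = 0" using assms unfolding supp_def by blast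
    then show ?thesis using True by simp
  next
    case False
    then show ?thesis using assms left_ker_undefined[of l F e] by simp
  qed
qed

text \<open>Double counting of the pairs \<open>(l, e)\<close> with \<open>l e\<close> nonzero:
  every nonzero kernel vector contributes at least \<open>L\<close>, every redundant equation at
  most 2/3 of the kernel. For a large kernel the union of the supports is thus about 3/2 times the
  lower bound for a single support.\<close>

lemma card_redundant_ge:
  fixes L :: real
  assumes "finite F" "\<And>l. l \<in> left_ker F \<Longrightarrow> supp F l \<noteq> {} \<Longrightarrow> L \<le> real (card (supp F l))"
  shows "3 * (real (card (left_ker F)) - 1) * L \<le> 2 * real (card (left_ker F)) * real (card (redundant F))"
proof -
  let ?K = "left_ker F" and ?z = "restrict (\<lambda>_. 0::int) F"
  have fin: "finite ?K" using assms finite_left_ker by blast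
  have z: "?z \<in> ?K" by (rule zero_in_left_ker)
  then have pos: "card ?K \<ge> 1" using fin by (metis One_nat_def Suc_leI card_gt_0_iff empty_iff)
  have finr: "finite (redundant F)" using assms by (simp add: redundant_def)
  have "real (card (?K - {?z})) * L \<le> (\<Sum>l\<in>?K - {?z}. real (card (supp F l)))"
    using assms(2) left_ker_eqI by (intro sum_bounded_below) blast
  also have "\<dots> \<le> (\<Sum>l\<in>?K. real (card (supp F l)))"
    using fin by (intro sum_mono2) auto
  also have "\<dots> = (\<Sum>l\<in>?K. \<Sum>e\<in>redundant F. if l e \<noteq> 0 then 1 else 0)"
  proof (intro sum.cong refl)
    fix l assume "l \<in> ?K"
    then have "supp F l = {e \<in> redundant F. l e \<noteq> 0}" by (auto simp: supp_def redundant_def)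
    then show "real (card (supp F l)) = (\<Sum>e\<in>redundant F. if l e \<noteq> 0 then 1 else 0)"
      using finr by (simp add: sum.If_cases Int_def)
  qed
  also have "\<dots> = (\<Sum>e\<in>redundant F. real (card {l \<in> ?K. l e \<noteq> 0}))"
    using fin by (subst sum.swap) (simp add: sum.If_cases Int_def)
  also have "\<dots> \<le> (\<Sum>e\<in>redundant F. 2 * real (card ?K) / 3)"
  proof (intro sum_mono)
    fix e assume "e \<in> redundant F"
    then have "3 * card {l \<in> ?K. l e \<noteq> 0} \<le> 2 * card ?K"
      using card_left_ker_coordinate assms(1) by (simp add: redundant_def)
    then show "real (card {l \<in> ?K. l e \<noteq> 0}) \<le> 2 * real (card ?K) / 3" by linarith
  qed
  also have "\<dots> = 2 * real (card ?K) / 3 * real (card (redundant F))" by simp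
  finally have "real (card (?K - {?z})) * L \<le> 2 * real (card ?K) / 3 * real (card (redundant F))" .
  moreover have "real (card (?K - {?z})) = real (card ?K) - 1"
    using z fin pos by (simp add: card_Diff_singleton of_nat_diff)
  ultimately show ?thesis by (simp add: field_simps)
qed

lemma redundant_in_span:
  assumes "finite F" "e \<in> redundant F"
  shows "in_span (F - {e}) (row e)"
  using assms left_ker_in_span unfolding redundant_def by blast

lemma equations_iff:
  "e \<in> equations k n \<longleftrightarrow> length (fst e) = k \<and> set (fst e) \<subseteq> {1..n} \<and> snd e \<in> {0, 1, 2}"
  by (cases e) (simp add: equations_def)

lemma finite_equations: "finite (equations k n)"
proof -
  have "equations k n = {ys. set ys \<subseteq> {1..n} \<and> length ys = k} \<times> {0, 1, 2}"
    unfolding equations_def by auto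
  then show ?thesis by (simp add: finite_lists_length_eq)
qed

lemma card_equations: "card (equations k n) = 3 * n ^ k"
proof -
  have "equations k n = {ys. set ys \<subseteq> {1..n} \<and> length ys = k} \<times> {0, 1, 2}"
    unfolding equations_def by auto
  then show ?thesis by (simp add: card_cartesian_product card_lists_length_eq)
qed

lemma row_nonzero_iff: "row e x \<noteq> 0 \<longleftrightarrow> x \<in> set (fst e)"
  by (auto simp: row_def count_list_0_iff)

text \<open>A trivial kernel makes the rows independent, and independent rows can be solved for
  every right-hand side; the solution is reduced modulo 3 to an assignment.\<close>

lemma unsatisfiable_left_ker:
  assumes "F \<subseteq> equations k n" "\<not> satisfiable n F"
  shows "\<exists>l\<in>left_ker F. supp F l \<noteq> {}"
proof (rule ccontr)
  assume *: "\<not> ?thesis"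
  have fin: "finite F" using assms finite_equations finite_subset by blast
  \<comment> \<open>Columns outside {1..n} vanish, so the relation at the variables, which is all
    that \<open>indep_mod3\<close> offers, extends to all indices, as \<open>left_ker\<close>
    demands.\<close>
  have out: "comb F l x = 0" if "x \<notin> {1..n}" for l x
    unfolding comb_def
  proof (intro sum.neutral ballI)
    fix e assume "e \<in> F"
    then have "x \<notin> set (fst e)" using assms that equations_iff by blast
    then show "l e * row e x = 0" by (simp add: row_nonzero_iff[symmetric])
  qed
  have "indep_mod3 row {1..n} F"
    unfolding indep_mod3_def
  proof (intro allI impI ballI)
    fix l e assume l: "\<forall>x\<in>{1..n}. [(\<Sum>e\<in>F. l e * row e x) = 0] (mod 3)" and e: "e \<in> F"
    have "[comb F l x = 0] (mod 3)" for x
      using l out by (cases "x \<in> {1..n}") (auto simp: comb_def)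
    then have "reduce F l \<in> left_ker F" by (rule reduce_in_left_ker)
    then have "reduce F l e = 0" using * e unfolding supp_def by blast
    then show "[l e = 0] (mod 3)" using e by (simp add: reduce_def cong_def)
  qed
  then obtain s where s: "\<And>e. e \<in> F \<Longrightarrow> [(\<Sum>x\<in>{1..n}. row e x * s x) = int (snd e)] (mod 3)"
    using indep_mod3_solvable[OF fin, of "{1..n}" row "\<lambda>e. int (snd e)"] by blast
  define \<sigma> where "\<sigma> x = nat (s x mod 3)" for x
  have "satisfies \<sigma> e" if e: "e \<in> F" for e
  proof -
    have "set (fst e) \<subseteq> {1..n}" using assms e equations_iff by blast
    then have "int (\<Sum>y\<leftarrow>fst e. \<sigma> y) = (\<Sum>x\<in>{1..n}. row e x * (s x mod 3))"
      by (subst sum_list_map_eq_sum_count2[of _ "{1..n}"]) (auto simp: row_def \<sigma>_def)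
    also have "[\<dots> = (\<Sum>x\<in>{1..n}. row e x * s x)] (mod 3)"
      by (intro cong_sum cong_mult) (auto simp: cong_def)
    also have "[(\<Sum>x\<in>{1..n}. row e x * s x) = int (snd e)] (mod 3)" using s e by simp
    finally show ?thesis unfolding satisfies_def by (metis cong_int_iff of_nat_numeral)
  qed
  moreover have "\<sigma> x \<in> {0, 1, 2}" for x
  proof -
    have "s x mod 3 \<in> {0, 1, 2}" by (rule mod_3_in)
    then show ?thesis by (auto simp: \<sigma>_def)
  qed
  ultimately have "satisfiable n F" unfolding satisfiable_def by blast
  then show False using assms by simp
qed

definition unit :: "nat \<Rightarrow> nat \<Rightarrow> int" where
  "unit x y = (if y = x then 1 else 0)"

text \<open>The differences \<open>unit x - unit z\<close> for \<open>x\<close> in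
  \<open>D - {z}\<close> are independent: at a column \<open>y\<close> in \<open>D - {z}\<close> a
  combination of them shows exactly the coefficient of \<open>y\<close>. Dimensions are compared by
  counting: the coefficient vectors over \<open>D - {z}\<close> embed into those over
  \<open>F\<close>.\<close>

lemma card_equivalent_le:
  assumes "finite F" "finite D" "z \<in> D"
    and "\<And>x. x \<in> D \<Longrightarrow> in_span F (\<lambda>y. unit x y - unit z y)"
  shows "card D \<le> card F + 1"
proof -
  let ?D = "D - {z}"
  obtain l where l: "\<And>x y. x \<in> D \<Longrightarrow> [unit x y - unit z y = comb F (l x) y] (mod 3)"
    using assms(4) unfolding in_span_def by metis
  define \<phi> where "\<phi> f = reduce F (\<lambda>e. \<Sum>x\<in>?D. f x * l x e)" for f :: "nat \<Rightarrow> int"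
  have comb_\<phi>: "[comb F (\<phi> f) y = f y] (mod 3)" if y: "y \<in> ?D" for f y
  proof -
    have "[comb F (\<phi> f) y = comb F (\<lambda>e. \<Sum>x\<in>?D. f x * l x e) y] (mod 3)"
      unfolding \<phi>_def by (rule comb_reduce)
    also have "comb F (\<lambda>e. \<Sum>x\<in>?D. f x * l x e) y = (\<Sum>x\<in>?D. f x * comb F (l x) y)"
      unfolding comb_def sum_distrib_left sum_distrib_right
      by (subst sum.swap) (simp add: algebra_simps)
    also have "[\<dots> = (\<Sum>x\<in>?D. f x * (unit x y - unit z y))] (mod 3)"
      using l by (intro cong_sum cong_mult) (auto intro: cong_sym)
    also have "(\<Sum>x\<in>?D. f x * (unit x y - unit z y)) = (\<Sum>x\<in>?D. if x = y then f x else 0)"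
      using y by (intro sum.cong) (auto simp: unit_def)
    also have "\<dots> = f y" using y assms by simp
    finally show ?thesis .
  qed
  have "inj_on \<phi> (?D \<rightarrow>\<^sub>E {0, 1, 2})"
  proof (rule inj_onI)
    fix f g assume f: "f \<in> ?D \<rightarrow>\<^sub>E {0, 1, 2}" and g: "g \<in> ?D \<rightarrow>\<^sub>E {0, 1, 2}" and eq: "\<phi> f = \<phi> g"
    show "f = g"
    proof (rule PiE_ext[OF f g])
      fix y assume y: "y \<in> ?D"
      then have "[f y = g y] (mod 3)"
        using comb_\<phi>[OF y, of f] comb_\<phi>[OF y, of g] eq by (metis cong_sym cong_trans)
      moreover have "f y \<in> {0, 1, 2}" "g y \<in> {0, 1, 2}" using PiE_mem[OF f y] PiE_mem[OF g y] by auto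
      ultimately show "f y = g y" by (auto simp: cong_def)
    qed
  qed
  moreover have "\<phi> ` (?D \<rightarrow>\<^sub>E {0, 1, 2}) \<subseteq> F \<rightarrow>\<^sub>E {0, 1, 2}"
    unfolding \<phi>_def using reduce_PiE by blast
  ultimately have "card (?D \<rightarrow>\<^sub>E {0, 1, 2::int}) \<le> card (F \<rightarrow>\<^sub>E {0, 1, 2::int})"
    using assms by (intro card_inj_on_le) (auto intro!: finite_PiE)
  then have "(3::nat) ^ card ?D \<le> 3 ^ card F"
    using assms by (simp add: card_PiE)
  then have "card ?D \<le> card F" by simp
  then show ?thesis using assms by simp
qed

section \<open>Leaf removal and linear combinations of rows\<close>

abbreviation peel :: "nat \<Rightarrow> equation set \<Rightarrow> nat \<Rightarrow> nat set \<times> equation set" where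
  "peel n F i \<equiv> (delete_low ^^ i) ({1..n}, F)"

definition low_vars :: "nat set \<times> equation set \<Rightarrow> nat set" where
  "low_vars S = {x \<in> fst S. occurrences (snd S) x \<le> 1}"

lemma delete_low_eq:
  "delete_low S = (fst S - low_vars S, {e \<in> snd S. set (fst e) \<inter> low_vars S = {}})"
  by (cases S) (simp add: delete_low_def low_vars_def Let_def)

lemma peel_antimono: "i \<le> j \<Longrightarrow> fst (peel n F j) \<subseteq> fst (peel n F i) \<and> snd (peel n F j) \<subseteq> snd (peel n F i)"
proof (induction j rule: dec_induct)
  case (step j)
  then show ?case by (auto simp: delete_low_eq)
qed simp

lemma core_subset:
  "snd (two_core n F) \<subseteq> F" "fst (two_core n F) \<subseteq> {1..n}"
  using peel_antimono[of 0 n n F] by (auto simp: two_core_def)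

lemma low_var_count:
  assumes "finite G" "occurrences G x \<le> 1" "e \<in> G" "x \<in> set (fst e)"
  shows "count_list (fst e) x = 1" "\<And>f. f \<in> G \<Longrightarrow> f \<noteq> e \<Longrightarrow> count_list (fst f) x = 0"
proof -
  have "count_list (fst e) x \<noteq> 0" using assms by (simp add: count_list_0_iff)
  moreover have *: "occurrences G x = count_list (fst e) x + (\<Sum>f\<in>G - {e}. count_list (fst f) x)"
    using assms unfolding occurrences_def by (simp add: sum.remove)
  ultimately show "count_list (fst e) x = 1" using assms by linarith
  then have "(\<Sum>f\<in>G - {e}. count_list (fst f) x) = 0" using * assms by linarith
  then show "\<And>f. f \<in> G \<Longrightarrow> f \<noteq> e \<Longrightarrow> count_list (fst f) x = 0" using assms by simp
qed

text \<open>A variable \<open>x\<close> removed in a round lies in at most one remaining equation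
  \<open>e\<close>, and there only once, so the combination has the value \<open>l e\<close> at
  \<open>x\<close>. As \<open>w\<close> vanishes at \<open>x\<close>, the coefficient of every
  removed equation is 0 modulo 3.\<close>

lemma peel_combination:
  assumes "finite F" and w: "\<And>x. [w x = comb F l x] (mod 3)"
    and vanish: "\<And>x. x \<notin> fst (two_core n F) \<Longrightarrow> w x = 0" and "i \<le> n"
  shows "(\<forall>x. [w x = comb (snd (peel n F i)) l x] (mod 3)) \<and> (\<forall>e\<in>F - snd (peel n F i). [l e = 0] (mod 3))"
  using \<open>i \<le> n\<close>
proof (induction i)
  case 0
  then show ?case using w by simp
next
  case (Suc i)
  define S where "S = peel n F i"
  have fin: "finite (snd S)" using peel_antimono[of 0 i n F] assms(1) finite_subset by (auto simp: S_def)
  have IH: "\<And>x. [w x = comb (snd S) l x] (mod 3)" "\<And>e. e \<in> F - snd S \<Longrightarrow> [l e = 0] (mod 3)"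
    using Suc by (auto simp: S_def)
  have next': "snd (peel n F (Suc i)) = {e \<in> snd S. set (fst e) \<inter> low_vars S = {}}"
    "fst (peel n F (Suc i)) = fst S - low_vars S"
    by (simp_all add: delete_low_eq S_def)
  have l0: "[l e = 0] (mod 3)" if e: "e \<in> snd S" "x \<in> set (fst e)" "x \<in> low_vars S" for e x
  proof -
    have occ: "occurrences (snd S) x \<le> 1" using e by (simp add: low_vars_def)
    have "x \<notin> fst (two_core n F)"
      using peel_antimono[of "Suc i" n n F] Suc.prems next'(2) e by (auto simp: two_core_def simp del: funpow.simps)
    then have "w x = 0" using vanish by simp
    moreover have "comb (snd S) l x = l e"
    proof -
      have "comb (snd S) l x = l e * row e x + (\<Sum>f\<in>snd S - {e}. l f * row f x)"
        using e fin unfolding comb_def by (simp add: sum.remove)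
      also have "(\<Sum>f\<in>snd S - {e}. l f * row f x) = 0"
        using low_var_count(2)[OF fin occ e(1,2)] by (intro sum.neutral) (auto simp: row_def)
      finally show ?thesis using low_var_count(1)[OF fin occ e(1,2)] by (simp add: row_def)
    qed
    ultimately show ?thesis using IH(1)[of x] by (simp add: cong_sym)
  qed
  have "[comb (snd S) l x = comb (snd (peel n F (Suc i))) l x] (mod 3)" for x
  proof -
    have "[comb (snd S) l x = comb (snd S) (\<lambda>e. if e \<in> snd (peel n F (Suc i)) then l e else 0) x] (mod 3)"
      unfolding next' using l0 by (intro comb_cong_mod3) auto
    also have "comb (snd S) (\<lambda>e. if e \<in> snd (peel n F (Suc i)) then l e else 0) x
        = comb (snd (peel n F (Suc i))) (\<lambda>e. if e \<in> snd (peel n F (Suc i)) then l e else 0) x"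
      using fin next' by (intro comb_mono_zero) auto
    also have "\<dots> = comb (snd (peel n F (Suc i))) l x"
      unfolding comb_def by (intro sum.cong) auto
    finally show ?thesis .
  qed
  then have "[w x = comb (snd (peel n F (Suc i))) l x] (mod 3)" for x
    using IH(1) cong_trans by blast
  moreover have "[l e = 0] (mod 3)" if "e \<in> F - snd (peel n F (Suc i))" for e
    using that IH(2) l0 unfolding next' by blast
  ultimately show ?case by blast
qed

lemma in_span_core:
  assumes "finite F" "in_span F w" "\<And>x. x \<notin> fst (two_core n F) \<Longrightarrow> w x = 0"
  shows "in_span (snd (two_core n F)) w"
  using assms peel_combination[of F w _ n n] unfolding in_span_def two_core_def by blast

text \<open>The case of the zero vector in \<open>peel_combination\<close>. A lower bound on
  supports thereby becomes one on the size of the core.\<close>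

lemma supp_subset_core:
  assumes "finite F" "l \<in> left_ker F"
  shows "supp F l \<subseteq> snd (two_core n F)"
proof
  fix e assume e: "e \<in> supp F l"
  show "e \<in> snd (two_core n F)"
  proof (rule ccontr)
    assume *: "e \<notin> snd (two_core n F)"
    have "[0 = comb F l x] (mod 3)" for x using assms unfolding left_ker_def by (auto intro: cong_sym)
    then have "[l e = 0] (mod 3)"
      using peel_combination[of F "\<lambda>_. 0" l n n] assms e * by (auto simp: two_core_def supp_def)
    moreover have "l e \<in> {0, 1, 2}" using assms(2) e left_ker_values[of l F e] by (simp add: supp_def)
    ultimately show False using e by (auto simp: supp_def cong_def)
  qed
qed

text \<open>Each removed variable takes at most one equation with it, so the excess of equations
  over variables never decreases.\<close>

lemma delete_low_card:
  assumes "finite (fst S)" "finite (snd S)"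
  shows "card (snd S) + card (fst (delete_low S)) \<le> card (fst S) + card (snd (delete_low S))"
proof -
  let ?L = "low_vars S" and ?D = "\<lambda>x. {e \<in> snd S. x \<in> set (fst e)}"
  have L: "?L \<subseteq> fst S" by (auto simp: low_vars_def)
  then have finL: "finite ?L" using assms finite_subset by blast
  have "card (?D x) \<le> 1" if "x \<in> ?L" for x
  proof (cases "?D x = {}")
    case False
    then obtain e where e: "e \<in> snd S" "x \<in> set (fst e)" by auto
    have "?D x \<subseteq> {e}"
    proof
      fix f assume "f \<in> ?D x"
      then show "f \<in> {e}"
        using low_var_count(2)[OF assms(2) _ e, of f] that by (auto simp: low_vars_def count_list_0_iff)
    qed
    then show ?thesis using card_mono[of "{e}"] by simp
  next
    case True
    then show ?thesis by (simp only: True card.empty)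
  qed
  then have "card (\<Union>x\<in>?L. ?D x) \<le> (\<Sum>x\<in>?L. 1)"
    by (intro order_trans[OF card_UN_le[OF finL]] sum_mono)
  moreover have eq: "snd S = (\<Union>x\<in>?L. ?D x) \<union> snd (delete_low S)"
    by (auto simp: delete_low_eq)
  have "card (snd S) \<le> card (\<Union>x\<in>?L. ?D x) + card (snd (delete_low S))"
    by (rule order_trans[OF eq_refl[OF arg_cong[OF eq, of card]] card_Un_le])
  moreover have "card (fst (delete_low S)) = card (fst S) - card ?L" "card ?L \<le> card (fst S)"
    using L assms by (auto simp: delete_low_eq card_Diff_subset finL card_mono)
  ultimately show ?thesis by simp
qed

lemma core_card:
  assumes "finite F"
  shows "card F + card (fst (two_core n F)) \<le> n + card (snd (two_core n F))"
proof -
  have "card F + card (fst (peel n F i)) \<le> n + card (snd (peel n F i))" for i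
  proof (induction i)
    case (Suc i)
    have "finite (fst (peel n F i))" "finite (snd (peel n F i))"
      using peel_antimono[of 0 i n F] assms finite_subset by auto
    from delete_low_card[OF this] Suc show ?case by simp
  qed simp
  then show ?thesis by (simp add: two_core_def)
qed

lemma core_occurrences:
  assumes "x \<in> fst (two_core n F)"
  shows "occurrences (snd (two_core n F)) x \<ge> 2"
proof -
  have "low_vars (two_core n F) = {}"
    using delete_low_two_core[of n F] by (auto simp: delete_low_eq low_vars_def prod_eq_iff)
  then show ?thesis using assms by (auto simp: low_vars_def)
qed

lemma core_equation_vars:
  assumes "F \<subseteq> equations k n" "e \<in> snd (two_core n F)"
  shows "set (fst e) \<subseteq> fst (two_core n F)"
proof -
  have "\<forall>e\<in>snd (peel n F i). set (fst e) \<subseteq> fst (peel n F i)" for i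
  proof (induction i)
    case 0
    then show ?case using assms equations_iff by simp blast
  next
    case (Suc i)
    then show ?case unfolding funpow.simps o_apply delete_low_eq by (simp del: split_paired_All) blast
  qed
  then show ?thesis using assms by (simp add: two_core_def)
qed

subsection \<open>Random subsets\<close>

text \<open>The expectation over a random subset of \<open>E\<close> with inclusion probability
  \<open>p\<close>, written as a finite sum. The algebraic identities below then hold for every real
  \<open>p\<close>, mostly by induction on \<open>E\<close>; the bounds on \<open>p\<close> enter
  with monotonicity and with the translation from \<open>random_formula\<close>.\<close>

definition expect :: "real \<Rightarrow> 'a set \<Rightarrow> ('a set \<Rightarrow> real) \<Rightarrow> real" where
  "expect p E h = (\<Sum>F\<in>Pow E. p ^ card F * (1 - p) ^ card (E - F) * h F)"

lemma expect_empty [simp]: "expect p {} h = h {}"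
  by (simp add: expect_def)

lemma expect_insert:
  assumes "finite E" "e \<notin> E"
  shows "expect p (insert e E) h = p * expect p E (\<lambda>F. h (insert e F)) + (1 - p) * expect p E h"
proof -
  let ?w = "\<lambda>E F. p ^ card F * (1 - p) ^ card (E - F)"
  have inj: "inj_on (insert e) (Pow E)" using assms by (intro inj_onI) (metis Pow_iff insert_ident subset_iff)
  have "expect p (insert e E) h = (\<Sum>F\<in>Pow E. ?w (insert e E) F * h F) + (\<Sum>F\<in>insert e ` Pow E. ?w (insert e E) F * h F)"
    unfolding expect_def Pow_insert using assms by (intro sum.union_disjoint) auto
  also have "(\<Sum>F\<in>insert e ` Pow E. ?w (insert e E) F * h F) = (\<Sum>F\<in>Pow E. ?w (insert e E) (insert e F) * h (insert e F))"
    using inj by (simp add: sum.reindex)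
  also have "\<dots> = (\<Sum>F\<in>Pow E. p * (?w E F * h (insert e F)))"
  proof (intro sum.cong refl)
    fix F assume F: "F \<in> Pow E"
    then have "finite F" "e \<notin> F" "insert e E - insert e F = E - F"
      using assms finite_subset by auto
    then show "?w (insert e E) (insert e F) * h (insert e F) = p * (?w E F * h (insert e F))" by simp
  qed
  also have "(\<Sum>F\<in>Pow E. ?w (insert e E) F * h F) = (\<Sum>F\<in>Pow E. (1 - p) * (?w E F * h F))"
  proof (intro sum.cong refl)
    fix F assume F: "F \<in> Pow E"
    then have "insert e E - F = insert e (E - F)" "e \<notin> E - F" "finite (E - F)" using assms by auto
    then show "?w (insert e E) F * h F = (1 - p) * (?w E F * h F)" by simp
  qed
  finally show ?thesis by (simp add: expect_def sum_distrib_left)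
qed

lemma expect_cong: "(\<And>F. F \<subseteq> E \<Longrightarrow> g F = h F) \<Longrightarrow> expect p E g = expect p E h"
  unfolding expect_def by (intro sum.cong) auto

lemma expect_add: "expect p E (\<lambda>F. g F + h F) = expect p E g + expect p E h"
  by (simp add: expect_def sum.distrib algebra_simps)

lemma expect_cmult: "expect p E (\<lambda>F. c * h F) = c * expect p E h"
  by (simp add: expect_def sum_distrib_left algebra_simps)

lemma expect_diff: "expect p E (\<lambda>F. g F - h F) = expect p E g - expect p E h"
  by (simp add: expect_def sum_subtractf algebra_simps)

lemma expect_sum: "expect p E (\<lambda>F. \<Sum>i\<in>I. h i F) = (\<Sum>i\<in>I. expect p E (h i))"
  unfolding expect_def sum_distrib_left by (subst sum.swap) simp

lemma expect_mono:
  assumes "0 \<le> p" "p \<le> 1" "\<And>F. F \<subseteq> E \<Longrightarrow> g F \<le> h F"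
  shows "expect p E g \<le> expect p E h"
  unfolding expect_def using assms by (intro sum_mono mult_left_mono mult_nonneg_nonneg zero_le_power) auto

lemma expect_const [simp]:
  assumes "finite E"
  shows "expect p E (\<lambda>F. c) = c"
  using assms by (induction E rule: finite_induct) (auto simp: expect_insert algebra_simps)

lemma expect_nonneg:
  assumes "0 \<le> p" "p \<le> 1" "\<And>F. F \<subseteq> E \<Longrightarrow> 0 \<le> h F"
  shows "0 \<le> expect p E h"
  unfolding expect_def using assms by (intro sum_nonneg mult_nonneg_nonneg zero_le_power) auto

lemma expect_Un:
  assumes "finite A" "finite B" "A \<inter> B = {}"
  shows "expect p (A \<union> B) h = expect p A (\<lambda>F. expect p B (\<lambda>G. h (F \<union> G)))"
  using assms(1,3)
proof (induction A arbitrary: h rule: finite_induct)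
  case (insert e A)
  have "expect p (insert e A \<union> B) h = p * expect p (A \<union> B) (\<lambda>F. h (insert e F)) + (1 - p) * expect p (A \<union> B) h"
    using insert assms(2) by (simp add: expect_insert)
  also have "\<dots> = p * expect p A (\<lambda>F. expect p B (\<lambda>G. h (insert e (F \<union> G)))) + (1 - p) * expect p A (\<lambda>F. expect p B (\<lambda>G. h (F \<union> G)))"
    using insert by simp
  finally show ?case using insert by (simp add: expect_insert)
qed simp

text \<open>Whether \<open>e\<close> is included is independent of the rest \<open>F - {e}\<close>,
  and \<open>h\<close> sees only the rest.\<close>

lemma expect_mem:
  assumes "finite E" "e \<in> E"
  shows "expect p E (\<lambda>F. of_bool (e \<in> F) * h (F - {e})) = p * expect p E (\<lambda>F. h (F - {e}))"
    and "expect p E (\<lambda>F. of_bool (e \<notin> F) * h (F - {e})) = (1 - p) * expect p E (\<lambda>F. h (F - {e}))"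
proof -
  define E' where "E' = E - {e}"
  have E: "E = insert e E'" "finite E'" "e \<notin> E'" using assms by (auto simp: E'_def)
  have a: "expect p E' (\<lambda>F. of_bool (e \<in> F) * h (F - {e})) = 0"
  proof -
    have "expect p E' (\<lambda>F. of_bool (e \<in> F) * h (F - {e})) = expect p E' (\<lambda>_. 0)"
    proof (rule expect_cong)
      fix F assume "F \<subseteq> E'"
      then have "e \<notin> F" using E by auto
      then show "of_bool (e \<in> F) * h (F - {e}) = 0" by simp
    qed
    then show ?thesis using E by simp
  qed
  have b: "expect p E' (\<lambda>F. h (insert e F - {e})) = expect p E' (\<lambda>F. h (F - {e}))"
    by simp
  have c: "expect p E' (\<lambda>F. of_bool (e \<notin> F) * h (F - {e})) = expect p E' (\<lambda>F. h (F - {e}))"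
  proof (rule expect_cong)
    fix F assume "F \<subseteq> E'"
    then have "e \<notin> F" using E by auto
    then show "of_bool (e \<notin> F) * h (F - {e}) = h (F - {e})" by simp
  qed
  have d: "expect p E (\<lambda>F. h (F - {e})) = expect p E' (\<lambda>F. h (F - {e}))"
    unfolding E(1) using E by (simp add: expect_insert algebra_simps)
  show "expect p E (\<lambda>F. of_bool (e \<in> F) * h (F - {e})) = p * expect p E (\<lambda>F. h (F - {e}))"
    unfolding d unfolding E(1) using E a by (simp add: expect_insert)
  show "expect p E (\<lambda>F. of_bool (e \<notin> F) * h (F - {e})) = (1 - p) * expect p E (\<lambda>F. h (F - {e}))"
    unfolding d unfolding E(1) using E c by (simp add: expect_insert)
qed

text \<open>A generating function: the weight \<open>y ^ card F\<close> is carried along because a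
  \<open>y < 1\<close> later penalises formulas with too many equations.\<close>

lemma expect_superset_power:
  assumes "finite E" "S \<subseteq> E"
  shows "expect p E (\<lambda>F. of_bool (S \<subseteq> F) * y ^ card F) = (p * y) ^ card S * (1 - p + p * y) ^ (card E - card S)"
  using assms
proof (induction E arbitrary: S rule: finite_induct)
  case (insert e E)
  show ?case
  proof (cases "e \<in> S")
    case True
    have S: "S - {e} \<subseteq> E" and finS: "finite S" using insert finite_subset by auto
    have "expect p E (\<lambda>F. of_bool (S \<subseteq> insert e F) * y ^ card (insert e F))
        = expect p E (\<lambda>F. y * (of_bool (S - {e} \<subseteq> F) * y ^ card F))"
    proof (rule expect_cong)
      fix F assume F: "F \<subseteq> E"
      then have "finite F" "e \<notin> F" using insert finite_subset by auto
      moreover have "S \<subseteq> insert e F \<longleftrightarrow> S - {e} \<subseteq> F" by auto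
      ultimately show "of_bool (S \<subseteq> insert e F) * y ^ card (insert e F) = y * (of_bool (S - {e} \<subseteq> F) * y ^ card F)"
        by simp
    qed
    also have "\<dots> = y * ((p * y) ^ card (S - {e}) * (1 - p + p * y) ^ (card E - card (S - {e})))"
      by (simp only: expect_cmult insert.IH[OF S])
    finally have 1: "expect p E (\<lambda>F. of_bool (S \<subseteq> insert e F) * y ^ card (insert e F)) = \<dots>" .
    have 2: "expect p E (\<lambda>F. of_bool (S \<subseteq> F) * y ^ card F) = 0"
      using expect_cong[of E "\<lambda>F. of_bool (S \<subseteq> F) * y ^ card F" "\<lambda>_. 0" p] insert True by auto
    have 3: "card S = Suc (card (S - {e}))" by (rule card.remove[OF finS True])
    then show ?thesis
      unfolding expect_insert[OF insert.hyps] 1 2 3 card_insert_disjoint[OF insert.hyps] diff_Suc_Suc power_Suc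
      by (simp add: algebra_simps del: card_Diff_insert card_Diff_singleton)
  next
    case False
    then have S: "S \<subseteq> E" using insert by auto
    have "expect p E (\<lambda>F. of_bool (S \<subseteq> insert e F) * y ^ card (insert e F))
        = expect p E (\<lambda>F. y * (of_bool (S \<subseteq> F) * y ^ card F))"
    proof (rule expect_cong)
      fix F assume F: "F \<subseteq> E"
      then have "finite F" "e \<notin> F" using insert finite_subset by auto
      moreover have "S \<subseteq> insert e F \<longleftrightarrow> S \<subseteq> F" using False by auto
      ultimately show "of_bool (S \<subseteq> insert e F) * y ^ card (insert e F) = y * (of_bool (S \<subseteq> F) * y ^ card F)"
        by simp
    qed
    moreover have "card (insert e E) - card S = Suc (card E - card S)"
      using insert S card_mono[of E S] by simp
    ultimately show ?thesis using insert.IH[OF S] insert by (simp add: expect_insert expect_cmult algebra_simps)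
  qed
qed simp

lemma expect_superset:
  assumes "finite E" "S \<subseteq> E"
  shows "expect p E (\<lambda>F. of_bool (S \<subseteq> F)) = p ^ card S"
  using expect_superset_power[OF assms, of p 1] by simp

lemma expect_card:
  fixes p :: real
  assumes "finite E"
  shows "expect p E (\<lambda>F. real (card F)) = p * card E"
  using assms
proof (induction E rule: finite_induct)
  case (insert e E)
  have "expect p E (\<lambda>F. real (card (insert e F))) = expect p E (\<lambda>F. 1 + real (card F))"
    using insert by (intro expect_cong) (auto simp: subset_iff finite_subset card_insert_if)
  then show ?case using insert by (simp add: expect_insert expect_add algebra_simps)
qed simp

lemma expect_variance:
  fixes p :: real
  assumes "finite E"
  shows "expect p E (\<lambda>F. (real (card F) - p * card E)\<^sup>2) = card E * p * (1 - p)"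
  using assms
proof (induction E rule: finite_induct)
  case (insert e E)
  let ?X = "\<lambda>F. real (card F) - p * card E"
  have m: "expect p E ?X = 0" using insert by (simp add: expect_diff expect_card)
  have sq: "expect p E (\<lambda>F. (?X F + a)\<^sup>2) = expect p E (\<lambda>F. (?X F)\<^sup>2) + a\<^sup>2" for a
  proof -
    have "expect p E (\<lambda>F. (?X F + a)\<^sup>2) = expect p E (\<lambda>F. (?X F)\<^sup>2 + (2 * a) * ?X F + a\<^sup>2)"
      by (intro expect_cong) (simp add: power2_eq_square algebra_simps)
    also have "\<dots> = expect p E (\<lambda>F. (?X F)\<^sup>2) + a\<^sup>2"
      unfolding expect_add expect_cmult m using insert by simp
    finally show ?thesis .
  qed
  have "expect p E (\<lambda>F. (real (card (insert e F)) - p * card (insert e E))\<^sup>2) = expect p E (\<lambda>F. (?X F + (1 - p))\<^sup>2)"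
  proof (rule expect_cong)
    fix F assume "F \<subseteq> E"
    then have "finite F" "e \<notin> F" using insert finite_subset by auto
    then show "(real (card (insert e F)) - p * card (insert e E))\<^sup>2 = (?X F + (1 - p))\<^sup>2"
      using insert by (simp add: algebra_simps)
  qed
  moreover have "expect p E (\<lambda>F. (real (card F) - p * card (insert e E))\<^sup>2) = expect p E (\<lambda>F. (?X F + (- p))\<^sup>2)"
    using insert by (intro expect_cong) (simp add: algebra_simps)
  ultimately have "expect p (insert e E) (\<lambda>F. (real (card F) - p * card (insert e E))\<^sup>2)
      = p * (card E * p * (1 - p) + (1 - p)\<^sup>2) + (1 - p) * (card E * p * (1 - p) + (- p)\<^sup>2)"
    unfolding expect_insert[OF insert.hyps] sq insert.IH by (simp only:)
  also have "\<dots> = card (insert e E) * p * (1 - p)"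
    using insert.hyps by (simp add: power2_eq_square algebra_simps)
  finally show ?case .
qed simp

text \<open>The inequality \<open>2 * q * \<bar>X\<bar> \<le> q\<^sup>2 + X\<^sup>2\<close> takes
  the place of Cauchy-Schwarz; with \<open>q\<close> of the order of the standard deviation nothing
  essential is lost.\<close>

lemma expect_abs_card:
  fixes p q :: real
  assumes "finite E" "0 \<le> p" "p \<le> 1" "q > 0"
  shows "expect p E (\<lambda>F. \<bar>real (card F) - p * card E\<bar>) \<le> (q + p * card E / q) / 2"
proof -
  let ?X = "\<lambda>F. real (card F) - p * card E"
  have "expect p E (\<lambda>F. \<bar>?X F\<bar>) \<le> expect p E (\<lambda>F. q / 2 + 1 / (2 * q) * (?X F)\<^sup>2)"
  proof (rule expect_mono[OF assms(2,3)])
    fix F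
    have "0 \<le> (\<bar>?X F\<bar> - q)\<^sup>2" by simp
    then have "2 * q * \<bar>?X F\<bar> \<le> q * q + (?X F)\<^sup>2"
      unfolding power2_diff power2_abs by (simp add: power2_eq_square algebra_simps)
    then show "\<bar>?X F\<bar> \<le> q / 2 + 1 / (2 * q) * (?X F)\<^sup>2" using assms by (simp add: field_simps power2_eq_square)
  qed
  also have "\<dots> = q / 2 + 1 / (2 * q) * (card E * p * (1 - p))"
    unfolding expect_add expect_cmult expect_variance[OF assms(1)] using assms by simp
  also have "\<dots> \<le> q / 2 + 1 / (2 * q) * (card E * p * 1)"
    using assms by (intro add_left_mono mult_left_mono) auto
  finally show ?thesis by (simp add: field_simps)
qed

text \<open>Chebyshev's inequality, with the variance bounded by the mean.\<close>

lemma expect_card_deviation: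
  fixes p a :: real
  assumes "finite E" "0 \<le> p" "p \<le> 1" "a > 0"
  shows "expect p E (\<lambda>F. of_bool (\<bar>real (card F) - p * card E\<bar> \<ge> a)) \<le> p * card E / a\<^sup>2"
proof -
  let ?X = "\<lambda>F. real (card F) - p * card E"
  have "expect p E (\<lambda>F. of_bool (\<bar>?X F\<bar> \<ge> a)) \<le> expect p E (\<lambda>F. 1 / a\<^sup>2 * (?X F)\<^sup>2)"
  proof (rule expect_mono[OF assms(2,3)])
    fix F
    show "of_bool (\<bar>?X F\<bar> \<ge> a) \<le> 1 / a\<^sup>2 * (?X F)\<^sup>2"
    proof (cases "\<bar>?X F\<bar> \<ge> a")
      case True
      then have "a\<^sup>2 \<le> (?X F)\<^sup>2" using assms by (metis abs_le_square_iff abs_of_pos)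
      then show ?thesis using True assms by simp
    qed simp
  qed
  also have "\<dots> = 1 / a\<^sup>2 * (card E * p * (1 - p))"
    unfolding expect_cmult expect_variance[OF assms(1)] ..
  also have "\<dots> \<le> 1 / a\<^sup>2 * (card E * p * 1)"
    using assms by (intro mult_left_mono) auto
  finally show ?thesis by (simp add: field_simps)
qed

text \<open>One element at a time: raising its inclusion probability shifts weight from
  \<open>h F\<close> to the smaller \<open>h (insert e F)\<close>.\<close>

lemma expect_antimono_p:
  assumes "finite E" "0 \<le> p" "p \<le> q" "q \<le> 1" "\<And>F G. F \<subseteq> G \<Longrightarrow> G \<subseteq> E \<Longrightarrow> h G \<le> h F"
  shows "expect q E h \<le> expect p E h"
  using assms(1,5)
proof (induction E arbitrary: h rule: finite_induct)
  case (insert e E)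
  let ?h = "\<lambda>F. h (insert e F)"
  have 1: "expect q E ?h \<le> expect p E ?h"
    by (rule insert.IH, rule insert.prems) auto
  have 2: "expect q E h \<le> expect p E h"
    by (rule insert.IH, rule insert.prems) auto
  have 3: "expect p E ?h \<le> expect p E h"
    using assms by (intro expect_mono insert.prems) auto
  have "expect q (insert e E) h = q * expect q E ?h + (1 - q) * expect q E h"
    using insert by (simp add: expect_insert)
  also have "\<dots> \<le> q * expect p E ?h + (1 - q) * expect p E h"
    using 1 2 assms by (intro add_mono mult_left_mono) auto
  also have "\<dots> = expect p E h - q * (expect p E h - expect p E ?h)" by (simp add: algebra_simps)
  also have "\<dots> \<le> expect p E h - p * (expect p E h - expect p E ?h)"
    using 3 assms by (intro diff_left_mono mult_right_mono) auto
  also have "\<dots> = expect p (insert e E) h"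
    using insert by (simp add: expect_insert algebra_simps)
  finally show ?case .
qed simp

text \<open>Russo's formula in discrete form. For the indicator \<open>h\<close> of an increasing
  event the left side counts the elements of \<open>F\<close> whose removal destroys the event. The
  right side is at most the mean absolute deviation of \<open>card F\<close>, so few elements are
  pivotal on average.\<close>

lemma expect_pivotal:
  assumes "finite E"
  shows "(1 - p) * (\<Sum>e\<in>E. expect p E (\<lambda>F. of_bool (e \<in> F) * (h F - h (F - {e}))))
    = expect p E (\<lambda>F. (real (card F) - p * card E) * h F)"
proof -
  have "(1 - p) * expect p E (\<lambda>F. of_bool (e \<in> F) * (h F - h (F - {e})))
      = expect p E (\<lambda>F. (of_bool (e \<in> F) - p) * h F)" if e: "e \<in> E" for e
  proof -
    have "expect p E (\<lambda>F. of_bool (e \<in> F) * (h F - h (F - {e})))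
        = expect p E (\<lambda>F. of_bool (e \<in> F) * h F) - p * expect p E (\<lambda>F. h (F - {e}))"
      unfolding right_diff_distrib expect_diff expect_mem[OF assms e] ..
    moreover have "(1 - p) * expect p E (\<lambda>F. h (F - {e})) = expect p E (\<lambda>F. of_bool (e \<notin> F) * h F)"
      unfolding expect_mem(2)[OF assms e, symmetric]
    proof (rule expect_cong)
      fix F
      show "of_bool (e \<notin> F) * h (F - {e}) = of_bool (e \<notin> F) * h F" by (cases "e \<in> F") simp_all
    qed
    moreover have "expect p E (\<lambda>F. of_bool (e \<notin> F) * h F) = expect p E h - expect p E (\<lambda>F. of_bool (e \<in> F) * h F)"
      unfolding expect_diff[symmetric] by (intro expect_cong) auto
    moreover have "(1 - p) * (a - p * b) = (1 - p) * a - p * ((1 - p) * b)" for a b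
      by (simp add: algebra_simps)
    moreover have "expect p E (\<lambda>F. (of_bool (e \<in> F) - p) * h F)
        = expect p E (\<lambda>F. of_bool (e \<in> F) * h F) - p * expect p E h"
      unfolding left_diff_distrib expect_diff expect_cmult ..
    ultimately show ?thesis by (simp only:) (simp add: algebra_simps)
  qed
  then have "(1 - p) * (\<Sum>e\<in>E. expect p E (\<lambda>F. of_bool (e \<in> F) * (h F - h (F - {e}))))
      = expect p E (\<lambda>F. \<Sum>e\<in>E. (of_bool (e \<in> F) - p) * h F)"
    by (simp add: sum_distrib_left expect_sum)
  also have "\<dots> = expect p E (\<lambda>F. (real (card F) - p * card E) * h F)"
  proof (rule expect_cong)
    fix F assume F: "F \<subseteq> E"
    have "(\<Sum>e\<in>E. of_bool (e \<in> F) - p) = real (card F) - p * card E"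
      using F assms by (simp add: sum_subtractf Int_absorb1 of_bool_def sum.If_cases Int_def)
        (metis (no_types, lifting) Collect_mem_eq Collect_cong subsetD)
    then show "(\<Sum>e\<in>E. (of_bool (e \<in> F) - p) * h F) = (real (card F) - p * card E) * h F"
      by (simp add: sum_distrib_right[symmetric])
  qed
  finally show ?thesis .
qed

lemma expect_disjoint:
  assumes "finite E" "D \<subseteq> E"
  shows "expect p E (\<lambda>F. of_bool (F \<inter> D = {}) * h F) = (1 - p) ^ card D * expect p E (\<lambda>F. h (F - D))"
proof -
  have finD: "finite D" using assms finite_subset by blast
  have split: "expect p E g = expect p (E - D) (\<lambda>F. expect p D (\<lambda>G. g (F \<union> G)))" for g
    using expect_Un[of "E - D" D p g] assms finD by (simp add: Un_absorb2 Int_commute)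
  have "expect p D (\<lambda>G. of_bool (G = {})) = (1 - p) ^ card D"
    using finD by (induction D rule: finite_induct) (auto simp: expect_insert)
  moreover have "expect p D (\<lambda>G. of_bool ((F \<union> G) \<inter> D = {}) * h (F \<union> G)) = expect p D (\<lambda>G. h F * of_bool (G = {}))"
    if "F \<subseteq> E - D" for F
    using that by (intro expect_cong) auto
  moreover have "expect p D (\<lambda>G. h ((F \<union> G) - D)) = h F" if "F \<subseteq> E - D" for F
  proof -
    have "expect p D (\<lambda>G. h ((F \<union> G) - D)) = expect p D (\<lambda>G. h F)"
      using that by (intro expect_cong arg_cong[where f = h]) auto
    then show ?thesis using finD by simp
  qed
  ultimately have *: "expect p D (\<lambda>G. of_bool ((F \<union> G) \<inter> D = {}) * h (F \<union> G))
      = (1 - p) ^ card D * expect p D (\<lambda>G. h ((F \<union> G) - D))" if "F \<subseteq> E - D" for F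
    using that by (simp only: expect_cmult) (simp only: mult.commute)
  show ?thesis
    unfolding split[of "\<lambda>F. of_bool (F \<inter> D = {}) * h F"] split[of "\<lambda>F. h (F - D)"] expect_cmult[symmetric]
    by (rule expect_cong) (simp only: * expect_cmult)
qed

lemma prob_random_formula:
  assumes "0 \<le> p" "p \<le> 1"
  shows "measure_pmf.prob (random_formula k n p) A = expect p (equations k n) (\<lambda>F. of_bool (F \<in> A))"
proof -
  let ?E = "equations k n"
  let ?M = "Pi_pmf ?E False (\<lambda>_. bernoulli_pmf p)"
  have fin: "finite ?E" by (rule finite_equations)
  have pmf: "pmf (random_formula k n p) F = p ^ card F * (1 - p) ^ card (?E - F)" if F: "F \<subseteq> ?E" for F
  proof -
    have "pmf (random_formula k n p) F = measure_pmf.prob ?M ({b. {e \<in> ?E. b e} = F} \<inter> set_pmf ?M)"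
      unfolding random_formula_def pmf_map measure_Int_set_pmf by (simp add: vimage_def)
    \<comment> \<open>Outside \<open>?E\<close> a sampled \<open>b\<close> has the default value
      \<open>False\<close>, so it is determined by the set it includes.\<close>
    also have "{b. {e \<in> ?E. b e} = F} \<inter> set_pmf ?M = {\<lambda>e. e \<in> F} \<inter> set_pmf ?M"
      using F set_Pi_pmf_subset'[OF fin, of False "\<lambda>_. bernoulli_pmf p"] by (fastforce simp: PiE_dflt_def)
    also have "measure_pmf.prob ?M \<dots> = pmf ?M (\<lambda>e. e \<in> F)"
      by (simp add: measure_Int_set_pmf measure_pmf_single)
    also have "\<dots> = (\<Prod>e\<in>?E. pmf (bernoulli_pmf p) (e \<in> F))"
      using F by (intro pmf_Pi'[OF fin]) auto
    also have "\<dots> = (\<Prod>e\<in>F. pmf (bernoulli_pmf p) (e \<in> F)) * (\<Prod>e\<in>?E - F. pmf (bernoulli_pmf p) (e \<in> F))"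
      using F fin by (subst prod.subset_diff[of F]) (auto simp: mult.commute)
    also have "\<dots> = (\<Prod>e\<in>F. p) * (\<Prod>e\<in>?E - F. 1 - p)"
      using assms by (intro arg_cong2[where f = "(*)"] prod.cong) auto
    finally show ?thesis by simp
  qed
  have "set_pmf (random_formula k n p) \<subseteq> Pow ?E"
    by (auto simp: random_formula_def)
  then have "measure_pmf.prob (random_formula k n p) A = measure_pmf.prob (random_formula k n p) (Pow ?E \<inter> A)"
    by (intro measure_prob_cong_0) (auto simp: set_pmf_iff)
  also have "\<dots> = (\<Sum>F\<in>Pow ?E \<inter> A. pmf (random_formula k n p) F)"
    using fin by (intro measure_measure_pmf_finite) auto
  also have "\<dots> = (\<Sum>F\<in>Pow ?E \<inter> A. p ^ card F * (1 - p) ^ card (?E - F))"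
    using pmf by (intro sum.cong) auto
  also have "\<dots> = expect p ?E (\<lambda>F. of_bool (F \<in> A))"
    unfolding expect_def using fin by (intro sum.mono_neutral_cong_left) auto
  finally show ?thesis .
qed

subsection \<open>Characters modulo 3\<close>

definition \<omega> :: complex where
  "\<omega> = cis (2 * pi / 3)"

lemma omega_eq: "\<omega> = Complex (-1/2) (sqrt 3 / 2)"
proof -
  have "cos (2 * pi / 3) = - 1 / 2" "sin (2 * pi / 3) = sqrt 3 / 2"
    using cos_120 sin_120 by (simp_all add: mult.commute)
  then show ?thesis by (simp add: \<omega>_def complex_eq_iff)
qed

lemma omega_cube: "\<omega> ^ 3 = 1"
  unfolding \<omega>_def Complex.DeMoivre by simp

lemma omega_sum: "1 + \<omega> + \<omega>\<^sup>2 = 0"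
  by (simp add: omega_eq complex_eq_iff power2_eq_square)

lemma omega_square: "\<omega>\<^sup>2 = cnj \<omega>"
  using omega_sum by (simp add: omega_eq complex_eq_iff power2_eq_square)

lemma omega_power_mod: "\<omega> ^ m = \<omega> ^ (m mod 3)"
proof -
  have "\<omega> ^ m = \<omega> ^ (3 * (m div 3) + m mod 3)" by simp
  also have "\<dots> = (\<omega> ^ 3) ^ (m div 3) * \<omega> ^ (m mod 3)" by (simp only: power_add power_mult)
  finally show ?thesis by (simp add: omega_cube)
qed

lemma omega_indicator: "(\<Sum>j\<in>{0, 1, 2::nat}. \<omega> ^ (j * m)) = (if 3 dvd m then 3 else 0)"
proof -
  have "m mod 3 = 0 \<or> m mod 3 = 1 \<or> m mod 3 = 2" by presburger
  moreover have "\<omega> ^ (2 * m) = (\<omega> ^ m)\<^sup>2" by (simp add: power_mult[symmetric] mult.commute)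
  then have "(\<Sum>j\<in>{0, 1, 2::nat}. \<omega> ^ (j * m)) = 1 + \<omega> ^ (m mod 3) + (\<omega> ^ (m mod 3))\<^sup>2"
    by (simp add: omega_power_mod[of m])
  moreover have "(\<omega>\<^sup>2)\<^sup>2 = \<omega>"
    using omega_cube by (simp add: power2_eq_square power3_eq_cube mult.assoc)
  ultimately show ?thesis using omega_sum by (auto simp: dvd_eq_mod_eq_0 algebra_simps)
qed

text \<open>Orthogonality of characters at each coordinate \<open>x\<close>: divisibility by 3
  becomes a sum over the character index \<open>v x\<close>. Expanding the product over
  \<open>V\<close> and exchanging the sums decouples the positions \<open>i\<close>. Here
  \<open>c i t x\<close> is what the choice \<open>t\<close> at position \<open>i\<close> adds to
  coordinate \<open>x\<close>.\<close>

lemma card_vanishing_mod3: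
  fixes c :: "'i \<Rightarrow> 't \<Rightarrow> 'x \<Rightarrow> nat"
  assumes "finite I" "finite V" "\<And>i. i \<in> I \<Longrightarrow> finite (T i)"
  shows "3 ^ card V * of_nat (card {f \<in> Pi\<^sub>E I T. \<forall>x\<in>V. 3 dvd (\<Sum>i\<in>I. c i (f i) x)})
    = (\<Sum>v\<in>V \<rightarrow>\<^sub>E {0, 1, 2::nat}. \<Prod>i\<in>I. \<Sum>t\<in>T i. \<Prod>x\<in>V. \<omega> ^ (v x * c i t x))"
proof -
  let ?P = "Pi\<^sub>E I T"
  have finP: "finite ?P" using assms by (auto intro!: finite_PiE)
  have "3 ^ card V * of_nat (card {f \<in> ?P. \<forall>x\<in>V. 3 dvd (\<Sum>i\<in>I. c i (f i) x)})
      = (\<Sum>f\<in>?P. \<Prod>x\<in>V. if 3 dvd (\<Sum>i\<in>I. c i (f i) x) then 3 else (0::complex))"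
  proof -
    have "(\<Prod>x\<in>V. if 3 dvd (\<Sum>i\<in>I. c i (f i) x) then 3 else (0::complex))
        = (if \<forall>x\<in>V. 3 dvd (\<Sum>i\<in>I. c i (f i) x) then 3 ^ card V else 0)" for f
      using assms by auto
    then show ?thesis using finP by (simp add: sum.If_cases Int_def mult.commute)
  qed
  also have "\<dots> = (\<Sum>f\<in>?P. \<Prod>x\<in>V. \<Sum>j\<in>{0, 1, 2::nat}. \<omega> ^ (j * (\<Sum>i\<in>I. c i (f i) x)))"
    by (simp only: omega_indicator)
  also have "\<dots> = (\<Sum>f\<in>?P. \<Sum>v\<in>V \<rightarrow>\<^sub>E {0, 1, 2}. \<Prod>x\<in>V. \<omega> ^ (v x * (\<Sum>i\<in>I. c i (f i) x)))"
    using assms(2) by (subst prod_sum_PiE) auto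
  also have "\<dots> = (\<Sum>v\<in>V \<rightarrow>\<^sub>E {0, 1, 2}. \<Sum>f\<in>?P. \<Prod>i\<in>I. \<Prod>x\<in>V. \<omega> ^ (v x * c i (f i) x))"
    by (subst sum.swap, subst prod.swap) (simp add: sum_distrib_left power_sum)
  also have "\<dots> = (\<Sum>v\<in>V \<rightarrow>\<^sub>E {0, 1, 2}. \<Prod>i\<in>I. \<Sum>t\<in>T i. \<Prod>x\<in>V. \<omega> ^ (v x * c i t x))"
    using assms by (subst prod_sum_PiE) auto
  finally show ?thesis .
qed

lemma sum_lists_prod_count:
  fixes g :: "'x \<Rightarrow> 'b::comm_ring_1"
  assumes "finite V"
  shows "(\<Sum>ys | length ys = k \<and> set ys \<subseteq> V. \<Prod>x\<in>V. g x ^ count_list ys x) = (\<Sum>x\<in>V. g x) ^ k"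
proof (induction k)
  case 0
  have "{ys. length ys = 0 \<and> set ys \<subseteq> V} = {[]}" by auto
  then show ?case by simp
next
  case (Suc k)
  let ?L = "\<lambda>k. {ys. length ys = k \<and> set ys \<subseteq> V}"
  have fin: "finite (?L k)" using finite_lists_length_eq[OF assms, of k] by (simp add: conj_commute)
  have eq: "?L (Suc k) = (\<lambda>(y, ys). y # ys) ` (V \<times> ?L k)"
    by (force simp: length_Suc_conv)
  have "(\<Sum>ys\<in>?L (Suc k). \<Prod>x\<in>V. g x ^ count_list ys x)
      = (\<Sum>(y, ys)\<in>V \<times> ?L k. \<Prod>x\<in>V. g x ^ count_list (y # ys) x)"
    unfolding eq by (subst sum.reindex) (auto simp: inj_on_def case_prod_unfold)
  also have "\<dots> = (\<Sum>(y, ys)\<in>V \<times> ?L k. g y * (\<Prod>x\<in>V. g x ^ count_list ys x))"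
  proof (intro sum.cong refl, clarify)
    fix y ys assume y: "y \<in> V"
    have "(\<Prod>x\<in>V. g x ^ count_list (y # ys) x) = (\<Prod>x\<in>V. (if x = y then g x else 1) * g x ^ count_list ys x)"
      by (intro prod.cong) auto
    also have "\<dots> = g y * (\<Prod>x\<in>V. g x ^ count_list ys x)"
      using y assms by (simp add: prod.distrib)
    finally show "(\<Prod>x\<in>V. g x ^ count_list (y # ys) x) = g y * (\<Prod>x\<in>V. g x ^ count_list ys x)" .
  qed
  also have "\<dots> = (\<Sum>y\<in>V. g y) * (\<Sum>ys\<in>?L k. \<Prod>x\<in>V. g x ^ count_list ys x)"
    by (simp add: sum.cartesian_product[symmetric] sum_product)
  finally show ?case using Suc by simp
qed

definition char_sum :: "'x set \<Rightarrow> ('x \<Rightarrow> nat) \<Rightarrow> complex" where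
  "char_sum V v = (\<Sum>x\<in>V. \<omega> ^ v x)"

text \<open>Mixed moments, up to the factor \<open>3 ^ card V\<close>, of the sum of
  \<open>card V\<close> independent uniform cube roots of unity.\<close>

definition moment :: "'x set \<Rightarrow> nat \<Rightarrow> nat \<Rightarrow> complex" where
  "moment V a b = (\<Sum>v\<in>V \<rightarrow>\<^sub>E {0, 1, 2::nat}. char_sum V v ^ a * cnj (char_sum V v) ^ b)"

lemma cnj_char_sum: "cnj (char_sum V v) = (\<Sum>x\<in>V. \<omega> ^ (2 * v x))"
  by (simp add: char_sum_def omega_square[symmetric] power_mult)

lemma moment_sign:
  assumes "finite V" "finite I" "\<And>i. i \<in> I \<Longrightarrow> s i \<in> {1, 2::nat}"
  shows "(\<Sum>v\<in>V \<rightarrow>\<^sub>E {0, 1, 2::nat}. \<Prod>i\<in>I. (\<Sum>x\<in>V. \<omega> ^ (v x * s i)) ^ k)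
    = moment V (k * card {i \<in> I. s i = 1}) (k * card {i \<in> I. s i = 2})"
  unfolding moment_def
proof (intro sum.cong refl)
  fix v
  have I: "I = {i \<in> I. s i = 1} \<union> {i \<in> I. s i = 2}" using assms by auto
  have "(\<Prod>i\<in>I. (\<Sum>x\<in>V. \<omega> ^ (v x * s i)) ^ k)
      = (\<Prod>i\<in>{i \<in> I. s i = 1}. (\<Sum>x\<in>V. \<omega> ^ (v x * s i)) ^ k) * (\<Prod>i\<in>{i \<in> I. s i = 2}. (\<Sum>x\<in>V. \<omega> ^ (v x * s i)) ^ k)"
    by (subst I, subst prod.union_disjoint) (use assms in auto)
  also have "\<dots> = char_sum V v ^ (k * card {i \<in> I. s i = 1}) * cnj (char_sum V v) ^ (k * card {i \<in> I. s i = 2})"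
    unfolding cnj_char_sum unfolding char_sum_def by (simp add: power_mult mult.commute)
  finally show "(\<Prod>i\<in>I. (\<Sum>x\<in>V. \<omega> ^ (v x * s i)) ^ k) = \<dots>" .
qed

text \<open>Read backwards, orthogonality identifies the moment as \<open>3 ^ card V\<close> times
  the number of sequences of \<open>a + b\<close> elements of \<open>V\<close>, the first
  \<open>a\<close> with weight 1 and the others with weight 2, that give every element a total
  divisible by 3. Nonnegativity allows single terms to be picked out of the generating
  function.\<close>

lemma moment_nonneg:
  assumes "finite V"
  shows "\<exists>N. moment V a b = of_nat N"
proof -
  let ?s = "\<lambda>i. if i < a then 1 else 2::nat"
  have "{i \<in> {..<a+b}. ?s i = 1} = {..<a}" "{i \<in> {..<a+b}. ?s i = 2} = {a..<a+b}" by auto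
  then have c: "card {i \<in> {..<a+b}. ?s i = 1} = a" "card {i \<in> {..<a+b}. ?s i = 2} = b"
    by (simp_all only: card_lessThan card_atLeastLessThan add_diff_cancel_left')
  have "moment V a b = (\<Sum>v\<in>V \<rightarrow>\<^sub>E {0, 1, 2::nat}. \<Prod>i<a+b. (\<Sum>x\<in>V. \<omega> ^ (v x * ?s i)) ^ 1)"
    using assms by (subst moment_sign) (auto simp only: c mult_1 finite_lessThan split: if_splits)
  also have "\<dots> = (\<Sum>v\<in>V \<rightarrow>\<^sub>E {0, 1, 2::nat}. \<Prod>i<a+b. \<Sum>t\<in>V. \<Prod>x\<in>V. \<omega> ^ (v x * (if x = t then ?s i else 0)))"
    using assms by (intro sum.cong prod.cong refl) (auto simp: if_distrib[of "\<lambda>m. _ * m"] if_distrib[of "\<lambda>m. \<omega> ^ m"] prod.delta' intro!: sum.cong cong: if_cong)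
  also have "\<dots> = of_nat (3 ^ card V * card {f \<in> {..<a+b} \<rightarrow>\<^sub>E V. \<forall>x\<in>V. 3 dvd (\<Sum>i<a+b. if x = f i then ?s i else 0)})"
    using card_vanishing_mod3[of "{..<a+b}" V "\<lambda>_. V" "\<lambda>i t x. if x = t then ?s i else 0"] assms
    by simp
  finally show ?thesis by blast
qed

text \<open>The moment generating function of the real part of a uniform cube root of unity.\<close>

definition growth :: "real \<Rightarrow> real" where
  "growth t = (exp t + 2 * exp (- t / 2)) / 3"

text \<open>The sum factorises over \<open>V\<close>. The norm of each exponential is the
  exponential of the real part, which depends on \<open>X + Y\<close> only because conjugate roots
  have the same real part.\<close>

lemma norm_exp_moment_le:
  fixes X Y :: real
  assumes "finite V"
  shows "norm (\<Sum>v\<in>V \<rightarrow>\<^sub>E {0, 1, 2::nat}. exp (X * char_sum V v) * exp (Y * cnj (char_sum V v)))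
    \<le> (3 * growth (X + Y)) ^ card V"
proof -
  have "(\<Sum>v\<in>V \<rightarrow>\<^sub>E {0, 1, 2::nat}. exp (X * char_sum V v) * exp (Y * cnj (char_sum V v)))
      = (\<Sum>v\<in>V \<rightarrow>\<^sub>E {0, 1, 2::nat}. \<Prod>x\<in>V. exp (X * \<omega> ^ v x + Y * \<omega> ^ (2 * v x)))"
    using assms unfolding cnj_char_sum unfolding char_sum_def
    by (simp add: exp_sum[symmetric] exp_add[symmetric] sum.distrib sum_distrib_left)
  also have "\<dots> = (\<Prod>x\<in>V. \<Sum>j\<in>{0, 1, 2::nat}. exp (X * \<omega> ^ j + Y * \<omega> ^ (2 * j)))"
    using assms by (subst prod_sum_PiE) auto
  also have "norm \<dots> = norm (\<Sum>j\<in>{0, 1, 2::nat}. exp (X * \<omega> ^ j + Y * \<omega> ^ (2 * j))) ^ card V"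
    by (simp add: norm_power)
  also have "\<dots> \<le> (3 * growth (X + Y)) ^ card V"
  proof (rule power_mono)
    have "norm (\<Sum>j\<in>{0, 1, 2::nat}. exp (X * \<omega> ^ j + Y * \<omega> ^ (2 * j)))
        \<le> (\<Sum>j\<in>{0, 1, 2::nat}. norm (exp (X * \<omega> ^ j + Y * \<omega> ^ (2 * j))))"
      by (rule norm_sum)
    also have "\<dots> = exp (X + Y) + exp (- (X + Y) / 2) + exp (- (X + Y) / 2)"
    proof -
      have re: "Re \<omega> = - 1 / 2" "Re (\<omega>\<^sup>2) = - 1 / 2"
        unfolding omega_square by (simp_all add: omega_eq)
      have w4: "\<omega> ^ (2 * 2) = \<omega>" using omega_power_mod[of 4] by simp
      have re_lin: "Re (complex_of_real X * a + complex_of_real Y * b) = X * Re a + Y * Re b" for a b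
        by simp
      have "norm (exp (X * \<omega> ^ 0 + Y * \<omega> ^ (2 * 0))) = exp (X + Y)"
        by (simp add: norm_exp_eq_Re)
      moreover have "norm (exp (X * \<omega> ^ 1 + Y * \<omega> ^ (2 * 1))) = exp (- (X + Y) / 2)"
        unfolding norm_exp_eq_Re re_lin mult_1_right power_one_right re by (simp add: field_simps)
      moreover have "norm (exp (X * \<omega> ^ 2 + Y * \<omega> ^ (2 * 2))) = exp (- (X + Y) / 2)"
        unfolding norm_exp_eq_Re re_lin w4 re by (simp add: field_simps)
      moreover have "(\<Sum>j\<in>{0, 1, 2::nat}. f j) = f 0 + f 1 + f 2" for f :: "nat \<Rightarrow> real" by simp
      ultimately show ?thesis by (simp only:)
    qed
    finally show "norm (\<Sum>j\<in>{0, 1, 2::nat}. exp (X * \<omega> ^ j + Y * \<omega> ^ (2 * j))) \<le> 3 * growth (X + Y)"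
      by (simp add: growth_def)
  qed simp
  finally show ?thesis .
qed

text \<open>All moments are nonnegative, so each term of the exponential generating function in
  \<open>X\<close> and \<open>Y\<close> is at most its value. The double series is summed in two
  stages, over \<open>a\<close> for fixed \<open>b\<close> and then over \<open>b\<close>.\<close>

lemma moment_le_growth:
  fixes X Y :: real
  assumes "finite V" "0 \<le> X" "0 \<le> Y"
  shows "Re (moment V a b) * X ^ a * Y ^ b / (fact a * fact b) \<le> (3 * growth (X + Y)) ^ card V"
proof -
  let ?V = "V \<rightarrow>\<^sub>E {0, 1, 2::nat}" and ?z = "char_sum V"
  have re: "0 \<le> Re (moment V a b)" for a b
    using moment_nonneg[OF assms(1), of a b] by auto
  have re_mult: "Re (complex_of_real r * z) = r * Re z" for r z by simp
  define S where "S b = (\<Sum>v\<in>?V. exp (X * ?z v) * cnj (?z v) ^ b)" for b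
  have 1: "(\<lambda>a. Re (moment V a b) * X ^ a / fact a) sums Re (S b)" for b
  proof -
    have "(\<lambda>a. \<Sum>v\<in>?V. ((X * ?z v) ^ a /\<^sub>R fact a) * cnj (?z v) ^ b) sums S b"
      unfolding S_def by (intro sums_sum sums_mult2 exp_converges)
    then have "(\<lambda>a. Re (\<Sum>v\<in>?V. ((X * ?z v) ^ a /\<^sub>R fact a) * cnj (?z v) ^ b)) sums Re (S b)"
      by (rule sums_Re)
    moreover have "(\<Sum>v\<in>?V. ((X * ?z v) ^ a /\<^sub>R fact a) * cnj (?z v) ^ b) = of_real (X ^ a / fact a) * moment V a b" for a
      unfolding moment_def sum_distrib_left
      by (intro sum.cong) (auto simp: power_mult_distrib scaleR_conv_of_real divide_inverse)
    moreover have "Re (of_real (X ^ a / fact a) * moment V a b) = Re (moment V a b) * X ^ a / fact a" for a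
      unfolding re_mult by simp
    ultimately show ?thesis by (simp only:)
  qed
  have S0: "0 \<le> Re (S b)" for b
    using re assms by (intro sums_le[OF _ sums_zero 1[of b]]) simp
  have 2: "(\<lambda>b. Re (S b) * Y ^ b / fact b) sums Re (\<Sum>v\<in>?V. exp (X * ?z v) * exp (Y * cnj (?z v)))"
  proof -
    have "(\<lambda>b. \<Sum>v\<in>?V. exp (X * ?z v) * ((Y * cnj (?z v)) ^ b /\<^sub>R fact b)) sums (\<Sum>v\<in>?V. exp (X * ?z v) * exp (Y * cnj (?z v)))"
      by (intro sums_sum sums_mult exp_converges)
    then have "(\<lambda>b. Re (\<Sum>v\<in>?V. exp (X * ?z v) * ((Y * cnj (?z v)) ^ b /\<^sub>R fact b))) sums Re (\<Sum>v\<in>?V. exp (X * ?z v) * exp (Y * cnj (?z v)))"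
      by (rule sums_Re)
    moreover have "(\<Sum>v\<in>?V. exp (X * ?z v) * ((Y * cnj (?z v)) ^ b /\<^sub>R fact b)) = of_real (Y ^ b / fact b) * S b" for b
      unfolding S_def sum_distrib_left
      by (intro sum.cong) (auto simp: power_mult_distrib scaleR_conv_of_real divide_inverse)
    moreover have "Re (of_real (Y ^ b / fact b) * S b) = Re (S b) * Y ^ b / fact b" for b
      unfolding re_mult by simp
    ultimately show ?thesis by (simp only:)
  qed
  have "Re (moment V a b) * X ^ a / fact a \<le> Re (S b)"
    using sum_le_suminf[OF sums_summable[OF 1[of b]], of "{a}"] sums_unique[OF 1[of b]] re assms by simp
  then have "Re (moment V a b) * X ^ a / fact a * (Y ^ b / fact b) \<le> Re (S b) * (Y ^ b / fact b)"
    using assms by (intro mult_right_mono) auto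
  also have "\<dots> \<le> Re (\<Sum>v\<in>?V. exp (X * ?z v) * exp (Y * cnj (?z v)))"
    using sum_le_suminf[OF sums_summable[OF 2], of "{b}"] sums_unique[OF 2] S0 assms by simp
  also have "\<dots> \<le> (3 * growth (X + Y)) ^ card V"
    using norm_exp_moment_le[OF assms(1)] complex_Re_le_cmod order_trans by blast
  finally show ?thesis by simp
qed

text \<open>Stirling's bound up to a polynomial factor. The induction starts at 1 and proves it with
  the factor \<open>a\<close> in place of \<open>a + 1\<close>; the weaker factor also covers
  \<open>a = 0\<close>.\<close>

lemma fact_le_power: "fact a \<le> exp 1 * (real a + 1) * (real a / exp 1) ^ a"
proof (cases "a = 0")
  case False
  then have "0 < a" by simp
  then have "fact a \<le> exp 1 * real a * (real a / exp 1) ^ a"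
  proof (induction a rule: nat_induct_non_zero)
    case 1
    then show ?case by simp
  next
    case (Suc a)
    let ?a = "real a"
    have "exp 1 \<le> (1 + 1 / ?a) ^ Suc a"
    proof -
      have "1 / (?a + 1) \<le> ln (1 + 1 / ?a)"
        using ln_one_minus_pos_lower_bound Suc ln_le_minus_one[of "?a / (?a + 1)"] 
        by (simp add: ln_div field_simps)
      then have "1 \<le> (?a + 1) * ln (1 + 1 / ?a)" by (simp add: field_simps)
      then have "exp 1 \<le> exp (real (Suc a) * ln (1 + 1 / ?a))" by (simp add: algebra_simps)
      also have "\<dots> = (1 + 1 / ?a) ^ Suc a"
        using Suc by (subst exp_of_nat_mult) (auto simp: add_pos_pos)
      finally show ?thesis .
    qed
    then have *: "exp 1 * ?a ^ Suc a \<le> (?a + 1) ^ Suc a"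
    proof -
      have "(1 + 1 / ?a) * ?a = ?a + 1" using Suc by (simp add: field_simps)
      then have "(1 + 1 / ?a) ^ Suc a * ?a ^ Suc a = (?a + 1) ^ Suc a"
        by (simp only: power_mult_distrib[symmetric])
      then show ?thesis using mult_right_mono[OF \<open>exp 1 \<le> (1 + 1 / ?a) ^ Suc a\<close>, of "?a ^ Suc a"] by simp
    qed
    have "fact (Suc a) \<le> (?a + 1) * (exp 1 * ?a * (?a / exp 1) ^ a)"
      using mult_left_mono[OF Suc.IH, of "?a + 1"] by (simp add: add.commute)
    also have "\<dots> = (?a + 1) * (exp 1 * ?a ^ Suc a) / exp 1 ^ a"
      by (simp add: power_divide)
    also have "\<dots> \<le> (?a + 1) * (?a + 1) ^ Suc a / exp 1 ^ a"
      using * by (intro divide_right_mono mult_left_mono) auto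
    also have "\<dots> = exp 1 * real (Suc a) * (real (Suc a) / exp 1) ^ Suc a"
      unfolding power_divide of_nat_Suc by (simp add: add.commute)
    finally show ?case .
  qed
  also have "\<dots> \<le> exp 1 * (real a + 1) * (real a / exp 1) ^ a"
    by (intro mult_right_mono mult_left_mono) auto
  finally show ?thesis .
qed simp

text \<open>Splitting \<open>t\<close> into \<open>X\<close> and \<open>Y\<close> in the ratio of
  \<open>a\<close> to \<open>b\<close> bounds both \<open>fact a / X ^ a\<close> and
  \<open>fact b / Y ^ b\<close> by powers of the same base \<open>q / (exp 1 * t)\<close>, up to
  polynomial factors, so the result depends on \<open>a + b\<close> only. The parameter
  \<open>t\<close> stays free and is chosen later according to the weight.\<close>

lemma moment_bound:
  assumes "finite V" "t > 0" "a + b > 0"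
  defines "q \<equiv> real (a + b)"
  shows "Re (moment V a b) \<le> (exp 1)\<^sup>2 * (q + 1)\<^sup>2 * (q / (exp 1 * t)) ^ (a + b) * (3 * growth t) ^ card V"
proof -
  define X Y where "X = t * a / q" and "Y = t * b / q"
  have q: "q > 0" using assms(3) by (simp only: q_def of_nat_0_less_iff)
  have XY: "0 \<le> X" "0 \<le> Y" using assms q by (auto simp: X_def Y_def)
  have "X + Y = t * q / q" unfolding X_def Y_def q_def by (simp add: add_divide_distrib algebra_simps)
  then have sum: "X + Y = t" using q by simp
  have f: "fact c \<le> exp 1 * (q + 1) * (q / (exp 1 * t)) ^ c * (t * c / q) ^ c" if "c \<le> a + b" for c
  proof -
    have "fact c \<le> exp 1 * (real c + 1) * (real c / exp 1) ^ c" by (rule fact_le_power)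
    also have "\<dots> \<le> exp 1 * (q + 1) * (real c / exp 1) ^ c"
      using that by (intro mult_right_mono mult_left_mono) (auto simp: q_def)
    also have "(real c / exp 1) ^ c = (q / (exp 1 * t)) ^ c * (t * c / q) ^ c"
      using assms q by (simp add: power_mult_distrib[symmetric])
    finally show ?thesis by (simp add: mult.assoc)
  qed
  \<comment> \<open>If \<open>a = 0\<close> then \<open>X = 0\<close>, but \<open>X ^ 0 = 1\<close>;
    likewise for \<open>b\<close>.\<close>
  have pos: "0 < X ^ a" "0 < Y ^ b" using assms q by (auto simp: X_def Y_def zero_less_power_eq)
  have cancel: "m = m * x * y / (f * g) * (f * g / (x * y))" if "x \<noteq> 0" "y \<noteq> 0" "f \<noteq> 0" "g \<noteq> 0" for m x y f g :: real
    using that by simp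
  have "Re (moment V a b) = Re (moment V a b) * X ^ a * Y ^ b / (fact a * fact b) * (fact a * fact b / (X ^ a * Y ^ b))"
    using pos by (intro cancel) (metis less_irrefl, metis less_irrefl, simp_all)
  also have "\<dots> \<le> (3 * growth t) ^ card V * (fact a * fact b / (X ^ a * Y ^ b))"
    using moment_le_growth[OF assms(1) XY, of a b] pos unfolding sum by (intro mult_right_mono) auto
  also have "\<dots> \<le> (3 * growth t) ^ card V * ((exp 1 * (q + 1) * (q / (exp 1 * t)) ^ a) * (exp 1 * (q + 1) * (q / (exp 1 * t)) ^ b))"
  proof (rule mult_left_mono)
    show "fact a * fact b / (X ^ a * Y ^ b) \<le> (exp 1 * (q + 1) * (q / (exp 1 * t)) ^ a) * (exp 1 * (q + 1) * (q / (exp 1 * t)) ^ b)"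
  proof -
    have "fact a / X ^ a \<le> exp 1 * (q + 1) * (q / (exp 1 * t)) ^ a"
      using f[of a] pos by (simp add: X_def pos_divide_le_eq)
    moreover have "fact b / Y ^ b \<le> exp 1 * (q + 1) * (q / (exp 1 * t)) ^ b"
      using f[of b] pos by (simp add: Y_def pos_divide_le_eq)
    ultimately have "fact a / X ^ a * (fact b / Y ^ b) \<le> (exp 1 * (q + 1) * (q / (exp 1 * t)) ^ a) * (exp 1 * (q + 1) * (q / (exp 1 * t)) ^ b)"
      using pos q assms by (intro mult_mono) auto
    then show ?thesis by simp
  qed
  qed (simp add: growth_def)
  also have "(exp 1 * (q + 1) * (q / (exp 1 * t)) ^ a) * (exp 1 * (q + 1) * (q / (exp 1 * t)) ^ b)
      = (exp 1)\<^sup>2 * (q + 1)\<^sup>2 * (q / (exp 1 * t)) ^ (a + b)"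
    by (simp add: power_add power2_eq_square algebra_simps)
  finally show ?thesis by (simp only: mult.commute)
qed

subsection \<open>Counting circuits\<close>

text \<open>A circuit is a nowhere zero linear relation modulo 3 between the coefficient vectors of \<open>m\<close>
  equations; the right-hand sides play no role.\<close>

definition circuits :: "nat \<Rightarrow> nat \<Rightarrow> nat \<Rightarrow> (equation set \<times> (equation \<Rightarrow> nat)) set" where
  "circuits k n m = {(S, \<mu>). S \<subseteq> equations k n \<and> card S = m \<and> \<mu> \<in> S \<rightarrow>\<^sub>E {1, 2} \<and>
     (\<forall>x\<in>{1..n}. 3 dvd (\<Sum>e\<in>S. \<mu> e * count_list (fst e) x))}"

lemma finite_circuits: "finite (circuits k n m)"
proof -
  have "circuits k n m \<subseteq> (SIGMA S : Pow (equations k n). S \<rightarrow>\<^sub>E {1, 2})"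
    by (auto simp: circuits_def)
  moreover have "finite (SIGMA S : Pow (equations k n). S \<rightarrow>\<^sub>E {1, 2::nat})"
    using finite_equations finite_subset[OF _ finite_equations]
    by (intro finite_SigmaI finite_PiE) auto
  ultimately show ?thesis by (rule finite_subset)
qed

lemma card_bijections: "finite S \<Longrightarrow> card {h \<in> {..<card S} \<rightarrow>\<^sub>E S. inj_on h {..<card S}} = fact (card S)"
  by (subst card_inj_on_subset_funcset) (auto simp: fact_prod_rev)

text \<open>After the change to characters each equation contributes 3, for its right-hand side,
  times the \<open>k\<close>-th power of the character sum, conjugated where the sign is 2. The
  sequences may repeat equations, which is harmless for an upper bound.\<close>

lemma card_signed_sequences:
  fixes s :: "nat \<Rightarrow> nat"
  assumes s: "s \<in> {..<m} \<rightarrow> {1, 2}" and "t > 0" "m > 0" "k > 0"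
  defines "q \<equiv> real (k * m)"
  shows "real (card {g \<in> {..<m} \<rightarrow>\<^sub>E equations k n. \<forall>x\<in>{1..n}. 3 dvd (\<Sum>i<m. s i * count_list (fst (g i)) x)})
    \<le> 3 ^ m * ((exp 1)\<^sup>2 * (q + 1)\<^sup>2 * (q / (exp 1 * t)) ^ (k * m) * growth t ^ n)"
proof -
  let ?V = "{1..n}" and ?T = "{ys. length ys = k \<and> set ys \<subseteq> {1..n}}"
  let ?a = "k * card {i \<in> {..<m}. s i = 1}" and ?b = "k * card {i \<in> {..<m}. s i = 2}"
  let ?N = "card {g \<in> {..<m} \<rightarrow>\<^sub>E equations k n. \<forall>x\<in>?V. 3 dvd (\<Sum>i<m. s i * count_list (fst (g i)) x)}"
  have E: "equations k n = ?T \<times> {0, 1, 2}" by (auto simp: equations_def)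
  have "(\<Sum>e\<in>equations k n. \<Prod>x\<in>?V. \<omega> ^ (v x * (j * count_list (fst e) x)))
      = 3 * (\<Sum>x\<in>?V. \<omega> ^ (v x * j)) ^ k" for v j
  proof -
    have "(\<Sum>e\<in>equations k n. \<Prod>x\<in>?V. \<omega> ^ (v x * (j * count_list (fst e) x)))
        = (\<Sum>ys\<in>?T. \<Sum>a\<in>{0, 1, 2::nat}. \<Prod>x\<in>?V. (\<omega> ^ (v x * j)) ^ count_list ys x)"
      unfolding E sum.cartesian_product by (intro sum.cong) (auto simp: power_mult[symmetric] mult.assoc)
    also have "\<dots> = 3 * (\<Sum>ys\<in>?T. \<Prod>x\<in>?V. (\<omega> ^ (v x * j)) ^ count_list ys x)"
      by (simp add: sum_distrib_left)
    finally show ?thesis by (simp add: sum_lists_prod_count)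
  qed
  then have "3 ^ n * complex_of_nat ?N = (\<Sum>v\<in>?V \<rightarrow>\<^sub>E {0, 1, 2::nat}. \<Prod>i<m. 3 * (\<Sum>x\<in>?V. \<omega> ^ (v x * s i)) ^ k)"
    using card_vanishing_mod3[of "{..<m}" ?V "\<lambda>_. equations k n" "\<lambda>i e x. s i * count_list (fst e) x"]
      finite_equations by simp
  also have "\<dots> = 3 ^ m * (\<Sum>v\<in>?V \<rightarrow>\<^sub>E {0, 1, 2::nat}. \<Prod>i<m. (\<Sum>x\<in>?V. \<omega> ^ (v x * s i)) ^ k)"
    by (simp add: prod.distrib sum_distrib_left)
  also have "(\<Sum>v\<in>?V \<rightarrow>\<^sub>E {0, 1, 2::nat}. \<Prod>i<m. (\<Sum>x\<in>?V. \<omega> ^ (v x * s i)) ^ k) = moment ?V ?a ?b"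
    using s by (intro moment_sign) auto
  finally have "Re (3 ^ n * complex_of_nat ?N) = Re (3 ^ m * moment ?V ?a ?b)" by (rule arg_cong)
  moreover have "Re (3 ^ j * z) = 3 ^ j * Re z" for j z
  proof -
    have "3 ^ j * z = of_real (3 ^ j) * z" by simp
    then show ?thesis by (simp only: Re_complex_of_real times_complex.sel Im_complex_of_real mult_zero_left diff_zero)
  qed
  ultimately have eq: "3 ^ n * real ?N = 3 ^ m * Re (moment ?V ?a ?b)" by simp
  have "{..<m} = {i \<in> {..<m}. s i = 1} \<union> {i \<in> {..<m}. s i = 2}" using s by auto
  then have "card {..<m} = card ({i \<in> {..<m}. s i = 1} \<union> {i \<in> {..<m}. s i = 2})" by (rule arg_cong)
  also have "\<dots> = card {i \<in> {..<m}. s i = 1} + card {i \<in> {..<m}. s i = 2}"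
    by (rule card_Un_disjoint) auto
  finally have "k * m = k * (card {i \<in> {..<m}. s i = 1} + card {i \<in> {..<m}. s i = 2})"
    by (simp only: card_lessThan)
  then have ab: "?a + ?b = k * m" by (simp only: distrib_left)
  have "Re (moment ?V ?a ?b) \<le> (exp 1)\<^sup>2 * (q + 1)\<^sup>2 * (q / (exp 1 * t)) ^ (k * m) * (3 * growth t) ^ n"
    using moment_bound[of ?V t ?a ?b] assms unfolding ab q_def by simp
  then have "3 ^ n * real ?N \<le> 3 ^ m * ((exp 1)\<^sup>2 * (q + 1)\<^sup>2 * (q / (exp 1 * t)) ^ (k * m) * (3 * growth t) ^ n)"
    unfolding eq by simp
  also have "\<dots> = 3 ^ n * (3 ^ m * ((exp 1)\<^sup>2 * (q + 1)\<^sup>2 * (q / (exp 1 * t)) ^ (k * m) * growth t ^ n))"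
    by (simp add: power_mult_distrib)
  finally show ?thesis by simp
qed

text \<open>Each circuit together with one of the \<open>fact m\<close> orderings of its equations
  gives a sign sequence and an equation sequence, from which it can be recovered. The
  \<open>2 ^ m\<close> sign sequences and the \<open>3 ^ m\<close> right-hand sides combine to
  \<open>6 ^ m\<close>.\<close>

lemma card_circuits_le:
  assumes "t > 0" "m > 0" "k > 0"
  defines "q \<equiv> real (k * m)"
  shows "fact m * real (card (circuits k n m))
    \<le> 6 ^ m * ((exp 1)\<^sup>2 * (q + 1)\<^sup>2 * (q / (exp 1 * t)) ^ (k * m) * growth t ^ n)"
proof -
  let ?H = "\<lambda>S. {h \<in> {..<m} \<rightarrow>\<^sub>E S. inj_on h {..<m}}"
  let ?G = "\<lambda>s::nat \<Rightarrow> nat. {g \<in> {..<m} \<rightarrow>\<^sub>E equations k n. \<forall>x\<in>{1..n}. 3 dvd (\<Sum>i<m. s i * count_list (fst (g i)) x)}"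
  let ?signs = "{..<m} \<rightarrow>\<^sub>E {1, 2::nat}"
  define A where "A = (SIGMA c : circuits k n m. ?H (fst c))"
  define W where "W = (SIGMA s : ?signs. ?G s)"
  define \<phi> :: "(equation set \<times> (equation \<Rightarrow> nat)) \<times> (nat \<Rightarrow> equation) \<Rightarrow> (nat \<Rightarrow> nat) \<times> (nat \<Rightarrow> equation)"
    where "\<phi> = (\<lambda>(c, h). (restrict (\<lambda>i. snd c (h i)) {..<m}, h))"
  have fin: "finite S" "card S = m" if "(S, \<mu>) \<in> circuits k n m" for S \<mu>
    using that finite_subset[OF _ finite_equations] by (auto simp: circuits_def)
  have bij: "h ` {..<m} = S" if "(S, \<mu>) \<in> circuits k n m" "h \<in> ?H S" for S \<mu> h
  proof (rule card_subset_eq)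
    show "finite S" using that fin by blast
    show "h ` {..<m} \<subseteq> S" using that(2) by blast
    show "card (h ` {..<m}) = card S" using that(2) fin(2)[OF that(1)] by (simp add: card_image)
  qed
  have finG: "finite (?G s)" for s
  proof (rule finite_subset)
    show "finite ({..<m} \<rightarrow>\<^sub>E equations k n)" using finite_equations by (intro finite_PiE) auto
  qed blast
  have finW: "finite W" unfolding W_def using finG by (auto intro!: finite_SigmaI finite_PiE)
  have cardA: "card A = fact m * card (circuits k n m)"
  proof -
    have H: "finite (?H (fst c))" "card (?H (fst c)) = fact m" if c: "c \<in> circuits k n m" for c
    proof -
      have S: "finite (fst c)" "card (fst c) = m" using fin[of "fst c" "snd c"] c by simp_all
      then have "finite ({..<m} \<rightarrow>\<^sub>E fst c)" by (intro finite_PiE) auto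
      then show "finite (?H (fst c))" by (rule finite_subset[rotated]) blast
      show "card (?H (fst c)) = fact m" using card_bijections[OF S(1)] S(2) by simp
    qed
    have "card A = (\<Sum>c\<in>circuits k n m. card (?H (fst c)))"
      unfolding A_def using finite_circuits H(1) by (intro card_SigmaI) blast+
    also have "\<dots> = (\<Sum>c\<in>circuits k n m. fact m)"
      using H(2) by (intro sum.cong refl)
    finally show ?thesis by simp
  qed
  have inj: "inj_on \<phi> A"
  proof (rule inj_onI)
    fix a b assume a: "a \<in> A" and b: "b \<in> A" and eq: "\<phi> a = \<phi> b"
    obtain S \<mu> h where a': "a = ((S, \<mu>), h)" by (cases a) auto
    obtain S' \<mu>' h' where b': "b = ((S', \<mu>'), h')" by (cases b) auto
    have h: "h = h'" using eq a' b' by (simp add: \<phi>_def)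
    have im: "h ` {..<m} = S" "h ` {..<m} = S'"
      using bij[of S \<mu> h] bij[of S' \<mu>' h'] a b a' b' h by (auto simp: A_def)
    have mu: "\<mu> \<in> S \<rightarrow>\<^sub>E {1, 2}" "\<mu>' \<in> S \<rightarrow>\<^sub>E {1, 2}"
      using a b a' b' im by (auto simp: A_def circuits_def)
    have "\<mu> = \<mu>'"
    proof (rule PiE_ext[OF mu])
      fix e assume "e \<in> S"
      then obtain i where i: "i < m" "e = h i" using im by auto
      have "fst (\<phi> a) i = fst (\<phi> b) i" using eq by simp
      then show "\<mu> e = \<mu>' e" using i a' b' h by (simp add: \<phi>_def)
    qed
    then show "a = b" using a' b' h im by simp
  qed
  have sub: "\<phi> ` A \<subseteq> W"
  proof
    fix w assume "w \<in> \<phi> ` A"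
    then obtain S \<mu> h where A: "((S, \<mu>), h) \<in> A" and w: "w = \<phi> ((S, \<mu>), h)" by (auto simp: A_def)
    then have c: "(S, \<mu>) \<in> circuits k n m" and h: "h \<in> ?H S" by (auto simp: A_def)
    have "(\<Sum>i<m. \<mu> (h i) * count_list (fst (h i)) x) = (\<Sum>e\<in>S. \<mu> e * count_list (fst e) x)" for x
      using h bij[OF c h] by (subst sum.reindex_bij_betw[of h _ S, symmetric]) (auto simp: bij_betw_def)
    then show "w \<in> W"
      using c h by (auto simp: w \<phi>_def W_def circuits_def PiE_iff)
  qed
  have "real (card W) = (\<Sum>s\<in>?signs. real (card (?G s)))"
    unfolding W_def using finG by (subst card_SigmaI) (auto intro!: finite_PiE)
  also have "\<dots> \<le> (\<Sum>s\<in>?signs. 3 ^ m * ((exp 1)\<^sup>2 * (q + 1)\<^sup>2 * (q / (exp 1 * t)) ^ (k * m) * growth t ^ n))"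
    unfolding q_def using assms by (intro sum_mono card_signed_sequences) auto
  also have "\<dots> = 6 ^ m * ((exp 1)\<^sup>2 * (q + 1)\<^sup>2 * (q / (exp 1 * t)) ^ (k * m) * growth t ^ n)"
    by (simp add: card_PiE power_mult_distrib[symmetric])
  finally have "real (card W) \<le> 6 ^ m * ((exp 1)\<^sup>2 * (q + 1)\<^sup>2 * (q / (exp 1 * t)) ^ (k * m) * growth t ^ n)" .
  moreover have "fact m * card (circuits k n m) \<le> card W"
    using card_inj_on_le[OF inj sub finW] unfolding cardA .
  then have "real (fact m * card (circuits k n m)) \<le> real (card W)" by (simp only: of_nat_le_iff)
  then have "fact m * real (card (circuits k n m)) \<le> real (card W)" by (simp only: of_nat_mult of_nat_fact)
  ultimately show ?thesis by (rule order_trans[rotated])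
qed

definition has_circuit :: "nat \<Rightarrow> equation set \<Rightarrow> bool" where
  "has_circuit m F \<longleftrightarrow> (\<exists>l\<in>left_ker F. card (supp F l) = m)"

lemma has_circuit_imp:
  assumes "F \<subseteq> equations k n" "has_circuit m F"
  shows "\<exists>c\<in>circuits k n m. fst c \<subseteq> F"
proof -
  obtain l where l: "l \<in> left_ker F" "card (supp F l) = m" using assms by (auto simp: has_circuit_def)
  define \<mu> where "\<mu> = restrict (\<lambda>e. nat (l e)) (supp F l)"
  have finF: "finite F" using assms finite_equations finite_subset by blast
  have vals: "l e = 1 \<or> l e = 2" if "e \<in> supp F l" for e
    using that left_ker_values[OF l(1), of e] by (auto simp: supp_def)
  have "3 dvd (\<Sum>e\<in>supp F l. \<mu> e * count_list (fst e) x)" for x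
  proof -
    have "int (\<Sum>e\<in>supp F l. \<mu> e * count_list (fst e) x) = (\<Sum>e\<in>supp F l. l e * row e x)"
      unfolding of_nat_sum of_nat_mult row_def \<mu>_def
    proof (intro sum.cong refl)
      fix e assume "e \<in> supp F l"
      then show "int (restrict (\<lambda>e. nat (l e)) (supp F l) e) * int (count_list (fst e) x) = l e * int (count_list (fst e) x)"
        using vals[of e] by auto
    qed
    also have "\<dots> = comb F l x"
      unfolding comb_def using finF by (intro sum.mono_neutral_left) (auto simp: supp_def)
    finally have "3 dvd int (\<Sum>e\<in>supp F l. \<mu> e * count_list (fst e) x)"
      using l(1) by (simp add: left_ker_def cong_0_iff)
    then show ?thesis by presburger
  qed
  moreover have "\<mu> \<in> supp F l \<rightarrow>\<^sub>E {1, 2}"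
  proof (rule PiE_I)
    fix e assume "e \<in> supp F l"
    then show "\<mu> e \<in> {1, 2}" using vals[of e] by (auto simp: \<mu>_def)
  qed (simp add: \<mu>_def)
  moreover have "supp F l \<subseteq> F" by (auto simp: supp_def)
  ultimately have "(supp F l, \<mu>) \<in> circuits k n m"
    using l assms by (auto simp: circuits_def)
  then show ?thesis using \<open>supp F l \<subseteq> F\<close> by force
qed

lemma expect_has_circuit:
  assumes "0 \<le> p" "p \<le> 1"
  shows "expect p (equations k n) (\<lambda>F. of_bool (has_circuit m F)) \<le> real (card (circuits k n m)) * p ^ m"
proof -
  let ?E = "equations k n"
  have "expect p ?E (\<lambda>F. of_bool (has_circuit m F)) \<le> expect p ?E (\<lambda>F. \<Sum>c\<in>circuits k n m. of_bool (fst c \<subseteq> F))"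
  proof (rule expect_mono[OF assms])
    fix F assume F: "F \<subseteq> ?E"
    show "(of_bool (has_circuit m F) :: real) \<le> (\<Sum>c\<in>circuits k n m. of_bool (fst c \<subseteq> F))"
    proof (cases "has_circuit m F")
      case True
      then obtain c where c: "c \<in> circuits k n m" "fst c \<subseteq> F" using has_circuit_imp F by blast
      have "of_bool (fst c \<subseteq> F) \<le> (\<Sum>c\<in>circuits k n m. of_bool (fst c \<subseteq> F) :: real)"
        by (rule member_le_sum[where f = "\<lambda>c. of_bool (fst c \<subseteq> F)", OF c(1)]) (auto simp: finite_circuits)
      then show ?thesis using c True by simp
    qed (simp add: sum_nonneg)
  qed
  also have "\<dots> = (\<Sum>c\<in>circuits k n m. p ^ card (fst c))"
    unfolding expect_sum using finite_equations by (intro sum.cong refl expect_superset) (auto simp: circuits_def)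
  also have "\<dots> = (\<Sum>c\<in>circuits k n m. p ^ m)" by (intro sum.cong) (auto simp: circuits_def)
  finally show ?thesis by simp
qed

text \<open>An exponential tilt: \<open>y ^ card F / y ^ n'\<close> is at least 1 when
  \<open>card F \<le> n'\<close>. The restriction removes formulas with unusually many equations,
  which can make the plain first moment exponentially large near weight 2n/3.\<close>

lemma expect_has_circuit_few:
  assumes "0 \<le> p" "p \<le> 1" "0 < y" "y \<le> 1"
  shows "expect p (equations k n) (\<lambda>F. of_bool (has_circuit m F \<and> card F \<le> n'))
    \<le> real (card (circuits k n m)) * ((p * y) ^ m * (1 - p + p * y) ^ (3 * n ^ k - m) / y ^ n')"
proof -
  let ?E = "equations k n"
  let ?f = "\<lambda>c F. of_bool (fst c \<subseteq> F) * y ^ card F"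
  have "expect p ?E (\<lambda>F. of_bool (has_circuit m F \<and> card F \<le> n'))
      \<le> expect p ?E (\<lambda>F. 1 / y ^ n' * (\<Sum>c\<in>circuits k n m. ?f c F))"
  proof (rule expect_mono[OF assms(1,2)])
    fix F assume F: "F \<subseteq> ?E"
    show "of_bool (has_circuit m F \<and> card F \<le> n') \<le> 1 / y ^ n' * (\<Sum>c\<in>circuits k n m. ?f c F)"
    proof (cases "has_circuit m F \<and> card F \<le> n'")
      case True
      then obtain c where c: "c \<in> circuits k n m" "fst c \<subseteq> F" using has_circuit_imp F by blast
      have "y ^ n' \<le> y ^ card F" using True assms by (intro power_decreasing) auto
      also have "\<dots> = ?f c F" using c by simp
      also have "\<dots> \<le> (\<Sum>c\<in>circuits k n m. ?f c F)"
        using assms by (intro member_le_sum[where f = "\<lambda>c. ?f c F", OF c(1)]) (auto simp: finite_circuits)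
      finally show ?thesis using True assms by simp
    qed (use assms in \<open>auto intro!: divide_nonneg_nonneg sum_nonneg\<close>)
  qed
  also have "\<dots> = 1 / y ^ n' * (\<Sum>c\<in>circuits k n m. (p * y) ^ m * (1 - p + p * y) ^ (3 * n ^ k - m))"
    unfolding expect_cmult expect_sum using finite_equations
    by (intro arg_cong2[where f = "(*)"] sum.cong refl, subst expect_superset_power)
      (auto simp: circuits_def card_equations)
  finally show ?thesis by simp
qed

section \<open>Elementary estimates and circuits of small weight\<close>

text \<open>The linear terms of \<open>exp t\<close> and \<open>2 * exp (- t / 2)\<close> cancel,
  since a uniform cube root of unity has mean 0; only the quadratic term remains for small
  \<open>t\<close>.\<close>

lemma growth_le_exp_square:
  assumes "0 \<le> t" "t \<le> 1"
  shows "growth t \<le> exp (t\<^sup>2 / 2)"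
proof -
  have "exp t \<le> 1 + t + t\<^sup>2" using assms exp_bound by blast
  moreover have "exp (- t / 2) \<le> 1 - t / 2 + (t / 2)\<^sup>2"
  proof -
    have "exp (- t / 2) = 1 / exp (t / 2)"
      using exp_minus[of "t / 2"] by (simp only: inverse_eq_divide minus_divide_left)
    also have "\<dots> \<le> 1 / (1 + t / 2)"
      using assms exp_ge_add_one_self[of "t / 2"] by (intro divide_left_mono) auto
    also have "\<dots> \<le> 1 - t / 2 + (t / 2)\<^sup>2"
    proof -
      have "1 \<le> (1 - t / 2 + (t / 2)\<^sup>2) * (1 + t / 2)"
        using assms by (simp add: algebra_simps power2_eq_square)
      then show ?thesis using assms by (simp add: pos_divide_le_eq)
    qed
    finally show ?thesis .
  qed
  ultimately have "growth t \<le> 1 + t\<^sup>2 / 2"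
    by (simp add: growth_def power_divide field_simps)
  also have "\<dots> \<le> exp (t\<^sup>2 / 2)" by (rule exp_ge_add_one_self)
  finally show ?thesis .
qed

lemma exp_7_ge: "610 \<le> exp (7::real)"
proof -
  have "5 / 2 \<le> exp (1::real)" using exp_lower_Taylor_quadratic[of "1::real"] by simp
  then have "(5 / 2) ^ 7 \<le> exp (1::real) ^ 7" by (intro power_mono) auto
  also have "exp (1::real) ^ 7 = exp 7" by (simp add: exp_of_nat_mult[symmetric])
  finally show ?thesis by (simp add: power_divide)
qed

text \<open>The tangent of \<open>exp\<close> at 7, with its slope rounded down to 610.\<close>

lemma exp_ge_linear: "610 * (x - 6) \<le> exp (x::real)"
proof (cases "x \<ge> 6")
  case True
  have "exp x = exp 7 * exp (x - 7)" by (simp add: exp_add[symmetric])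
  moreover have "610 * (x - 6) \<le> exp 7 * exp (x - 7)"
    using exp_7_ge exp_ge_add_one_self[of "x - 7"] True by (intro mult_mono) auto
  ultimately show ?thesis by simp
next
  case False
  then have "610 * (x - 6) \<le> 0" by simp
  then show ?thesis using exp_ge_zero[of x] by linarith
qed

lemma inverse_fact_le: "m > 0 \<Longrightarrow> 1 / fact m \<le> (exp 1 / real m) ^ m"
proof -
  assume m: "m > 0"
  have "(\<lambda>i. real m ^ i /\<^sub>R fact i) sums exp (real m)" by (rule exp_converges)
  then have "real m ^ m /\<^sub>R fact m \<le> exp (real m)"
    using sum_le_suminf[of "\<lambda>i. real m ^ i /\<^sub>R fact i" "{m}"] by (simp add: sums_iff)
  also have "exp (real m) = exp 1 ^ m" by (simp add: exp_of_nat_mult[symmetric])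
  finally show ?thesis using m by (simp add: power_divide field_simps)
qed

text \<open>For weight at most \<open>n / k\<close> the parameter \<open>t\<close> is at most 1 and
  \<open>growth\<close> is bounded like a Gaussian. With \<open>u = k * m / n\<close>, the choice
  \<open>t = sqrt u\<close> balances \<open>t ^ (k * m)\<close> in the denominator against
  \<open>exp (n * t\<^sup>2 / 2)\<close>. Up to polynomial factors
  \<open>(2 * k * r ^ (k - 2)) ^ m\<close> remains, which for \<open>k \<ge> 16\<close> is at most
  \<open>(u / 10) ^ m\<close>: geometric in \<open>m\<close>, and of order \<open>1 / n\<close>
  already for \<open>m = 1\<close>.\<close>

lemma circuits_few_small:
  fixes n k m :: nat and p :: real
  assumes k: "k \<ge> 16" and m: "m > 0" and km: "k * m \<le> n" and p: "0 \<le> p" "p \<le> 1 / (3 * real n ^ (k - 1))"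
  shows "real (card (circuits k n m)) * p ^ m
    \<le> (exp 1)\<^sup>2 * (real k * real m) * (real k * real m + 1)\<^sup>2 / 10 ^ m / n"
proof -
  define q where "q = real (k * m)"
  define u where "u = q / n"
  define t where "t = sqrt u"
  define r where "r = sqrt (u / exp 1)"
  have n: "n > 0" using k m km by (cases "n = 0") auto
  have q: "q > 0" using k m by (simp add: q_def)
  have u: "0 < u" "u \<le> 1" using q n km by (auto simp: u_def q_def simp flip: of_nat_mult)
  have t: "0 < t" "t \<le> 1" "t\<^sup>2 = u" using u by (auto simp: t_def)
  have r: "0 < r" "r\<^sup>2 = u / exp 1" using u by (auto simp: r_def)
  have pw: "r ^ j = r\<^sup>2 * r ^ (j - 2)" if "2 \<le> j" for j
    using that by (metis le_add_diff_inverse power_add)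
  have rt: "r = t / exp (1 / 2)"
    unfolding r_def t_def by (simp add: real_sqrt_divide real_sqrt_unique flip: exp_of_nat_mult)
  have qt: "q / t = n * t"
    using t n by (simp add: u_def power2_eq_square field_simps)
  have G: "growth t ^ n \<le> exp (1 / 2) ^ (k * m)"
  proof -
    have "growth t ^ n \<le> exp (t\<^sup>2 / 2) ^ n"
      using t growth_le_exp_square by (intro power_mono) (auto simp: growth_def)
    also have "\<dots> = exp (n * (u / 2))" by (simp only: t(3) exp_of_nat_mult)
    also have "n * (u / 2) = q * (1 / 2)" using n by (simp add: u_def)
    also have "exp (q * (1 / 2)) = exp (1 / 2) ^ (k * m)" unfolding q_def by (rule exp_of_nat_mult)
    finally show ?thesis .
  qed
  have "(q / (exp 1 * t)) ^ (k * m) * growth t ^ n \<le> (q / (exp 1 * t)) ^ (k * m) * exp (1 / 2) ^ (k * m)"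
    using G q t by (intro mult_left_mono) auto
  also have "\<dots> = (n * r) ^ (k * m)"
  proof -
    have "q / (exp 1 * t) * exp (1 / 2) = n * t * (exp (1 / 2) / exp 1)"
      using qt by (metis divide_divide_eq_left mult.commute times_divide_eq_right)
    also have "exp (1 / 2) / exp 1 = 1 / exp (1 / 2::real)"
    proof -
      have "exp (1::real) = exp (1 / 2) * exp (1 / 2)" by (simp flip: exp_add)
      then show ?thesis by simp
    qed
    finally show ?thesis by (simp add: rt power_mult_distrib[symmetric])
  qed
  finally have B: "(q / (exp 1 * t)) ^ (k * m) * growth t ^ n \<le> (n * r) ^ (k * m)" .
  define P where "P = (exp 1)\<^sup>2 * (q + 1)\<^sup>2"
  have P: "P \<ge> 0" by (simp add: P_def)
  have "fact m * real (card (circuits k n m)) \<le> 6 ^ m * (P * ((q / (exp 1 * t)) ^ (k * m) * growth t ^ n))"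
    using card_circuits_le[of t m k n] t m k unfolding P_def q_def by (simp add: mult.assoc)
  also have "\<dots> \<le> 6 ^ m * (P * (n * r) ^ (k * m))"
    using B P by (intro mult_left_mono) auto
  finally have "real (card (circuits k n m)) \<le> 1 / fact m * (6 ^ m * (P * (n * r) ^ (k * m)))"
    by (simp add: field_simps)
  also have "\<dots> \<le> (exp 1 / real m) ^ m * (6 ^ m * (P * (n * r) ^ (k * m)))"
    using inverse_fact_le[OF m] P r by (intro mult_right_mono) auto
  finally have "real (card (circuits k n m)) * p ^ m
      \<le> (exp 1 / real m) ^ m * (6 ^ m * (P * (n * r) ^ (k * m))) * (1 / (3 * real n ^ (k - 1))) ^ m"
    using p P r by (intro mult_mono power_mono) auto
  also have "\<dots> = P * (exp 1 / real m * 6 * (n * r) ^ k * (1 / (3 * real n ^ (k - 1)))) ^ m"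
    by (simp only: power_mult power_mult_distrib mult_ac)
  \<comment> \<open>Here \<open>m = u * n / k\<close> and \<open>r\<^sup>2 = u / exp 1\<close>
    absorb the factor \<open>exp 1 / m\<close>.\<close>
  also have "exp 1 / real m * 6 * (n * r) ^ k * (1 / (3 * real n ^ (k - 1))) = 2 * k * r ^ (k - 2)"
  proof -
    have "real n ^ k = n * real n ^ (k - 1)" using k by (metis not_numeral_le_zero power_eq_if)
    moreover have "r ^ k = r\<^sup>2 * r ^ (k - 2)" using pw[of k] k by simp
    moreover have "real m = u * n / k" using n k by (simp add: u_def q_def)
    ultimately show ?thesis
      using n m k u by (simp add: power_mult_distrib r(2) divide_simps) (simp add: ac_simps)
  qed
  also have "P * (2 * k * r ^ (k - 2)) ^ m \<le> P * (u / 10) ^ m"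
  proof (intro mult_left_mono power_mono P)
    \<comment> \<open>One factor \<open>r\<^sup>2\<close> is kept for the power of \<open>u\<close>;
      each of the other \<open>k - 4\<close> factors is at most
      \<open>exp (- 1 / 2)\<close>.\<close>
    have "r ^ (k - 2) = r\<^sup>2 * r ^ (k - 4)" using pw[of "k - 2"] k by simp
    also have "\<dots> \<le> r\<^sup>2 * (1 / exp (1 / 2)) ^ (k - 4)"
      using t r by (intro mult_left_mono power_mono) (auto simp: rt divide_right_mono)
    also have "(1 / exp (1 / 2)) ^ (k - 4) = 1 / exp ((real k - 4) / 2)"
    proof -
      have "exp ((real k - 4) / 2) = exp (real (k - 4) * (1 / 2))" using k by (simp add: of_nat_diff)
      also have "\<dots> = exp (1 / 2) ^ (k - 4)" by (rule exp_of_nat_mult)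
      finally show ?thesis by (simp add: power_one_over)
    qed
    finally have "r ^ (k - 2) \<le> u / exp 1 * (1 / exp ((real k - 4) / 2))" unfolding r(2) .
    then have "2 * k * r ^ (k - 2) \<le> 2 * k * (u / exp 1 * (1 / exp ((real k - 4) / 2)))"
      by (rule mult_left_mono) simp
    also have "\<dots> = u * (2 * k / exp ((real k - 2) / 2))"
    proof -
      have "exp ((real k - 2) / 2) = exp (1 + (real k - 4) / 2)" by (simp add: field_simps)
      then show ?thesis by (simp add: exp_add)
    qed
    also have "\<dots> \<le> u * (1 / 10)"
    proof (rule mult_left_mono)
      have "20 * real k \<le> 610 * ((real k - 2) / 2 - 6)" using k by (simp add: field_simps)
      also have "\<dots> \<le> exp ((real k - 2) / 2)" by (rule exp_ge_linear)
      finally show "2 * k / exp ((real k - 2) / 2) \<le> 1 / 10" by (simp add: field_simps)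
    qed (use u in simp)
    finally show "2 * k * r ^ (k - 2) \<le> u / 10" by simp
  qed (use r in simp)
  also have "P * (u / 10) ^ m \<le> P * (u / 10 ^ m)"
  proof (rule mult_left_mono[OF _ P])
    \<comment> \<open>The decay in \<open>n\<close> comes from a single factor
      \<open>u = k * m / n\<close>.\<close>
    have "u ^ m \<le> u ^ 1" using u m by (intro power_decreasing) auto
    then show "(u / 10) ^ m \<le> u / 10 ^ m" by (simp add: power_divide divide_right_mono)
  qed
  finally have "real (card (circuits k n m)) * p ^ m \<le> P * (u / 10 ^ m)" .
  also have "\<dots> = (exp 1)\<^sup>2 * (real k * real m) * (real k * real m + 1)\<^sup>2 / 10 ^ m / n"
    by (simp add: P_def u_def q_def mult.commute mult.left_commute)
  finally show ?thesis .
qed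

text \<open>Pinsker's inequality for Bernoulli distributions: the left side is minus the relative
  entropy of success probability \<open>s\<close> with respect to 2/3. It is the exponential rate of
  \<open>(n choose m) * 2 ^ m / 3 ^ n\<close> at \<open>m = s * n\<close>.\<close>

lemma binary_entropy_bound:
  fixes s :: real
  assumes "0 < s" "s \<le> 2 / 3"
  shows "s * (ln 2 - ln s) - (1 - s) * ln (1 - s) - ln 3 \<le> - 2 * (2 / 3 - s)\<^sup>2"
proof -
  define \<phi> where "\<phi> x = x * (ln 2 - ln x) - (1 - x) * ln (1 - x) - ln 3 + 2 * (2 / 3 - x)\<^sup>2" for x :: real
  define \<psi> where "\<psi> x = ln 2 - ln x + ln (1 - x) - 4 * (2 / 3 - x)" for x :: real
  have \<psi>: "\<psi> x \<ge> 0" if x: "s \<le> x" "x \<le> 2 / 3" for x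
  proof -
    have "\<psi> (2 / 3) \<le> \<psi> x"
    proof (rule DERIV_nonpos_imp_nonincreasing[OF x(2)])
      fix y assume y: "x \<le> y" "y \<le> 2 / 3"
      then have y': "0 < y" "y < 1" using x assms by auto
      have "(\<psi> has_real_derivative (- 1 / y - 1 / (1 - y) + 4)) (at y)"
        unfolding \<psi>_def using y' by (auto intro!: derivative_eq_intros)
      moreover have "- 1 / y - 1 / (1 - y) + 4 \<le> 0"
      proof -
        have "0 \<le> (2 * y - 1)\<^sup>2" by simp
        then have "4 * (y * (1 - y)) \<le> 1" by (simp add: power2_eq_square algebra_simps)
        then have "4 \<le> 1 / (y * (1 - y))" using y' by (simp add: pos_le_divide_eq)
        also have "\<dots> = 1 / y + 1 / (1 - y)" using y' by (simp add: field_simps)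
        finally show ?thesis by simp
      qed
      ultimately show "\<exists>d. (\<psi> has_real_derivative d) (at y) \<and> d \<le> 0" by blast
    qed
    moreover have "\<psi> (2 / 3) = 0" by (simp add: \<psi>_def ln_div)
    ultimately show ?thesis by simp
  qed
  have "\<phi> s \<le> \<phi> (2 / 3)"
  proof (rule DERIV_nonneg_imp_nondecreasing[OF assms(2)])
    fix x assume x: "s \<le> x" "x \<le> 2 / 3"
    then have x': "0 < x" "x < 1" using assms by auto
    have "(\<phi> has_real_derivative \<psi> x) (at x)"
      unfolding \<phi>_def \<psi>_def using x' by (auto intro!: derivative_eq_intros)
    then show "\<exists>d. (\<phi> has_real_derivative d) (at x) \<and> 0 \<le> d" using \<psi>[OF x] by blast
  qed
  also have "\<phi> (2 / 3) = 0" by (simp add: \<phi>_def ln_div field_simps)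
  finally show ?thesis by (simp add: \<phi>_def)
qed

text \<open>The left side is convex in \<open>s\<close> and the right side affine, so the two ends
  of the interval suffice. At the right end \<open>2 / 3 - s\<close> is only
  \<open>1 / (10 * k)\<close>, and the exponential is small enough because
  \<open>k \<ge> 16\<close>.\<close>

lemma exp_chord_bound:
  fixes k :: nat and s :: real
  assumes k: "k \<ge> 16" and s: "1 / k \<le> s" "s \<le> 2 / 3 - 1 / (10 * real k)"
  shows "exp (- (3 / 4) * k * s) \<le> 9 / 10 * (2 / 3 - s)"
proof -
  define a where "a = 1 / real k"
  define b where "b = 2 / 3 - 1 / (10 * real k)"
  let ?f = "\<lambda>x. exp (- (3 / 4) * k * x)"
  have a: "0 < a" "a \<le> 1 / 16" using k by (auto simp: a_def field_simps)
  have b: "b = 2 / 3 - a / 10" using k by (simp add: a_def b_def)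
  have ab: "a < b" using a b by simp
  define l where "l = (s - a) / (b - a)"
  have l: "0 \<le> l" "l \<le> 1" using s ab by (auto simp: l_def a_def b_def)
  have "l * (b - a) = s - a" using ab by (simp add: l_def)
  then have sl: "s = (1 - l) * a + l * b" by (simp add: algebra_simps)
  have fa: "?f a \<le> 9 / 10 * (2 / 3 - a)"
  proof -
    have "?f a = exp (- (3 / 4))" using k by (simp add: a_def)
    also have "\<dots> = 1 / exp (3 / 4::real)" by (simp only: exp_minus inverse_eq_divide)
    also have "\<dots> \<le> 1 / (1 + 3 / 4 + (3 / 4)\<^sup>2 / 2)"
      using exp_lower_Taylor_quadratic[of "3 / 4 :: real"]
      by (intro divide_left_mono mult_pos_pos exp_gt_zero) (auto intro: add_pos_pos)
    also have "\<dots> \<le> 9 / 10 * (2 / 3 - 1 / 16)" by (simp add: power2_eq_square)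
    finally show ?thesis using a by simp
  qed
  have fb: "?f b \<le> 9 / 10 * (2 / 3 - b)"
  proof -
    let ?x = "real k / 2 - 3 / 40"
    have "- (3 / 4) * k * b = - ?x" using k by (simp add: b_def field_simps)
    then have "?f b = 1 / exp ?x" by (simp only: exp_minus inverse_eq_divide)
    also have "\<dots> \<le> 1 / (12 * real k)"
    proof (rule divide_left_mono)
      have "12 * real k \<le> 610 * (?x - 6)" using k by (simp add: field_simps)
      also have "\<dots> \<le> exp ?x" by (rule exp_ge_linear)
      finally show "12 * real k \<le> exp ?x" .
    qed (use k in auto)
    also have "\<dots> \<le> 9 / 10 * (2 / 3 - b)" using k by (simp add: b_def field_simps)
    finally show ?thesis .
  qed
  have lin: "c * ((1 - l) * a + l * b) = (1 - l) * (c * a) + l * (c * b)" for c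
    by (simp add: algebra_simps)
  have cv: "exp ((1 - l) * x + l * y) \<le> (1 - l) * exp x + l * exp y" for x y :: real
    using convex_onD[OF exp_convex, of l x y] l by simp
  have "?f s = exp ((1 - l) * (- (3 / 4) * k * a) + l * (- (3 / 4) * k * b))"
    using lin[of "- (3 / 4) * k"] sl by simp
  also have "\<dots> \<le> (1 - l) * ?f a + l * ?f b"
    by (rule cv)
  also have "\<dots> \<le> (1 - l) * (9 / 10 * (2 / 3 - a)) + l * (9 / 10 * (2 / 3 - b))"
    using fa fb l by (intro add_mono mult_left_mono) auto
  also have "\<dots> = 9 / 10 * (2 / 3 - s)"
  proof -
    have "(1 - l) * (c * (d - a)) + l * (c * (d - b)) = c * (d - ((1 - l) * a + l * b))" for c d
      by (simp add: algebra_simps)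
    then show ?thesis unfolding sl by blast
  qed
  finally show ?thesis .
qed

subsection \<open>First moment\<close>

lemma edge_probability:
  fixes c :: real
  assumes "0 \<le> c" "c \<le> 1"
  shows "0 \<le> c / real n ^ j" "c / real n ^ j \<le> 1"
proof -
  show "0 \<le> c / real n ^ j" using assms by simp
  show "c / real n ^ j \<le> 1"
  proof (cases "n = 0")
    case True
    then show ?thesis using assms by (cases "j = 0") (auto simp: power_0_left)
  next
    case False
    then have "1 \<le> real n ^ j" by simp
    then have "c / real n ^ j \<le> c / 1" using assms False by (intro divide_left_mono) auto
    then show ?thesis using assms by simp
  qed
qed

text \<open>For larger weights \<open>growth t\<close> is close to \<open>exp t / 3\<close>, and
  \<open>t = k * s\<close> is close to the saddle point; the powers of \<open>exp 1\<close> then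
  cancel and leave \<open>w ^ n\<close>. The tilt \<open>y = 1 - s\<close> is optimal for
  \<open>n\<close> equations on average and \<open>n' = n\<close>. The exponent becomes that of
  \<open>binary_entropy_bound\<close> plus the error of replacing \<open>w\<close> by 1/3.\<close>

lemma circuits_few_medium:
  fixes n k m n' :: nat and p \<delta> :: real
  assumes k: "k \<ge> 16" and n: "n > 0" and m: "n \<le> k * m" "real m \<le> (2 / 3 - 1 / (10 * real k)) * n"
    and p: "0 \<le> p" "p \<le> 1 / (3 * real n ^ (k - 1))"
    and n': "m \<le> n'" "real n' \<le> (1 + \<delta>) * n" and \<delta>: "\<delta> \<ge> 0"
  defines "s \<equiv> real m / n"
  defines "y \<equiv> 1 - s"
  shows "real (card (circuits k n m)) * ((p * y) ^ m * (1 - p + p * y) ^ (3 * n ^ k - m) / y ^ n')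
    \<le> exp 1 * ((exp 1)\<^sup>2 * (real (k * m) + 1)\<^sup>2) * exp (n * (\<delta> * ln 3 - 38 / 100 * (1 / (10 * real k))\<^sup>2))"
proof -
  define a where "a = 2 / 3 - s"
  define t where "t = k * s"
  define w where "w = (1 + 2 * exp (- (3 / 2) * t)) / 3"
  \<comment> \<open>The mean number of equations per variable.\<close>
  define \<mu> where "\<mu> = 3 * p * real n ^ (k - 1)"
  define P where "P = (exp 1)\<^sup>2 * (real (k * m) + 1)\<^sup>2"
  have P: "0 \<le> P" by (simp add: P_def)
  have mpos: "m > 0" using m n by (cases m) auto
  have sm: "s * n = m" using n by (simp add: s_def)
  have s: "1 / k \<le> s" "s \<le> 2 / 3 - 1 / (10 * real k)"
  proof -
    have "real n \<le> real k * real m" using m(1) by (simp only: of_nat_le_iff flip: of_nat_mult)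
    then show "1 / k \<le> s" using k n by (simp add: s_def field_simps)
    show "s \<le> 2 / 3 - 1 / (10 * real k)" using m(2) n by (simp add: s_def pos_divide_le_eq)
  qed
  have s0: "0 < s" using mpos n by (simp add: s_def)
  have s23: "s < 2 / 3" using s(2) k by (smt (verit) divide_pos_pos of_nat_0_less_iff zero_less_numeral mult_pos_pos rel_simps(51) order_less_le_trans)
  have y: "1 / 3 < y" "y < 1" using s0 s23 by (auto simp: y_def)
  have a: "1 / (10 * real k) \<le> a" using s(2) by (simp add: a_def)
  have t0: "0 < t" using k s0 by (simp add: t_def)
  have tn: "t * n = real (k * m)" using sm by (simp add: t_def mult.assoc)
  have nk: "real n ^ k = n * real n ^ (k - 1)" using k by (metis not_numeral_le_zero power_eq_if)
  have \<mu>: "0 \<le> \<mu>" using p by (simp add: \<mu>_def)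
  have pn: "6 * p * real n ^ k = 2 * \<mu> * n" by (simp add: \<mu>_def nk)
  have w: "0 < w" by (simp add: w_def add_pos_pos)
  have B: "(real (k * m) / (exp 1 * t)) ^ (k * m) * growth t ^ n = real n ^ (k * m) * w ^ n"
  proof -
    have "real (k * m) / (exp 1 * t) = n / exp 1"
      unfolding tn[symmetric] using t0 by simp
    moreover have "growth t = exp t * w"
    proof -
      have "exp (- t / 2) = exp t * exp (- (3 / 2) * t)" by (simp flip: exp_add)
      then show ?thesis by (simp add: growth_def w_def algebra_simps)
    qed
    moreover have "exp t ^ n = exp 1 ^ (k * m)"
    proof -
      have "exp t ^ n = exp (n * t)" by (rule exp_of_nat_mult[symmetric])
      also have "n * t = real (k * m) * 1" using tn by (simp add: mult.commute)
      also have "exp \<dots> = exp 1 ^ (k * m)" by (rule exp_of_nat_mult)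
      finally show ?thesis .
    qed
    ultimately show ?thesis by (simp add: power_divide power_mult_distrib)
  qed
  have "fact m * real (card (circuits k n m)) \<le> 6 ^ m * (P * (real n ^ (k * m) * w ^ n))"
    using card_circuits_le[OF t0 mpos, of k n] k unfolding B[symmetric] P_def by (simp add: mult.assoc)
  then have "real (card (circuits k n m)) \<le> 1 / fact m * (6 ^ m * (P * (real n ^ (k * m) * w ^ n)))"
    by (simp add: field_simps)
  also have "\<dots> \<le> (exp 1 / real m) ^ m * (6 ^ m * (P * (real n ^ (k * m) * w ^ n)))"
    using inverse_fact_le[OF mpos] P w by (intro mult_right_mono) auto
  finally have "real (card (circuits k n m)) * p ^ m
      \<le> (exp 1 / real m) ^ m * (6 ^ m * (P * (real n ^ (k * m) * w ^ n))) * p ^ m"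
    using p by (intro mult_right_mono) auto
  also have "\<dots> = P * w ^ n * (exp 1 / real m * (6 * p * real n ^ k)) ^ m"
    by (simp only: power_mult power_mult_distrib mult_ac)
  also have "exp 1 / real m * (6 * p * real n ^ k) = 2 / s * (exp 1 * \<mu>)"
    unfolding pn using n mpos by (simp add: s_def)
  finally have 1: "real (card (circuits k n m)) * p ^ m \<le> P * w ^ n * (2 / s * (exp 1 * \<mu>)) ^ m" .
  \<comment> \<open>The full exponent \<open>3 * n ^ k\<close> would give
    \<open>exp (- \<mu>) ^ m\<close>; the \<open>m\<close> missing factors cost at most
    \<open>exp 1\<close>, since \<open>p * s * m \<le> 1\<close>.\<close>
  have 2: "(1 - p + p * y) ^ (3 * n ^ k - m) \<le> exp 1 * exp (- \<mu>) ^ m"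
  proof -
    have n1: "real n ^ (k - 1) \<ge> n" using n k power_increasing[of 1 "k - 1" "real n"] by simp
    have "p * m \<le> 1 / (3 * real n ^ (k - 1)) * n"
      using p s23 sm s0 n by (intro mult_mono) (auto simp: s_def field_simps)
    also have "\<dots> \<le> 1"
    proof -
      have "real n \<le> 3 * real n ^ (k - 1)" using n1 by linarith
      then show ?thesis using n by (simp add: divide_le_eq_1)
    qed
    finally have pm: "p * m \<le> 1" .
    have "1 - p + p * y = 1 - p * s" by (simp add: y_def algebra_simps)
    moreover have "p * s \<le> 1"
    proof -
      have "p * s \<le> p * m" using p n mpos s0 by (intro mult_left_mono) (auto simp: s_def field_simps)
      then show ?thesis using pm by simp
    qed
    ultimately have "(1 - p + p * y) ^ (3 * n ^ k - m) \<le> exp (- (p * s)) ^ (3 * n ^ k - m)"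
      using exp_ge_add_one_self[of "- (p * s)"] by (intro power_mono) auto
    also have "\<dots> = exp (real (3 * n ^ k - m) * (- (p * s)))" by (rule exp_of_nat_mult[symmetric])
    also have "\<dots> \<le> exp (1 + m * (- \<mu>))"
    proof -
      have "real (3 * n ^ k) - m \<le> real (3 * n ^ k - m)" by linarith
      then have "(p * s) * (real (3 * n ^ k) - m) \<le> (p * s) * real (3 * n ^ k - m)"
        using p s0 by (intro mult_left_mono) auto
      moreover have "(p * s) * real (3 * n ^ k) = \<mu> * m"
        using sm by (simp add: \<mu>_def nk algebra_simps)
      moreover have "(p * s) * m \<le> 1"
        using pm s0 s23 p mult_left_mono[of s 1 "p * m"] by (simp add: algebra_simps)
      ultimately show ?thesis by (simp add: algebra_simps)
    qed
    also have "\<dots> = exp 1 * exp (- \<mu>) ^ m" by (simp only: exp_add exp_of_nat_mult)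
    finally show ?thesis .
  qed
  have 3: "y ^ m / y ^ n' \<le> exp (n * (- (1 - s) * ln y + \<delta> * ln 3))"
  proof -
    have "y ^ n' = y ^ m * y ^ (n' - m)" using n'(1) by (simp flip: power_add)
    then have "y ^ m / y ^ n' = 1 / y ^ (n' - m)" using y by simp
    also have "\<dots> = exp (real (n' - m) * (- ln y))"
      using y by (simp add: exp_of_nat_mult exp_minus power_inverse inverse_eq_divide power_one_over)
    also have "\<dots> \<le> exp (n * (- (1 - s) * ln y + \<delta> * ln 3))"
    proof -
      have ly: "0 \<le> - ln y" "- ln y \<le> ln 3"
      proof -
        show "0 \<le> - ln y" using y by simp
        have "ln (1 / 3) \<le> ln y" using y by (subst ln_le_cancel_iff) auto
        then show "- ln y \<le> ln 3" by (simp add: ln_div)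
      qed
      have "real (n' - m) \<le> n * (1 - s) + n * \<delta>"
        using n' sm by (simp add: of_nat_diff algebra_simps)
      then have "real (n' - m) * (- ln y) \<le> (n * (1 - s) + n * \<delta>) * (- ln y)"
        using ly by (intro mult_right_mono) auto
      also have "\<dots> = n * (1 - s) * (- ln y) + n * \<delta> * (- ln y)" by (simp add: algebra_simps)
      also have "\<dots> \<le> n * (1 - s) * (- ln y) + n * \<delta> * ln 3"
        using ly \<delta> by (intro add_left_mono mult_left_mono) auto
      finally show ?thesis by (simp add: algebra_simps)
    qed
    finally show ?thesis .
  qed
  \<comment> \<open>As \<open>\<mu> * exp (1 - \<mu>)\<close> is at most 1, the density drops out;
    the worst case is \<open>\<mu> = 1\<close>, as many equations as variables.\<close>
  have 4: "(2 / s * (exp 1 * \<mu>)) ^ m * exp (- \<mu>) ^ m \<le> exp (n * (s * (ln 2 - ln s)))"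
  proof -
    have "exp 1 * \<mu> * exp (- \<mu>) \<le> 1"
    proof -
      have "\<mu> \<le> exp (\<mu> - 1)" using exp_ge_add_one_self[of "\<mu> - 1"] by simp
      then have "\<mu> * exp (1 - \<mu>) \<le> exp (\<mu> - 1) * exp (1 - \<mu>)" by (intro mult_right_mono) auto
      also have "\<dots> = 1" by (simp flip: exp_add)
      finally show ?thesis by (simp add: exp_diff exp_minus divide_inverse algebra_simps)
    qed
    then have "(2 / s) * (exp 1 * \<mu> * exp (- \<mu>)) \<le> (2 / s) * 1" using s0 by (intro mult_left_mono) auto
    then have "((2 / s) * (exp 1 * \<mu> * exp (- \<mu>))) ^ m \<le> (2 / s) ^ m"
      using s0 \<mu> by (intro power_mono) auto
    also have "(2 / s) ^ m = exp (ln 2 - ln s) ^ m" using s0 by (simp add: exp_diff)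
    also have "exp (ln 2 - ln s) ^ m = exp (real m * (ln 2 - ln s))" by (rule exp_of_nat_mult[symmetric])
    also have "real m * (ln 2 - ln s) = n * (s * (ln 2 - ln s))" using sm by (simp add: mult.commute mult.left_commute)
    finally show ?thesis by (simp only: power_mult_distrib mult_ac)
  qed
  have 5: "w ^ n \<le> exp (n * (2 * exp (- (3 / 2) * t) - ln 3))"
  proof -
    have "w \<le> exp (2 * exp (- (3 / 2) * t)) / 3"
      unfolding w_def using exp_ge_add_one_self by (intro divide_right_mono) auto
    also have "\<dots> = exp (2 * exp (- (3 / 2) * t) - ln 3)" by (simp add: exp_diff)
    finally have "w ^ n \<le> exp (2 * exp (- (3 / 2) * t) - ln 3) ^ n" using w by (intro power_mono) auto
    then show ?thesis by (simp only: exp_of_nat_mult)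
  qed
  \<comment> \<open>The entropy gives \<open>- 2 * a\<^sup>2\<close> and the error of
    \<open>w\<close> at most \<open>2 * (9 / 10)\<^sup>2 * a\<^sup>2\<close>; the difference leaves
    the constant 38/100.\<close>
  have 6: "s * (ln 2 - ln s) + (- (1 - s) * ln y + \<delta> * ln 3) + (2 * exp (- (3 / 2) * t) - ln 3)
      \<le> \<delta> * ln 3 - 38 / 100 * (1 / (10 * real k))\<^sup>2"
  proof -
    have "s * (ln 2 - ln s) - (1 - s) * ln y - ln 3 \<le> - 2 * a\<^sup>2"
      using binary_entropy_bound[of s] s0 s23 by (simp add: y_def a_def)
    moreover have "exp (- (3 / 2) * t) \<le> (9 / 10 * a)\<^sup>2"
    proof -
      have "exp (- (3 / 2) * t) = (exp (- (3 / 4) * k * s))\<^sup>2"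
        by (simp add: power2_eq_square t_def flip: exp_add)
      also have "\<dots> \<le> (9 / 10 * a)\<^sup>2"
        using exp_chord_bound[OF k s] by (intro power_mono) (auto simp: a_def)
      finally show ?thesis .
    qed
    moreover have "(1 / (10 * real k))\<^sup>2 \<le> a\<^sup>2" using a by (intro power_mono) auto
    moreover have "(9 / 10 * a)\<^sup>2 = 81 / 100 * a\<^sup>2" by (simp add: power_mult_distrib power_divide)
    moreover have "- (1 - s) * ln y = - ((1 - s) * ln y)" by (simp only: mult_minus_left)
    ultimately show ?thesis by linarith
  qed
  have "real (card (circuits k n m)) * ((p * y) ^ m * (1 - p + p * y) ^ (3 * n ^ k - m) / y ^ n')
      = (real (card (circuits k n m)) * p ^ m) * (1 - p + p * y) ^ (3 * n ^ k - m) * (y ^ m / y ^ n')"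
    by (simp add: power_mult_distrib)
  also have "\<dots> \<le> (P * w ^ n * (2 / s * (exp 1 * \<mu>)) ^ m) * (exp 1 * exp (- \<mu>) ^ m) * exp (n * (- (1 - s) * ln y + \<delta> * ln 3))"
  proof (rule mult_mono[OF mult_mono[OF 1 2] 3])
    show "0 \<le> (1 - p + p * y) ^ (3 * n ^ k - m)"
    proof (rule zero_le_power)
      have "p \<le> 1"
        using p edge_probability[of "1 / 3" n "k - 1"] by simp
      then show "0 \<le> 1 - p + p * y" using p y by simp
    qed
  qed (use P w s0 \<mu> y p in auto)
  also have "\<dots> = exp 1 * P * (w ^ n * ((2 / s * (exp 1 * \<mu>)) ^ m * exp (- \<mu>) ^ m) * exp (n * (- (1 - s) * ln y + \<delta> * ln 3)))"
    by (simp only: mult_ac)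
  also have "\<dots> \<le> exp 1 * P * (exp (n * (2 * exp (- (3 / 2) * t) - ln 3)) * exp (n * (s * (ln 2 - ln s))) * exp (n * (- (1 - s) * ln y + \<delta> * ln 3)))"
    using P w s0 \<mu> by (intro mult_left_mono mult_right_mono mult_mono 4 5) auto
  also have "\<dots> = exp 1 * P * exp (n * (s * (ln 2 - ln s) + (- (1 - s) * ln y + \<delta> * ln 3) + (2 * exp (- (3 / 2) * t) - ln 3)))"
    by (simp only: distrib_left exp_add mult_ac)
  also have "\<dots> \<le> exp 1 * P * exp (n * (\<delta> * ln 3 - 38 / 100 * (1 / (10 * real k))\<^sup>2))"
    using P by (intro mult_left_mono iffD2[OF exp_le_cancel_iff] 6) auto
  finally show ?thesis by (simp only: P_def)
qed

lemma cube_le_8_power: "real m ^ 3 \<le> 8 ^ m"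
proof -
  have "real m \<le> 2 ^ m" by (metis less_exp less_imp_le of_nat_le_iff of_nat_numeral of_nat_power)
  then have "real m ^ 3 \<le> (2 ^ m) ^ 3" by (intro power_mono) auto
  also have "\<dots> = (2 ^ 3) ^ m" by (simp only: power_mult[symmetric] mult.commute)
  finally show ?thesis by simp
qed

text \<open>The bound \<open>m ^ 3 \<le> 8 ^ m\<close> turns the sum into a geometric series of
  ratio 4/5, uniformly in \<open>M\<close>.\<close>

lemma sum_small_circuits_le:
  fixes k :: nat
  assumes "k \<ge> 1"
  shows "(\<Sum>m=1..M. (exp 1)\<^sup>2 * (real k * real m) * (real k * real m + 1)\<^sup>2 / 10 ^ m / n)
    \<le> 20 * (exp 1)\<^sup>2 * real k ^ 3 / real n"
proof -
  have "(\<Sum>m=1..M. (exp 1)\<^sup>2 * (real k * real m) * (real k * real m + 1)\<^sup>2 / 10 ^ m / n)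
      \<le> (\<Sum>m=1..M. (exp 1)\<^sup>2 * (4 * real k ^ 3) / n * (4 / 5) ^ m)"
  proof (rule sum_mono)
    fix m assume m: "m \<in> {1..M}"
    let ?x = "real k * real m"
    have x: "1 \<le> ?x"
    proof -
      have "1 \<le> k * m" using assms m by simp
      then have "1 \<le> real (k * m)" by linarith
      then show ?thesis by simp
    qed
    have "?x * (?x + 1)\<^sup>2 \<le> ?x * (2 * ?x)\<^sup>2"
      using x by (intro mult_left_mono power_mono) auto
    also have "\<dots> = 4 * real k ^ 3 * real m ^ 3"
      by (simp add: power2_eq_square power3_eq_cube)
    also have "\<dots> \<le> 4 * real k ^ 3 * 8 ^ m" using cube_le_8_power by (intro mult_left_mono) auto
    finally have "(exp 1)\<^sup>2 * (?x * (?x + 1)\<^sup>2) / 10 ^ m / n \<le> (exp 1)\<^sup>2 * (4 * real k ^ 3 * 8 ^ m) / 10 ^ m / n"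
      by (intro divide_right_mono mult_left_mono) auto
    also have "\<dots> = (exp 1)\<^sup>2 * (4 * real k ^ 3) / n * (8 ^ m / 10 ^ m)" by (simp add: mult.commute)
    also have "8 ^ m / 10 ^ m = (4 / 5 :: real) ^ m" by (simp flip: power_divide)
    finally show "(exp 1)\<^sup>2 * ?x * (?x + 1)\<^sup>2 / 10 ^ m / n \<le> (exp 1)\<^sup>2 * (4 * real k ^ 3) / n * (4 / 5) ^ m"
      by (simp add: mult.assoc)
  qed
  also have "\<dots> = (exp 1)\<^sup>2 * (4 * real k ^ 3) / n * (\<Sum>m=1..M. (4 / 5) ^ m)"
    by (simp add: sum_distrib_left)
  also have "\<dots> \<le> (exp 1)\<^sup>2 * (4 * real k ^ 3) / n * 5"
  proof (rule mult_left_mono)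
    have "(\<Sum>m=1..M. (4 / 5) ^ m) \<le> (\<Sum>m<Suc M. (4 / 5 :: real) ^ m)"
      by (intro sum_mono2) auto
    also have "\<dots> \<le> 5" by (simp add: sum_gp_strict)
    finally show "(\<Sum>m=1..M. (4 / 5) ^ m) \<le> (5::real)" .
  qed simp
  finally show ?thesis by simp
qed

definition has_small_circuit :: "real \<Rightarrow> equation set \<Rightarrow> bool" where
  "has_small_circuit L F \<longleftrightarrow> (\<exists>l\<in>left_ker F. supp F l \<noteq> {} \<and> real (card (supp F l)) \<le> L)"

text \<open>Either the number of equations deviates from its mean by at least
  \<open>\<delta> * n\<close>, or there is a circuit of weight at most \<open>n div k\<close>, or
  one of larger weight in a formula with at most \<open>n'\<close> equations. The first summand is
  Chebyshev's inequality, the other two are union bounds over the weight.\<close>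

lemma has_small_circuit_few:
  fixes n k :: nat and c \<delta> :: real
  assumes k: "k \<ge> 16" and c: "0 \<le> c" "c \<le> 1 / 3" and n: "n > 0" and \<delta>: "\<delta> > 0"
  shows "expect (c / real n ^ (k - 1)) (equations k n) (\<lambda>F. of_bool (has_small_circuit ((2 / 3 - 1 / (10 * real k)) * n) F))
    \<le> 1 / (\<delta>\<^sup>2 * n) + 20 * (exp 1)\<^sup>2 * real k ^ 3 / n
      + n * (exp 1 * ((exp 1)\<^sup>2 * (real k * n + 1)\<^sup>2) * exp (n * (\<delta> * ln 3 - 38 / 100 * (1 / (10 * real k))\<^sup>2)))"
proof -
  define p where "p = c / real n ^ (k - 1)"
  define L where "L = (2 / 3 - 1 / (10 * real k)) * n"
  define n' where "n' = nat \<lfloor>(1 + \<delta>) * n\<rfloor>"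
  define R where "R = exp 1 * ((exp 1)\<^sup>2 * (real k * n + 1)\<^sup>2) * exp (n * (\<delta> * ln 3 - 38 / 100 * (1 / (10 * real k))\<^sup>2))"
  define M where "M = n div k"
  let ?E = "equations k n"
  have "0 \<le> 1 / (10 * real k)" by simp
  then have hk: "2 / 3 - 1 / (10 * real k) < 1" by linarith
  have p: "0 \<le> p" "p \<le> 1 / (3 * real n ^ (k - 1))"
    using c n by (auto simp: p_def field_simps)
  have p1: "p \<le> 1" using c edge_probability[of c n "k - 1"] by (simp add: p_def)
  have "real n ^ k = n * real n ^ (k - 1)" using k by (metis not_numeral_le_zero power_eq_if)
  then have pN: "p * card ?E = 3 * c * n" using n by (simp add: p_def card_equations)
  have n': "real n' \<le> (1 + \<delta>) * n" using \<delta> by (simp add: n'_def)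
  have fin: "finite ?E" by (rule finite_equations)
  have "(of_bool (has_small_circuit L F) :: real) \<le> of_bool (\<bar>real (card F) - p * card ?E\<bar> \<ge> \<delta> * n)
      + (\<Sum>m=1..M. of_bool (has_circuit m F))
      + (\<Sum>m\<in>{m. M < m \<and> m \<le> n \<and> real m \<le> L}. of_bool (has_circuit m F \<and> card F \<le> n'))" (is "_ \<le> ?A + ?B + ?C")
    if F: "F \<subseteq> ?E" for F
  proof (cases "has_small_circuit L F")
    case True
    then obtain l where l: "l \<in> left_ker F" "supp F l \<noteq> {}" "real (card (supp F l)) \<le> L"
      by (auto simp: has_small_circuit_def)
    define m where "m = card (supp F l)"
    have "finite (supp F l)" using F by (intro finite_subset[OF _ fin]) (auto simp: supp_def)
    then have m: "m \<ge> 1" "has_circuit m F" "real m \<le> L"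
      using l by (auto simp: m_def has_circuit_def Suc_le_eq card_gt_0_iff)
    have nn: "0 \<le> ?A" "0 \<le> ?B" "0 \<le> ?C" by (auto intro!: sum_nonneg)
    consider "\<bar>real (card F) - p * card ?E\<bar> \<ge> \<delta> * n" | "m \<le> M" | "M < m" "\<bar>real (card F) - p * card ?E\<bar> < \<delta> * n"
      by linarith
    then show ?thesis
    proof cases
      case 1
      then show ?thesis using nn True by simp
    next
      case 2
      then have "of_bool (has_circuit m F) \<le> ?B"
        using m by (intro member_le_sum) auto
      then show ?thesis using nn True m by simp
    next
      case 3
      have "real (card F) < 3 * c * n + \<delta> * n" using 3 pN by linarith
      also have "\<dots> \<le> (1 + \<delta>) * n" using c n by (simp add: algebra_simps)
      finally have "card F \<le> n'" by (simp add: n'_def le_nat_floor)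
      moreover have "L \<le> 1 * real n" unfolding L_def using hk by (intro mult_right_mono) auto
      then have "m \<le> n" using m by linarith
      ultimately have "of_bool (has_circuit m F \<and> card F \<le> n') \<le> ?C"
        using m 3 by (intro member_le_sum) auto
      then show ?thesis using nn True m \<open>card F \<le> n'\<close> by simp
    qed
  qed (auto intro!: add_nonneg_nonneg sum_nonneg)
  then have "expect p ?E (\<lambda>F. of_bool (has_small_circuit L F)) \<le> expect p ?E (\<lambda>F. of_bool (\<bar>real (card F) - p * card ?E\<bar> \<ge> \<delta> * n)
      + (\<Sum>m=1..M. of_bool (has_circuit m F))
      + (\<Sum>m\<in>{m. M < m \<and> m \<le> n \<and> real m \<le> L}. of_bool (has_circuit m F \<and> card F \<le> n')))"
    using p p1 by (intro expect_mono) auto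
  also have "\<dots> = expect p ?E (\<lambda>F. of_bool (\<bar>real (card F) - p * card ?E\<bar> \<ge> \<delta> * n))
      + (\<Sum>m=1..M. expect p ?E (\<lambda>F. of_bool (has_circuit m F)))
      + (\<Sum>m\<in>{m. M < m \<and> m \<le> n \<and> real m \<le> L}. expect p ?E (\<lambda>F. of_bool (has_circuit m F \<and> card F \<le> n')))"
    by (simp only: expect_add expect_sum)
  also have "\<dots> \<le> 1 / (\<delta>\<^sup>2 * n) + 20 * (exp 1)\<^sup>2 * real k ^ 3 / n + n * R"
  proof (intro add_mono)
    have "expect p ?E (\<lambda>F. of_bool (\<bar>real (card F) - p * card ?E\<bar> \<ge> \<delta> * n)) \<le> p * card ?E / (\<delta> * n)\<^sup>2"
      using p p1 fin \<delta> n by (intro expect_card_deviation) auto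
    also have "\<dots> = 3 * c / (\<delta>\<^sup>2 * n)" using n unfolding pN by (simp add: power2_eq_square)
    also have "\<dots> \<le> 1 / (\<delta>\<^sup>2 * n)" using c by (intro divide_right_mono) auto
    finally show "expect p ?E (\<lambda>F. of_bool (\<bar>real (card F) - p * card ?E\<bar> \<ge> \<delta> * n)) \<le> 1 / (\<delta>\<^sup>2 * n)" .
    have "(\<Sum>m=1..M. expect p ?E (\<lambda>F. of_bool (has_circuit m F)))
        \<le> (\<Sum>m=1..M. (exp 1)\<^sup>2 * (real k * real m) * (real k * real m + 1)\<^sup>2 / 10 ^ m / n)"
    proof (rule sum_mono)
      fix m assume m: "m \<in> {1..M}"
      have "k * m \<le> k * (n div k)" using m by (simp add: M_def)
      also have "\<dots> \<le> n" by simp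
      finally have km: "k * m \<le> n" .
      have "expect p ?E (\<lambda>F. of_bool (has_circuit m F)) \<le> real (card (circuits k n m)) * p ^ m"
        using p p1 by (intro expect_has_circuit) auto
      also have "\<dots> \<le> (exp 1)\<^sup>2 * (real k * real m) * (real k * real m + 1)\<^sup>2 / 10 ^ m / n"
        using m by (intro circuits_few_small k km p) auto
      finally show "expect p ?E (\<lambda>F. of_bool (has_circuit m F)) \<le> (exp 1)\<^sup>2 * (real k * real m) * (real k * real m + 1)\<^sup>2 / 10 ^ m / n" .
    qed
    also have "\<dots> \<le> 20 * (exp 1)\<^sup>2 * real k ^ 3 / n"
      using k by (intro sum_small_circuits_le) auto
    finally show "(\<Sum>m=1..M. expect p ?E (\<lambda>F. of_bool (has_circuit m F))) \<le> 20 * (exp 1)\<^sup>2 * real k ^ 3 / n" .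
    have "(\<Sum>m\<in>{m. M < m \<and> m \<le> n \<and> real m \<le> L}. expect p ?E (\<lambda>F. of_bool (has_circuit m F \<and> card F \<le> n')))
        \<le> (\<Sum>m\<in>{m. M < m \<and> m \<le> n \<and> real m \<le> L}. R)"
    proof (rule sum_mono)
      fix m assume "m \<in> {m. M < m \<and> m \<le> n \<and> real m \<le> L}"
      then have m: "M < m" "m \<le> n" "real m \<le> (2 / 3 - 1 / (10 * real k)) * n" by (auto simp: L_def)
      have "n div k < m" using m by (simp add: M_def)
      then have km: "n \<le> k * m" using k by (simp add: div_less_iff_less_mult mult.commute)
      let ?s = "real m / n"
      have "(2 / 3 - 1 / (10 * real k)) * n < 1 * real n" using hk n by (intro mult_strict_right_mono) auto
      then have "real m < real n" using m(3) by linarith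
      then have s: "?s < 1" using n by simp
      have mn': "m \<le> n'"
      proof -
        have "real m \<le> (1 + \<delta>) * n" using m \<delta> by (simp add: algebra_simps add_increasing2)
        then show ?thesis by (simp add: n'_def le_nat_floor)
      qed
      have "expect p ?E (\<lambda>F. of_bool (has_circuit m F \<and> card F \<le> n'))
          \<le> real (card (circuits k n m)) * ((p * (1 - ?s)) ^ m * (1 - p + p * (1 - ?s)) ^ (3 * n ^ k - m) / (1 - ?s) ^ n')"
        using p p1 s by (intro expect_has_circuit_few) auto
      also have "\<dots> \<le> exp 1 * ((exp 1)\<^sup>2 * (real (k * m) + 1)\<^sup>2) * exp (n * (\<delta> * ln 3 - 38 / 100 * (1 / (10 * real k))\<^sup>2))"
        using \<delta> by (intro circuits_few_medium k n km m p mn' n') auto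
      also have "\<dots> \<le> R"
        unfolding R_def using m by (intro mult_right_mono mult_left_mono power_mono) (auto intro: mult_left_mono)
      finally show "expect p ?E (\<lambda>F. of_bool (has_circuit m F \<and> card F \<le> n')) \<le> R" .
    qed
    also have "\<dots> = card {m. M < m \<and> m \<le> n \<and> real m \<le> L} * R" by simp
    also have "\<dots> \<le> n * R"
    proof (rule mult_right_mono)
      have "card {m. M < m \<and> m \<le> n \<and> real m \<le> L} \<le> card {1..n}" by (intro card_mono) auto
      then show "real (card {m. M < m \<and> m \<le> n \<and> real m \<le> L}) \<le> real n" by simp
    qed (simp add: R_def)
    finally show "(\<Sum>m\<in>{m. M < m \<and> m \<le> n \<and> real m \<le> L}. expect p ?E (\<lambda>F. of_bool (has_circuit m F \<and> card F \<le> n'))) \<le> n * R" .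
  qed
  finally show ?thesis by (simp only: p_def L_def R_def)
qed

lemma has_small_circuit_negligible:
  fixes k :: nat and c :: real
  assumes k: "k \<ge> 16" and c: "0 \<le> c" "c \<le> 1 / 3"
  shows "(\<lambda>n. expect (c / real n ^ (k - 1)) (equations k n) (\<lambda>F. of_bool (has_small_circuit ((2 / 3 - 1 / (10 * real k)) * n) F)))
    \<longlonglongrightarrow> 0"
proof -
  \<comment> \<open>Half of the gain 38/100 pays for the fluctuation \<open>\<delta>\<close> of the
    number of equations.\<close>
  define \<theta> where "\<theta> = 19 / 100 * (1 / (10 * real k))\<^sup>2"
  define \<delta> where "\<delta> = \<theta> / ln 3"
  have \<theta>: "\<theta> > 0" using k by (simp add: \<theta>_def)
  have \<delta>: "\<delta> > 0" using \<theta> by (simp add: \<delta>_def)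
  have exponent: "\<delta> * ln 3 - 38 / 100 * (1 / (10 * real k))\<^sup>2 = - \<theta>"
    by (simp add: \<delta>_def \<theta>_def)
  define U where "U n = 1 / (\<delta>\<^sup>2 * n) + 20 * (exp 1)\<^sup>2 * real k ^ 3 / n
      + n * (exp 1 * ((exp 1)\<^sup>2 * (real k * n + 1)\<^sup>2) * exp (n * (- \<theta>)))" for n :: nat
  have "U \<longlonglongrightarrow> 0"
    unfolding U_def using \<theta> \<delta> k by real_asymp
  then show ?thesis
  proof (rule tendsto_sandwich[rotated 3])
    show "\<forall>\<^sub>F n in sequentially. expect (c / real n ^ (k - 1)) (equations k n) (\<lambda>F. of_bool (has_small_circuit ((2 / 3 - 1 / (10 * real k)) * n) F)) \<le> U n"
      using eventually_gt_at_top[of 0]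
    proof eventually_elim
      case (elim n)
      show ?case using has_small_circuit_few[OF k c elim \<delta>] unfolding U_def exponent .
    qed
    show "\<forall>\<^sub>F n in sequentially. 0 \<le> expect (c / real n ^ (k - 1)) (equations k n) (\<lambda>F. of_bool (has_small_circuit ((2 / 3 - 1 / (10 * real k)) * n) F))"
      using c edge_probability[of c _ "k - 1"]
      by (intro always_eventually allI expect_nonneg) auto
  qed simp
qed

subsection \<open>From dependence to an almost full row span\<close>

text \<open>The kernel has \<open>3 ^ d\<close> elements; once \<open>K\<close> is large, the average weight of its elements is close to 2/3
  of the size of the union of their supports.\<close>

definition dependent :: "nat \<Rightarrow> equation set \<Rightarrow> bool" where
  "dependent K F \<longleftrightarrow> K \<le> card (left_ker F)"

lemma dependent_mono: "dependent K F \<Longrightarrow> F \<subseteq> G \<Longrightarrow> finite G \<Longrightarrow> dependent K G"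
  unfolding dependent_def using card_left_ker_mono order_trans by blast

definition spanned :: "nat \<Rightarrow> nat \<Rightarrow> equation set \<Rightarrow> equation set" where
  "spanned k n F = {e \<in> equations k n. in_span F (row e)}"

text \<open>A redundant equation \<open>e\<close> has its row in the span of \<open>F - {e}\<close>.
  If \<open>A\<close> holds for \<open>F - {e}\<close> as well, it is counted in the first term;
  otherwise \<open>e\<close> is pivotal for the increasing event \<open>A\<close>, and
  \<open>expect_pivotal\<close> bounds the expected number of such \<open>e\<close>.\<close>

lemma redundant_expect_le:
  fixes p :: real
  assumes p: "0 \<le> p" "p < 1"
    and mono: "\<And>F G. A F \<Longrightarrow> F \<subseteq> G \<Longrightarrow> G \<subseteq> equations k n \<Longrightarrow> A G"
  defines "E \<equiv> equations k n"
  shows "expect p E (\<lambda>F. real (card (redundant F)) * of_bool (A F))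
    \<le> expect p E (\<lambda>F. \<Sum>e\<in>E. of_bool (e \<in> F) * of_bool (in_span (F - {e}) (row e) \<and> A (F - {e})))
      + expect p E (\<lambda>F. \<bar>real (card F) - p * card E\<bar>) / (1 - p)"
proof -
  have fin: "finite E" by (simp add: E_def finite_equations)
  let ?h = "\<lambda>F. of_bool (A F) :: real"
  let ?s = "\<lambda>F e. of_bool (e \<in> F) * of_bool (in_span (F - {e}) (row e) \<and> A (F - {e})) :: real"
  have pt: "real (card (redundant F)) * ?h F \<le> (\<Sum>e\<in>E. ?s F e) + (\<Sum>e\<in>E. of_bool (e \<in> F) * (?h F - ?h (F - {e})))"
    if F: "F \<subseteq> E" for F
  proof -
    have finF: "finite F" using F fin finite_subset by blast
    have "real (card (redundant F)) * ?h F = (\<Sum>e\<in>redundant F. ?h F)" by simp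
    also have "\<dots> \<le> (\<Sum>e\<in>redundant F. ?s F e + of_bool (e \<in> F) * (?h F - ?h (F - {e})))"
    proof (rule sum_mono)
      fix e assume e: "e \<in> redundant F"
      then have "e \<in> F" "in_span (F - {e}) (row e)"
        using redundant_in_span finF by (auto simp: redundant_def)
      then show "?h F \<le> ?s F e + of_bool (e \<in> F) * (?h F - ?h (F - {e}))" by simp
    qed
    also have "\<dots> \<le> (\<Sum>e\<in>E. ?s F e + of_bool (e \<in> F) * (?h F - ?h (F - {e})))"
    proof (rule sum_mono2[OF fin])
      show "redundant F \<subseteq> E" using F by (auto simp: redundant_def)
      fix e
      have "A (F - {e}) \<Longrightarrow> A F" by (rule mono) (use F E_def in auto)
      then show "0 \<le> ?s F e + of_bool (e \<in> F) * (?h F - ?h (F - {e}))" by auto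
    qed
    finally show ?thesis by (simp only: sum.distrib)
  qed
  have "expect p E (\<lambda>F. real (card (redundant F)) * ?h F)
      \<le> expect p E (\<lambda>F. (\<Sum>e\<in>E. ?s F e) + (\<Sum>e\<in>E. of_bool (e \<in> F) * (?h F - ?h (F - {e}))))"
    using p pt by (intro expect_mono) auto
  also have "\<dots> = expect p E (\<lambda>F. \<Sum>e\<in>E. ?s F e) + (\<Sum>e\<in>E. expect p E (\<lambda>F. of_bool (e \<in> F) * (?h F - ?h (F - {e}))))"
    by (simp only: expect_add expect_sum)
  also have "(\<Sum>e\<in>E. expect p E (\<lambda>F. of_bool (e \<in> F) * (?h F - ?h (F - {e}))))
      \<le> expect p E (\<lambda>F. \<bar>real (card F) - p * card E\<bar>) / (1 - p)"
  proof -
    have "(1 - p) * (\<Sum>e\<in>E. expect p E (\<lambda>F. of_bool (e \<in> F) * (?h F - ?h (F - {e}))))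
        = expect p E (\<lambda>F. (real (card F) - p * card E) * ?h F)"
      by (rule expect_pivotal[OF fin])
    also have "\<dots> \<le> expect p E (\<lambda>F. \<bar>real (card F) - p * card E\<bar>)"
      using p by (intro expect_mono) auto
    finally show ?thesis using p by (simp add: pos_le_divide_eq mult.commute)
  qed
  finally show ?thesis by simp
qed

text \<open>Putting such an \<open>e\<close> back triples the kernel of
  \<open>F - {e}\<close>.\<close>

lemma dependent_insert_sum:
  assumes "F \<subseteq> E" "finite E"
  shows "(\<Sum>e\<in>E. of_bool (e \<in> F) * of_bool (in_span (F - {e}) (row e) \<and> dependent K (F - {e})))
    \<le> real (card F) * of_bool (dependent (3 * K) F)"
proof -
  have finF: "finite F" using assms finite_subset by blast
  have "dependent (3 * K) F" if "e \<in> F" "in_span (F - {e}) (row e)" "dependent K (F - {e})" for e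
  proof -
    have "3 * card (left_ker (F - {e})) \<le> card (left_ker (insert e (F - {e})))"
      using that finF by (intro card_left_ker_insert) auto
    then show ?thesis using that by (simp add: dependent_def insert_absorb)
  qed
  then have "(\<Sum>e\<in>E. of_bool (e \<in> F) * of_bool (in_span (F - {e}) (row e) \<and> dependent K (F - {e})))
      \<le> (\<Sum>e\<in>E. of_bool (e \<in> F) * of_bool (dependent (3 * K) F) :: real)"
    by (intro sum_mono) auto
  also have "\<dots> = real (card (E \<inter> F)) * of_bool (dependent (3 * K) F)"
    using assms by (simp add: sum_distrib_right[symmetric] of_bool_def sum.If_cases)
  finally show ?thesis using assms by (simp add: Int_absorb1)
qed

text \<open>Resampling: inclusion of \<open>e\<close> is independent of \<open>F - {e}\<close>, so
  each term is \<open>p\<close> times the probability that \<open>F - {e}\<close> spans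
  \<open>e\<close> and satisfies \<open>A\<close>. Both events are increasing, so
  \<open>F - {e}\<close> may be enlarged to \<open>F\<close>.\<close>

lemma spanned_expect:
  fixes p :: real
  assumes p: "0 \<le> p" "p \<le> 1"
    and mono: "\<And>F G. A F \<Longrightarrow> F \<subseteq> G \<Longrightarrow> G \<subseteq> equations k n \<Longrightarrow> A G"
  defines "E \<equiv> equations k n"
  shows "expect p E (\<lambda>F. \<Sum>e\<in>E. of_bool (e \<in> F) * of_bool (in_span (F - {e}) (row e) \<and> A (F - {e})))
    \<le> p * expect p E (\<lambda>F. real (card (spanned k n F)) * of_bool (A F))"
proof -
  have fin: "finite E" by (simp add: E_def finite_equations)
  have "expect p E (\<lambda>F. \<Sum>e\<in>E. of_bool (e \<in> F) * of_bool (in_span (F - {e}) (row e) \<and> A (F - {e})))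
      = (\<Sum>e\<in>E. p * expect p E (\<lambda>F. of_bool (in_span (F - {e}) (row e) \<and> A (F - {e}))))"
    unfolding expect_sum using expect_mem(1)[OF fin, where h = "\<lambda>F. of_bool (in_span F (row _) \<and> A F)"]
    by (intro sum.cong refl)
  also have "\<dots> \<le> (\<Sum>e\<in>E. p * expect p E (\<lambda>F. of_bool (in_span F (row e) \<and> A F)))"
  proof (intro sum_mono mult_left_mono expect_mono p)
    fix e F assume F: "F \<subseteq> E"
    have "A (F - {e}) \<Longrightarrow> A F" by (rule mono) (use F E_def in auto)
    moreover have "in_span (F - {e}) (row e) \<Longrightarrow> in_span F (row e)"
      using F fin finite_subset in_span_mono by blast
    ultimately show "(of_bool (in_span (F - {e}) (row e) \<and> A (F - {e})) :: real) \<le> of_bool (in_span F (row e) \<and> A F)"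
      by auto
  qed
  also have "\<dots> = p * expect p E (\<lambda>F. \<Sum>e\<in>E. of_bool (in_span F (row e) \<and> A F))"
    by (simp only: expect_sum sum_distrib_left)
  also have "expect p E (\<lambda>F. \<Sum>e\<in>E. of_bool (in_span F (row e) \<and> A F))
      = expect p E (\<lambda>F. real (card (spanned k n F)) * of_bool (A F))"
  proof (rule expect_cong)
    fix F
    show "(\<Sum>e\<in>E. of_bool (in_span F (row e) \<and> A F)) = real (card (spanned k n F)) * of_bool (A F)"
    proof (cases "A F")
      case True
      then have "(\<Sum>e\<in>E. of_bool (in_span F (row e) \<and> A F)) = (\<Sum>e\<in>E. if in_span F (row e) then 1 else (0::real))"
        by (intro sum.cong) auto
      also have "\<dots> = real (card (spanned k n F))"
        using fin by (simp add: sum.If_cases spanned_def E_def Int_def)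
      finally show ?thesis using True by simp
    qed simp
  qed
  finally show ?thesis .
qed

text \<open>Slightly below 2/3, the typical density of a random kernel vector over the field with 3 elements.\<close>

definition circuit_size :: "nat \<Rightarrow> real" where
  "circuit_size k = 2 / 3 - 1 / (10 * real k)"

text \<open>On dependent formulas without small circuits \<open>card_redundant_ge\<close> applies
  with kernel size at least \<open>K\<close>; on all others the subtracted term makes the left side
  nonpositive.\<close>

lemma redundant_expect_ge:
  fixes p :: real
  assumes p: "0 \<le> p" "p \<le> 1" and K: "K \<ge> 2" and L: "L \<ge> 0"
  shows "3 / 2 * (1 - 1 / K) * L * (expect p (equations k n) (\<lambda>F. of_bool (dependent K F))
      - expect p (equations k n) (\<lambda>F. of_bool (has_small_circuit L F)))
    \<le> expect p (equations k n) (\<lambda>F. real (card (redundant F)) * of_bool (dependent K F))"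
proof -
  let ?c = "3 / 2 * (1 - 1 / real K) * L"
  have K0: "0 \<le> 1 - 1 / real K" using K by simp
  have "?c * (of_bool (dependent K F) - of_bool (has_small_circuit L F)) \<le> real (card (redundant F)) * of_bool (dependent K F)"
    if F: "F \<subseteq> equations k n" for F
  proof (cases "dependent K F \<and> \<not> has_small_circuit L F")
    case True
    let ?N = "real (card (left_ker F))"
    have finF: "finite F" using F finite_equations finite_subset by blast
    have "3 * (?N - 1) * L \<le> 2 * ?N * real (card (redundant F))"
      using True by (intro card_redundant_ge finF) (auto simp: has_small_circuit_def not_le)
    moreover have N: "real K \<le> ?N" using True by (simp add: dependent_def)
    ultimately have "3 / 2 * (1 - 1 / ?N) * L \<le> real (card (redundant F))"
      using K by (simp add: field_simps)
    moreover have "?c \<le> 3 / 2 * (1 - 1 / ?N) * L"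
      using N K L by (intro mult_right_mono mult_left_mono diff_left_mono divide_left_mono) auto
    ultimately show ?thesis using True by simp
  next
    case False
    then show ?thesis using K0 L by (cases "dependent K F") auto
  qed
  then have "expect p (equations k n) (\<lambda>F. ?c * (of_bool (dependent K F) - of_bool (has_small_circuit L F)))
      \<le> expect p (equations k n) (\<lambda>F. real (card (redundant F)) * of_bool (dependent K F))"
    using p by (intro expect_mono) auto
  then show ?thesis by (simp only: expect_cmult expect_diff)
qed

lemma edge_mean:
  assumes "k \<ge> 1" "n > 0"
  shows "c / real n ^ (k - 1) * card (equations k n) = 3 * c * n"
proof -
  have "real n ^ k = n * real n ^ (k - 1)" using assms by (metis not_one_le_zero power_eq_if)
  then show ?thesis using assms by (simp add: card_equations)
qed

lemma edge_deviation:
  assumes "k \<ge> 1" "n > 0" "0 \<le> c" "c \<le> 1 / 3"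
  shows "expect (c / real n ^ (k - 1)) (equations k n) (\<lambda>F. \<bar>real (card F) - c / real n ^ (k - 1) * card (equations k n)\<bar>) \<le> sqrt n"
proof -
  have "expect (c / real n ^ (k - 1)) (equations k n) (\<lambda>F. \<bar>real (card F) - c / real n ^ (k - 1) * card (equations k n)\<bar>)
      \<le> (sqrt n + c / real n ^ (k - 1) * card (equations k n) / sqrt n) / 2"
    using assms edge_probability[of c n "k - 1"] by (intro expect_abs_card finite_equations) auto
  also have "\<dots> \<le> (sqrt n + n / sqrt n) / 2"
    unfolding edge_mean[OF assms(1,2)] using assms by (intro divide_right_mono add_left_mono) auto
  also have "\<dots> = sqrt n" using assms by (simp add: real_div_sqrt)
  finally show ?thesis .
qed

lemma edge_probability_third:
  assumes "0 \<le> c" "c \<le> 1 / 3"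
  shows "c / real n ^ j \<le> 1 / 2"
  using edge_probability[of "2 * c" n j] assms by (simp add: mult.commute)

text \<open>Two ways to continue from the same sum. Counting inside \<open>F\<close>, many redundant
  equations force a kernel of size \<open>3 * K\<close>; counting over all possible equations, they
  force many spanned ones. The errors of order \<open>sqrt n\<close> come from pivotal equations and
  from the fluctuation of \<open>card F\<close>.\<close>

lemma dependent_redundant_le:
  fixes k n :: nat and c :: real
  assumes k: "k \<ge> 1" and n: "n > 0" and c: "0 \<le> c" "c \<le> 1 / 3"
  defines "p \<equiv> c / real n ^ (k - 1)" and "E \<equiv> equations k n"
  shows "expect p E (\<lambda>F. real (card (redundant F)) * of_bool (dependent K F))
      \<le> n * expect p E (\<lambda>F. of_bool (dependent (3 * K) F)) + 3 * sqrt n"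
    and "expect p E (\<lambda>F. real (card (redundant F)) * of_bool (dependent K F))
      \<le> p * expect p E (\<lambda>F. real (card (spanned k n F)) * of_bool (dependent K F)) + 2 * sqrt n"
proof -
  have fin: "finite E" by (simp add: E_def finite_equations)
  have p: "0 \<le> p" "p \<le> 1" "p \<le> 1 / 2"
    using edge_probability[of c n "k - 1"] edge_probability_third[of c n "k - 1"] c by (auto simp: p_def)
  have dev: "expect p E (\<lambda>F. \<bar>real (card F) - p * card E\<bar>) \<le> sqrt n"
    unfolding p_def E_def by (rule edge_deviation[OF k n c])
  have mean: "p * card E = 3 * c * n" unfolding p_def E_def by (rule edge_mean[OF k n])
  have "expect p E (\<lambda>F. \<bar>real (card F) - p * card E\<bar>) / (1 - p) \<le> sqrt n / (1 / 2)"
    using p dev by (intro frac_le) auto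
  then have dev2: "expect p E (\<lambda>F. \<bar>real (card F) - p * card E\<bar>) / (1 - p) \<le> 2 * sqrt n" by simp
  have mono: "dependent K F \<Longrightarrow> F \<subseteq> G \<Longrightarrow> G \<subseteq> equations k n \<Longrightarrow> dependent K G" for F G
    using dependent_mono finite_equations finite_subset by blast
  let ?S = "expect p E (\<lambda>F. \<Sum>e\<in>E. of_bool (e \<in> F) * of_bool (in_span (F - {e}) (row e) \<and> dependent K (F - {e})))"
  have S: "expect p E (\<lambda>F. real (card (redundant F)) * of_bool (dependent K F)) \<le> ?S + 2 * sqrt n"
    using redundant_expect_le[of p "dependent K" k n] p mono dev2 unfolding E_def by fastforce
  have "?S \<le> p * expect p E (\<lambda>F. real (card (spanned k n F)) * of_bool (dependent K F))"
    unfolding E_def using p mono by (intro spanned_expect) auto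
  then show "expect p E (\<lambda>F. real (card (redundant F)) * of_bool (dependent K F))
      \<le> p * expect p E (\<lambda>F. real (card (spanned k n F)) * of_bool (dependent K F)) + 2 * sqrt n"
    using S by linarith
  have "?S \<le> expect p E (\<lambda>F. real (card F) * of_bool (dependent (3 * K) F))"
    using p fin by (intro expect_mono dependent_insert_sum) auto
  also have "\<dots> \<le> expect p E (\<lambda>F. real n * of_bool (dependent (3 * K) F) + \<bar>real (card F) - p * card E\<bar>)"
  proof (intro expect_mono p)
    fix F :: "equation set"
    have "3 * c * n \<le> 1 * real n" using c by (intro mult_right_mono) auto
    then have "real (card F) \<le> n + \<bar>real (card F) - p * card E\<bar>" unfolding mean by linarith
    then show "real (card F) * of_bool (dependent (3 * K) F) \<le> real n * of_bool (dependent (3 * K) F) + \<bar>real (card F) - p * card E\<bar>"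
      by auto
  qed
  also have "\<dots> = n * expect p E (\<lambda>F. of_bool (dependent (3 * K) F)) + expect p E (\<lambda>F. \<bar>real (card F) - p * card E\<bar>)"
    by (simp only: expect_add expect_cmult)
  finally show "expect p E (\<lambda>F. real (card (redundant F)) * of_bool (dependent K F))
      \<le> n * expect p E (\<lambda>F. of_bool (dependent (3 * K) F)) + 3 * sqrt n"
    using S dev by linarith
qed

definition prob_of :: "real \<Rightarrow> nat \<Rightarrow> (nat \<Rightarrow> equation set \<Rightarrow> bool) \<Rightarrow> nat \<Rightarrow> real" where
  "prob_of c k P n = expect (c / real n ^ (k - 1)) (equations k n) (\<lambda>F. of_bool (P n F))"

lemma prob_of_nonneg: "0 \<le> c \<Longrightarrow> c \<le> 1 \<Longrightarrow> 0 \<le> prob_of c k P n"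
  unfolding prob_of_def using edge_probability[of c n "k - 1"] by (intro expect_nonneg) auto

lemma prob_of_mono:
  assumes "0 \<le> c" "c \<le> 1" "\<And>F. F \<subseteq> equations k n \<Longrightarrow> P n F \<Longrightarrow> Q n F"
  shows "prob_of c k P n \<le> prob_of c k Q n"
  unfolding prob_of_def using edge_probability[of c n "k - 1"] assms by (intro expect_mono) auto

lemma tendsto_0_le:
  fixes f g :: "nat \<Rightarrow> real"
  assumes "g \<longlonglongrightarrow> 0" "\<And>n. n > 0 \<Longrightarrow> f n \<le> g n" "\<And>n. 0 \<le> f n"
  shows "f \<longlonglongrightarrow> 0"
proof (rule tendsto_sandwich[OF _ _ tendsto_const assms(1)])
  show "\<forall>\<^sub>F n in sequentially. 0 \<le> f n" using assms by simp
  show "\<forall>\<^sub>F n in sequentially. f n \<le> g n"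
    using eventually_gt_at_top[of 0] by eventually_elim (use assms in auto)
qed

lemma circuit_size_bounds:
  assumes "k \<ge> 16"
  shows "0 < circuit_size k" "3 / 2 * circuit_size k = 1 - 3 / (20 * real k)" "3 / 5 \<le> circuit_size k"
proof -
  have "1 / (10 * real k) \<le> 1 / (10 * 16)" using assms by (intro divide_left_mono) auto
  then show "3 / 5 \<le> circuit_size k" by (simp add: circuit_size_def)
  then show "0 < circuit_size k" by simp
  show "3 / 2 * circuit_size k = 1 - 3 / (20 * real k)" by (simp add: circuit_size_def right_diff_distrib)
qed

lemma small_circuit_tendsto:
  assumes "k \<ge> 16" "0 \<le> c" "c \<le> 1 / 3"
  shows "prob_of c k (\<lambda>n. has_small_circuit (circuit_size k * n)) \<longlonglongrightarrow> 0"
  using has_small_circuit_negligible[OF assms] unfolding prob_of_def[abs_def] circuit_size_def .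

text \<open>With a kernel of size \<open>K\<close> about \<open>a * n\<close> equations are
  redundant, so a kernel of size \<open>3 * K\<close> is at most a constant factor less likely, up
  to vanishing errors.\<close>

lemma dependent_step:
  assumes k: "k \<ge> 16" and c: "0 \<le> c" "c \<le> 1 / 3" and K: "K \<ge> 2"
    and lim: "prob_of c k (\<lambda>n. dependent (3 * K)) \<longlonglongrightarrow> 0"
  shows "prob_of c k (\<lambda>n. dependent K) \<longlonglongrightarrow> 0"
proof -
  let ?S = "prob_of c k (\<lambda>n. has_small_circuit (circuit_size k * n))"
  let ?A = "\<lambda>K. prob_of c k (\<lambda>n. dependent K)"
  define a where "a = 3 / 2 * (1 - 1 / real K) * circuit_size k"
  have "1 / real K < 1" using K by simp
  then have a: "a > 0" unfolding a_def using circuit_size_bounds(1)[OF k] by (intro mult_pos_pos) auto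
  have le: "?A K n \<le> ?S n + (?A (3 * K) n + 3 / sqrt n) / a" if n: "n > 0" for n
  proof -
    have "a * n * (?A K n - ?S n) \<le> n * ?A (3 * K) n + 3 * sqrt n"
    proof -
      have "a * n * (?A K n - ?S n) = 3 / 2 * (1 - 1 / real K) * (circuit_size k * n) * (?A K n - ?S n)"
        by (simp add: a_def)
      also have "\<dots> \<le> n * ?A (3 * K) n + 3 * sqrt n"
        unfolding prob_of_def
        using c edge_probability[of c n "k - 1"] circuit_size_bounds(1)[OF k] k n
        by (intro order_trans[OF redundant_expect_ge dependent_redundant_le(1)] K) auto
      finally show ?thesis .
    qed
    also have "\<dots> = n * (?A (3 * K) n + 3 / sqrt n)"
      using n by (simp add: field_simps real_div_sqrt)
    finally have "n * (a * (?A K n - ?S n)) \<le> n * (?A (3 * K) n + 3 / sqrt n)" by (simp add: mult_ac)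
    then have "a * (?A K n - ?S n) \<le> ?A (3 * K) n + 3 / sqrt n" using n by simp
    then show ?thesis using a by (simp add: field_simps)
  qed
  have "(\<lambda>n. 3 / sqrt (real n)) \<longlonglongrightarrow> 0" by real_asymp
  then have "(\<lambda>n. ?S n + (?A (3 * K) n + 3 / sqrt n) / a) \<longlonglongrightarrow> 0 + (0 + 0) / a"
    using small_circuit_tendsto[OF k c] lim a by (intro tendsto_intros) auto
  then show ?thesis using tendsto_0_le[OF _ le] prob_of_nonneg c by simp
qed

definition almost_spanning :: "nat \<Rightarrow> nat \<Rightarrow> equation set \<Rightarrow> bool" where
  "almost_spanning k n F \<longleftrightarrow> (1 - 1 / (4 * real k)) * (3 * real n ^ k) \<le> card (spanned k n F)"

text \<open>For a kernel of size at least \<open>20 * k\<close> the redundant fraction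
  \<open>a\<close> exceeds \<open>b = 1 - 1 / (4 * k)\<close>, whereas a formula that is not almost
  spanning spans less than the fraction \<open>b\<close> of all equations. So large kernels occur
  essentially only in almost spanning formulas, and \<open>dependent_step\<close> descends from
  large kernels to nontrivial ones.\<close>

lemma dependent_tendsto:
  assumes k: "k \<ge> 16" and c: "0 \<le> c" "c \<le> 1 / 3"
    and lim: "prob_of c k (\<lambda>n F. dependent 2 F \<and> almost_spanning k n F) \<longlonglongrightarrow> 0"
  shows "prob_of c k (\<lambda>n. dependent 2) \<longlonglongrightarrow> 0"
proof -
  let ?S = "prob_of c k (\<lambda>n. has_small_circuit (circuit_size k * n))"
  let ?A = "\<lambda>K. prob_of c k (\<lambda>n. dependent K)"
  let ?G = "prob_of c k (\<lambda>n F. dependent 2 F \<and> almost_spanning k n F)"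
  have kpos: "real k > 0" using k by simp
  have large: "?A K \<longlonglongrightarrow> 0" if K: "K \<ge> 20 * k" for K
  proof -
    have K2: "K \<ge> 2" using K k by simp
    define a where "a = 3 / 2 * (1 - 1 / real K) * circuit_size k"
    define b where "b = 1 - 1 / (4 * real k)"
    have "b < a"
    \<comment> \<open>The kernel size and the weight margin lose \<open>1 / (20 * k)\<close> and
      \<open>3 / (20 * k)\<close>, together at most \<open>1 / (5 * k)\<close>, less than the
      \<open>1 / (4 * k)\<close> allowed.\<close>
    proof -
      have "1 / real K \<le> 1 / (20 * real k)"
        using K k by (intro divide_left_mono) (auto simp flip: of_nat_mult)
      then have "(1 - 1 / (20 * real k)) * (1 - 3 / (20 * real k)) \<le> (1 - 1 / real K) * (1 - 3 / (20 * real k))"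
        using k by (intro mult_right_mono) auto
      also have "\<dots> = a" unfolding a_def circuit_size_bounds(2)[OF k, symmetric] by simp
      finally have "(1 - 1 / (20 * real k)) * (1 - 3 / (20 * real k)) \<le> a" .
      moreover have "(1 - 1 / (20 * real k)) * (1 - 3 / (20 * real k)) = 1 - 1 / (5 * real k) + 3 / (20 * real k)\<^sup>2"
        using kpos by (simp add: field_simps power2_eq_square)
      moreover have "1 / (5 * real k) < 1 / (4 * real k)" using kpos by (intro divide_strict_left_mono) auto
      moreover have "0 \<le> 3 / (20 * real k)\<^sup>2" by simp
      ultimately have "1 - 1 / (5 * real k) + 3 / (20 * real k)\<^sup>2 \<le> a" "1 / (5 * real k) < 1 / (4 * real k)"
        "0 \<le> 3 / (20 * real k)\<^sup>2"
        by (simp_all only:)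
      then show ?thesis unfolding b_def by linarith
    qed
    have le: "?A K n \<le> (a * ?S n + ?G n + 2 / sqrt n) / (a - b)" if n: "n > 0" for n
    proof -
      define p where "p = c / real n ^ (k - 1)"
      let ?E = "equations k n"
      have p: "0 \<le> p" "p \<le> 1" using c edge_probability[of c n "k - 1"] by (auto simp: p_def)
      have "a * n * (?A K n - ?S n) = 3 / 2 * (1 - 1 / real K) * (circuit_size k * n) * (?A K n - ?S n)"
        by (simp add: a_def)
      also have "\<dots> \<le> p * expect p ?E (\<lambda>F. real (card (spanned k n F)) * of_bool (dependent K F)) + 2 * sqrt n"
        unfolding prob_of_def p_def
        using c edge_probability[of c n "k - 1"] circuit_size_bounds(1)[OF k] k n
        by (intro order_trans[OF redundant_expect_ge dependent_redundant_le(2)] K2) auto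
      also have "expect p ?E (\<lambda>F. real (card (spanned k n F)) * of_bool (dependent K F))
          \<le> expect p ?E (\<lambda>F. (3 * real n ^ k) * (b * of_bool (dependent K F) + of_bool (dependent 2 F \<and> almost_spanning k n F)))"
      proof (intro expect_mono p)
        fix F assume "F \<subseteq> ?E"
        have "card (spanned k n F) \<le> card ?E"
          unfolding spanned_def by (intro card_mono finite_equations) auto
        then have "real (card (spanned k n F)) \<le> real (card ?E)" by (simp only: of_nat_le_iff)
        then have "real (card (spanned k n F)) \<le> 3 * real n ^ k" by (simp add: card_equations)
        moreover have "0 \<le> b" using k by (simp add: b_def)
        then have "0 \<le> (3 * real n ^ k) * b" by simp
        moreover have "dependent K F \<Longrightarrow> dependent 2 F" using K2 by (simp add: dependent_def)
        ultimately show "real (card (spanned k n F)) * of_bool (dependent K F)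
            \<le> (3 * real n ^ k) * (b * of_bool (dependent K F) + of_bool (dependent 2 F \<and> almost_spanning k n F))"
          by (cases "dependent K F") (auto simp: almost_spanning_def b_def distrib_left mult.commute)
      qed
      also have "\<dots> = (3 * real n ^ k) * (b * ?A K n + ?G n)"
        by (simp only: expect_cmult expect_add prob_of_def p_def)
      finally have "a * n * (?A K n - ?S n) \<le> (p * (3 * real n ^ k)) * (b * ?A K n + ?G n) + 2 * sqrt n"
        using p by (simp add: mult_left_mono mult.assoc)
      also have "p * (3 * real n ^ k) = 3 * c * n"
        using edge_mean[of k n c] k n by (simp add: p_def card_equations)
      also have "3 * c * n * (b * ?A K n + ?G n) + 2 * sqrt n \<le> n * (b * ?A K n + ?G n) + 2 * sqrt n"
      proof -
        have "0 \<le> b * ?A K n + ?G n"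
          using c k prob_of_nonneg by (intro add_nonneg_nonneg mult_nonneg_nonneg) (auto simp: b_def)
        moreover have "3 * c * n \<le> 1 * real n" using c by (intro mult_right_mono) auto
        ultimately show ?thesis by (intro add_right_mono mult_right_mono) auto
      qed
      also have "\<dots> = n * (b * ?A K n + ?G n + 2 / sqrt n)"
        using n by (simp add: field_simps real_div_sqrt)
      finally have "n * (a * (?A K n - ?S n)) \<le> n * (b * ?A K n + ?G n + 2 / sqrt n)" by (simp add: mult_ac)
      then have "a * (?A K n - ?S n) \<le> b * ?A K n + ?G n + 2 / sqrt n" using n by simp
      then show ?thesis using \<open>b < a\<close> by (simp add: pos_le_divide_eq algebra_simps)
    qed
    have "(\<lambda>n. 2 / sqrt (real n)) \<longlonglongrightarrow> 0" by real_asymp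
    then have "(\<lambda>n. (a * ?S n + ?G n + 2 / sqrt n) / (a - b)) \<longlonglongrightarrow> (a * 0 + 0 + 0) / (a - b)"
      using small_circuit_tendsto[OF k c] lim \<open>b < a\<close> by (intro tendsto_intros) auto
    then show ?thesis using tendsto_0_le[OF _ le] prob_of_nonneg c by simp
  qed
  have "?A (2 * 3 ^ d) \<longlonglongrightarrow> 0 \<Longrightarrow> ?A 2 \<longlonglongrightarrow> 0" for d
  proof (induction d)
    case (Suc d)
    have "2 * 3 ^ Suc d = 3 * (2 * 3 ^ d :: nat)" "2 \<le> 2 * (3::nat) ^ d" by simp_all
    then have "?A (2 * 3 ^ d) \<longlonglongrightarrow> 0"
      using dependent_step[OF k c, of "2 * 3 ^ d"] Suc.prems by (simp only:)
    then show ?case by (rule Suc.IH)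
  qed simp
  moreover have "20 * k \<le> 2 * 3 ^ (20 * k)"
  proof -
    have "20 * k < 2 ^ (20 * k)" by (rule less_exp)
    also have "(2::nat) ^ (20 * k) \<le> 3 ^ (20 * k)" by (intro power_mono) auto
    finally show ?thesis by linarith
  qed
  ultimately show ?thesis using large by blast
qed

subsection \<open>Frozen variables\<close>

lemma card_lists_PiE:
  assumes "\<And>i. i < k \<Longrightarrow> finite (A i)"
  shows "card {ys. length ys = k \<and> (\<forall>i<k. ys ! i \<in> A i)} = (\<Prod>i<k. card (A i))"
proof -
  let ?f = "\<lambda>g. map g [0..<k]"
  have "inj_on ?f (Pi\<^sub>E {..<k} A)"
  proof (rule inj_onI)
    fix g h assume g: "g \<in> Pi\<^sub>E {..<k} A" and h: "h \<in> Pi\<^sub>E {..<k} A" and eq: "?f g = ?f h"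
    show "g = h"
    proof (rule PiE_ext[OF g h])
      fix i assume "i \<in> {..<k}"
      then show "g i = h i" using arg_cong[OF eq, of "\<lambda>ys. ys ! i"] by simp
    qed
  qed
  moreover have "?f ` (Pi\<^sub>E {..<k} A) = {ys. length ys = k \<and> (\<forall>i<k. ys ! i \<in> A i)}"
  proof (intro equalityI subsetI)
    fix ys assume ys: "ys \<in> {ys. length ys = k \<and> (\<forall>i<k. ys ! i \<in> A i)}"
    then have "ys = ?f (restrict ((!) ys) {..<k})" by (auto intro!: nth_equalityI)
    moreover have "restrict ((!) ys) {..<k} \<in> Pi\<^sub>E {..<k} A" using ys by auto
    ultimately show "ys \<in> ?f ` (Pi\<^sub>E {..<k} A)" by blast
  next
    fix ys assume "ys \<in> ?f ` (Pi\<^sub>E {..<k} A)"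
    then obtain g where "g \<in> Pi\<^sub>E {..<k} A" "ys = ?f g" by blast
    then show "ys \<in> {ys. length ys = k \<and> (\<forall>i<k. ys ! i \<in> A i)}" by (simp add: PiE_iff)
  qed
  ultimately have "card {ys. length ys = k \<and> (\<forall>i<k. ys ! i \<in> A i)} = card (Pi\<^sub>E {..<k} A)"
    using card_image by metis
  then show ?thesis by (simp add: card_PiE)
qed

abbreviation tuples :: "nat \<Rightarrow> nat \<Rightarrow> nat list set" where
  "tuples k n \<equiv> {ys. length ys = k \<and> set ys \<subseteq> {1..n}}"

lemma finite_tuples: "finite (tuples k n)"
  using finite_lists_length_eq[of "{1..n}" k] by (simp add: conj_commute)

lemma finite_tuples_filter: "finite {ys \<in> tuples k n. P ys}"
  by (rule finite_subset[OF _ finite_tuples[of k n]]) auto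

lemma card_tuples: "card (tuples k n) = n ^ k"
  using card_lists_length_eq[of "{1..n}" k] by (simp add: conj_commute)

lemma card_equations_fst: "card {e \<in> equations k n. P (fst e)} = 3 * card {ys \<in> tuples k n. P ys}"
proof -
  have "{e \<in> equations k n. P (fst e)} = {ys \<in> tuples k n. P ys} \<times> {0, 1, 2}"
    by (auto simp: equations_def)
  then show ?thesis by (simp add: card_cartesian_product)
qed

lemma card_tuples_restrict:
  "card {ys \<in> tuples k n. \<forall>i<k. ys ! i \<in> A i} = (\<Prod>i<k. card (A i \<inter> {1..n}))"
proof -
  have "{ys \<in> tuples k n. \<forall>i<k. ys ! i \<in> A i} = {ys. length ys = k \<and> (\<forall>i<k. ys ! i \<in> A i \<inter> {1..n})}"
    unfolding set_conv_nth by blast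
  also have "card \<dots> = (\<Prod>i<k. card (A i \<inter> {1..n}))" by (rule card_lists_PiE) auto
  finally show ?thesis .
qed

lemma card_tuples_le:
  assumes "\<And>ys i. ys \<in> tuples k n \<Longrightarrow> P ys \<Longrightarrow> i < k \<Longrightarrow> ys ! i \<in> A i"
  shows "card {ys \<in> tuples k n. P ys} \<le> (\<Prod>i<k. card (A i \<inter> {1..n}))"
  unfolding card_tuples_restrict[symmetric] using assms finite_tuples_filter by (intro card_mono) auto

lemma prod_if_eq:
  fixes k i :: nat and a b :: nat
  assumes "i < k"
  shows "(\<Prod>l<k. if l = i then a else b) = a * b ^ (k - 1)"
proof -
  have "(\<Prod>l<k. if l = i then a else b) = (\<Prod>l\<in>{..<k} - {i}. if l = i then a else b) * a"
    using assms by (subst prod.remove[of _ i]) auto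
  also have "(\<Prod>l\<in>{..<k} - {i}. if l = i then a else b) = b ^ (k - 1)"
    using assms by (subst prod.cong[OF refl, of _ _ "\<lambda>_. b"]) auto
  finally show ?thesis by simp
qed

lemma card_tuples_one:
  assumes "i < k"
  shows "card {ys \<in> tuples k n. ys ! i \<in> A} \<le> card (A \<inter> {1..n}) * n ^ (k - 1)"
proof -
  have "card {ys \<in> tuples k n. ys ! i \<in> A} \<le> (\<Prod>l<k. card ((if l = i then A else UNIV) \<inter> {1..n}))"
    by (rule card_tuples_le) auto
  also have "\<dots> = (\<Prod>l<k. if l = i then card (A \<inter> {1..n}) else n)"
    by (intro prod.cong) auto
  finally show ?thesis using assms by (simp only: prod_if_eq)
qed

lemma prod_on_subset:
  fixes c k :: nat
  assumes "T \<subseteq> {..<k}"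
  shows "(\<Prod>l<k. if l \<in> T then c else 1) = c ^ card T"
proof -
  have "(\<Prod>l<k. if l \<in> T then c else 1) = (\<Prod>l\<in>{..<k} \<inter> T. c)"
    by (rule prod.inter_restrict[symmetric]) simp
  then show ?thesis using assms by (simp add: Int_absorb1)
qed

lemma prod_two:
  fixes a b c :: nat
  assumes "i < k" "j < k" "i \<noteq> j"
  shows "(\<Prod>l<k. if l = i then a else if l = j then b else c) = a * b * c ^ (k - 2)"
proof -
  have "(\<Prod>l<k. if l = i then a else if l = j then b else c)
      = (\<Prod>l<k. (if l = i then a else 1) * ((if l = j then b else 1) * (if l \<in> {..<k} - {i, j} then c else 1)))"
    using assms by (intro prod.cong) auto
  also have "\<dots> = (\<Prod>l<k. if l = i then a else 1) * ((\<Prod>l<k. if l = j then b else 1) * c ^ card ({..<k} - {i, j}))"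
    unfolding prod.distrib by (subst prod_on_subset) auto
  also have "\<dots> = a * (b * c ^ card ({..<k} - {i, j}))" using assms by simp
  also have "card ({..<k} - {i, j}) = k - 2"
    using assms by (subst card_Diff_subset) auto
  finally show ?thesis by (simp only: mult.assoc)
qed

lemma card_tuples_two:
  assumes "i < k" "j < k" "i \<noteq> j"
  shows "card {ys \<in> tuples k n. ys ! i \<in> A \<and> ys ! j \<in> B} \<le> card (A \<inter> {1..n}) * card (B \<inter> {1..n}) * n ^ (k - 2)"
proof -
  have "card {ys \<in> tuples k n. ys ! i \<in> A \<and> ys ! j \<in> B}
      \<le> (\<Prod>l<k. card ((if l = i then A else if l = j then B else UNIV) \<inter> {1..n}))"
    by (rule card_tuples_le) auto
  also have "\<dots> = (\<Prod>l<k. if l = i then card (A \<inter> {1..n}) else if l = j then card (B \<inter> {1..n}) else n)"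
    by (intro prod.cong) auto
  finally show ?thesis by (simp only: prod_two[OF assms])
qed

text \<open>Summing over the common value at \<open>j\<close> and \<open>l\<close>: a coincidence
  costs one factor \<open>n\<close>, just as a prescribed entry does.\<close>

lemma card_tuples_three:
  assumes "i < k" "j < k" "l < k" "i \<noteq> j" "i \<noteq> l" "j \<noteq> l"
  shows "card {ys \<in> tuples k n. ys ! i \<in> A \<and> ys ! j = ys ! l} \<le> card (A \<inter> {1..n}) * n ^ (k - 2)"
proof -
  let ?a = "card (A \<inter> {1..n})" and ?S = "\<lambda>v. {ys \<in> tuples k n. ys ! i \<in> A \<and> ys ! j = v \<and> ys ! l = v}"
  have "card {i, j, l} \<le> card {..<k}" using assms by (intro card_mono) auto
  then have k: "k - 2 = Suc (k - 3)" using assms by simp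
  have one: "card (?S v) \<le> ?a * n ^ (k - 3)" if v: "v \<in> {1..n}" for v
  proof -
    have "card (?S v) \<le> (\<Prod>m<k. card ((if m = i then A else if m \<in> {j, l} then {v} else UNIV) \<inter> {1..n}))"
      by (rule card_tuples_le) auto
    also have "\<dots> = (\<Prod>m<k. (if m = i then ?a else 1) * (if m \<in> {..<k} - {i, j, l} then n else 1))"
      using assms v by (intro prod.cong) auto
    also have "\<dots> = (\<Prod>m<k. if m = i then ?a else 1) * n ^ card ({..<k} - {i, j, l})"
      unfolding prod.distrib by (subst prod_on_subset) auto
    also have "\<dots> = ?a * n ^ card ({..<k} - {i, j, l})" using assms by simp
    also have "card ({..<k} - {i, j, l}) = k - 3"
      using assms by (subst card_Diff_subset) auto
    finally show ?thesis .
  qed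
  have "{ys \<in> tuples k n. ys ! i \<in> A \<and> ys ! j = ys ! l} \<subseteq> (\<Union>v\<in>{1..n}. ?S v)"
  proof
    fix ys assume ys: "ys \<in> {ys \<in> tuples k n. ys ! i \<in> A \<and> ys ! j = ys ! l}"
    then have "ys ! l \<in> set ys" using assms by simp
    then have "ys ! l \<in> {1..n}" "ys \<in> ?S (ys ! l)" using ys by auto
    then show "ys \<in> (\<Union>v\<in>{1..n}. ?S v)" by blast
  qed
  then have "card {ys \<in> tuples k n. ys ! i \<in> A \<and> ys ! j = ys ! l} \<le> card (\<Union>v\<in>{1..n}. ?S v)"
    using finite_tuples_filter by (intro card_mono) auto
  also have "\<dots> \<le> (\<Sum>v\<in>{1..n}. card (?S v))" by (rule card_UN_le) simp
  also have "\<dots> \<le> (\<Sum>v\<in>{1..n}. ?a * n ^ (k - 3))" by (intro sum_mono one)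
  also have "\<dots> = ?a * n ^ (k - 2)" unfolding k by simp
  finally show ?thesis .
qed

lemma card_tuples_pair:
  "card {ys \<in> tuples k n. \<exists>i<k. \<exists>j<k. i \<noteq> j \<and> ys ! i \<in> A \<and> ys ! j \<in> B}
    \<le> k ^ 2 * (card (A \<inter> {1..n}) * card (B \<inter> {1..n}) * n ^ (k - 2))"
proof -
  let ?I = "{(i, j). i < k \<and> j < k \<and> i \<noteq> j}"
  have I: "?I \<subseteq> {..<k} \<times> {..<k}" by auto
  then have finI: "finite ?I" by (rule finite_subset) simp
  let ?M = "card (A \<inter> {1..n}) * card (B \<inter> {1..n}) * n ^ (k - 2)"
  let ?S = "\<lambda>ij. {ys \<in> tuples k n. ys ! fst ij \<in> A \<and> ys ! snd ij \<in> B}"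
  have "{ys \<in> tuples k n. \<exists>i<k. \<exists>j<k. i \<noteq> j \<and> ys ! i \<in> A \<and> ys ! j \<in> B} \<subseteq> (\<Union>ij\<in>?I. ?S ij)"
    by fastforce
  then have "card {ys \<in> tuples k n. \<exists>i<k. \<exists>j<k. i \<noteq> j \<and> ys ! i \<in> A \<and> ys ! j \<in> B} \<le> card (\<Union>ij\<in>?I. ?S ij)"
    using finI finite_tuples_filter by (intro card_mono) auto
  also have "\<dots> \<le> (\<Sum>ij\<in>?I. card (?S ij))" by (rule card_UN_le[OF finI])
  also have "\<dots> \<le> (\<Sum>ij\<in>?I. ?M)"
  proof (rule sum_mono)
    fix ij assume "ij \<in> ?I"
    then have "fst ij < k" "snd ij < k" "fst ij \<noteq> snd ij" by auto
    then show "card (?S ij) \<le> ?M" by (rule card_tuples_two)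
  qed
  also have "\<dots> = card ?I * ?M" by simp
  also have "\<dots> \<le> k ^ 2 * ?M"
    using card_mono[OF _ I] by (intro mult_right_mono) (auto simp: power2_eq_square)
  finally show ?thesis .
qed

lemma card_tuples_meeting:
  "card {ys \<in> tuples k n. set ys \<inter> A \<noteq> {}} \<le> k * (card (A \<inter> {1..n}) * n ^ (k - 1))"
proof -
  have "{ys \<in> tuples k n. set ys \<inter> A \<noteq> {}} = (\<Union>i<k. {ys \<in> tuples k n. ys ! i \<in> A})"
    by (auto simp: set_conv_nth)
  also have "card \<dots> \<le> (\<Sum>i<k. card {ys \<in> tuples k n. ys ! i \<in> A})"
    by (rule card_UN_le) simp
  also have "\<dots> \<le> (\<Sum>i<k. card (A \<inter> {1..n}) * n ^ (k - 1))"
    using card_tuples_one by (intro sum_mono) auto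
  finally show ?thesis by simp
qed

text \<open>The tuples with \<open>x\<close> at position \<open>i\<close> and entries of
  \<open>B\<close> elsewhere are disjoint for different \<open>i\<close>, as \<open>x\<close> is not
  in \<open>B\<close>; this supplies the factor \<open>k\<close>.\<close>

lemma card_tuples_once:
  assumes "x \<in> {1..n}" "x \<notin> B" "B \<subseteq> {1..n}"
  shows "k * card B ^ (k - 1) \<le> card {ys \<in> tuples k n. count_list ys x = 1 \<and> set ys - {x} \<subseteq> B}"
proof -
  let ?S = "\<lambda>i. {ys. length ys = k \<and> (\<forall>l<k. ys ! l \<in> (if l = i then {x} else B))}"
  have finB: "finite B" using assms finite_subset by blast
  have card: "card (?S i) = card B ^ (k - 1)" if "i < k" for i
  proof -
    have "card (?S i) = (\<Prod>l<k. if l = i then 1 else card B)"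
      using finB by (subst card_lists_PiE) (auto simp: if_distrib cong: if_cong)
    then show ?thesis using that by (simp add: prod_if_eq)
  qed
  have sub: "?S i \<subseteq> {ys \<in> tuples k n. count_list ys x = 1 \<and> set ys - {x} \<subseteq> B}" if i: "i < k" for i
  proof
    fix ys assume ys: "ys \<in> ?S i"
    then have len: "length ys = k" and nth: "\<And>l. l < k \<Longrightarrow> ys ! l \<in> (if l = i then {x} else B)" by auto
    have "ys ! l = x \<longleftrightarrow> l = i" if "l < k" for l
      using nth[OF that] assms by (cases "l = i") auto
    then have "{l. l < length ys \<and> x = ys ! l} = {i}" using i len by auto
    then have "count_list ys x = 1"
      by (simp add: count_list_eq_length_filter length_filter_conv_card)
    moreover have "set ys \<subseteq> insert x B"
      using nth len by (fastforce simp: set_conv_nth split: if_splits)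
    ultimately show "ys \<in> {ys \<in> tuples k n. count_list ys x = 1 \<and> set ys - {x} \<subseteq> B}"
      using len assms by auto
  qed
  have disj: "?S i \<inter> ?S j = {}" if "i < k" "j < k" "i \<noteq> j" for i j
    using that assms by (force split: if_splits)
  have fin: "finite (?S i)" if "i < k" for i
    using sub[OF that] by (rule finite_subset) (rule finite_tuples_filter)
  have "k * card B ^ (k - 1) = (\<Sum>i<k. card (?S i))" using card by simp
  also have "\<dots> = card (\<Union>i<k. ?S i)"
    using disj fin by (intro card_UN_disjoint[symmetric]) auto
  also have "\<dots> \<le> card {ys \<in> tuples k n. count_list ys x = 1 \<and> set ys - {x} \<subseteq> B}"
    using sub by (intro card_mono finite_tuples_filter) blast
  finally show ?thesis .
qed

section \<open>Linked and frozen variables\<close>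

text \<open>Linked variables take equal values in every solution of the homogeneous system.\<close>

definition linked :: "equation set \<Rightarrow> nat \<Rightarrow> nat \<Rightarrow> bool" where
  "linked F x y \<longleftrightarrow> in_span F (\<lambda>j. unit x j - unit y j)"

lemma linked_sym: "linked F x y \<Longrightarrow> linked F y x"
  unfolding linked_def using in_span_scale[of F "\<lambda>j. unit x j - unit y j" "-1"] by simp

lemma linked_trans: "linked F x y \<Longrightarrow> linked F y z \<Longrightarrow> linked F x z"
  unfolding linked_def using in_span_add[of F "\<lambda>j. unit x j - unit y j" "\<lambda>j. unit y j - unit z j"] by simp

lemma linked_mono: "linked F x y \<Longrightarrow> F \<subseteq> G \<Longrightarrow> finite G \<Longrightarrow> linked G x y"
  unfolding linked_def by (rule in_span_mono)

text \<open>Adding up the differences replaces every variable of a tuple by the single variable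
  \<open>x\<close>.\<close>

lemma linked_list:
  assumes "\<And>y. y \<in> set ys \<Longrightarrow> linked F x y"
  shows "in_span F (\<lambda>j. int (length ys) * unit x j - int (count_list ys j))"
  using assms
proof (induction ys)
  case Nil
  then show ?case using in_span_zero by simp
next
  case (Cons y ys)
  have "in_span F (\<lambda>j. (int (length ys) * unit x j - int (count_list ys j)) + (unit x j - unit y j))"
    using Cons by (intro in_span_add) (auto simp: linked_def)
  then show ?case by (rule in_span_cong) (auto simp: unit_def algebra_simps)
qed

text \<open>If 3 divides \<open>k\<close>, then all homogeneous equations are satisfied by constant assignments, so no
  single variable is ever determined.  What stabilises is the set of variables that agree with
  almost all others; the second condition is void in that case.\<close>

definition frozen :: "nat \<Rightarrow> nat \<Rightarrow> equation set \<Rightarrow> nat set" where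
  "frozen k n F = {x \<in> {1..n}. (1 - 1 / (4 * real k)) * n \<le> card {y \<in> {1..n}. linked F x y}
     \<and> in_span F (\<lambda>j. int k * unit x j)}"

lemma frozen_mono:
  assumes "F \<subseteq> G" "finite G"
  shows "frozen k n F \<subseteq> frozen k n G"
proof
  fix x assume x: "x \<in> frozen k n F"
  have "card {y \<in> {1..n}. linked F x y} \<le> card {y \<in> {1..n}. linked G x y}"
    using assms linked_mono by (intro card_mono) auto
  then have "real (card {y \<in> {1..n}. linked F x y}) \<le> real (card {y \<in> {1..n}. linked G x y})" by simp
  then show "x \<in> frozen k n G"
    using x in_span_mono[OF _ assms] unfolding frozen_def by auto
qed

text \<open>Each of the two classes contains at least 3/4 of all variables, so they meet.\<close>

lemma frozen_linked:
  assumes k: "k \<ge> 1" and n: "n > 0" and x: "x \<in> frozen k n F" and y: "y \<in> frozen k n F"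
  shows "linked F x y"
proof -
  let ?C = "\<lambda>x. {z \<in> {1..n}. linked F x z}"
  have "1 / (4 * real k) \<le> 1 / 4" using k by (intro divide_left_mono) auto
  then have "3 / 4 * real n \<le> (1 - 1 / (4 * real k)) * n" by (intro mult_right_mono) auto
  then have C: "3 / 4 * real n \<le> card (?C x)" "3 / 4 * real n \<le> card (?C y)"
    using x y unfolding frozen_def by (blast intro: order_trans)+
  have "?C x \<inter> ?C y \<noteq> {}"
  proof
    assume "?C x \<inter> ?C y = {}"
    then have "card (?C x) + card (?C y) = card (?C x \<union> ?C y)" by (intro card_Un_disjoint[symmetric]) auto
    also have "\<dots> \<le> card {1..n}" by (intro card_mono) auto
    finally have "real (card (?C x)) + real (card (?C y)) \<le> n" by simp
    then show False using C n by simp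
  qed
  then obtain z where "linked F x z" "linked F y z" by auto
  then show ?thesis using linked_sym linked_trans by blast
qed

text \<open>Replacing the \<open>k - 1\<close> other variables of \<open>e\<close> by one frozen
  \<open>z\<close> turns the row into \<open>unit x + (k - 1) * unit z\<close>; subtracting
  \<open>k * unit z\<close>, which is spanned because \<open>z\<close> is frozen, links
  \<open>x\<close> to \<open>z\<close>. The others are frozen already in \<open>G\<close>, which
  later is the formula without the equations at \<open>x\<close>.\<close>

lemma frozen_extend:
  assumes k: "k \<ge> 2" and n: "n > 0" and e: "e \<in> F" "finite F" and GF: "G \<subseteq> F"
    and len: "length (fst e) = k" and x: "x \<in> {1..n}" "count_list (fst e) x = 1"
    and others: "set (fst e) - {x} \<subseteq> frozen k n G"
  shows "x \<in> frozen k n F"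
proof -
  define ys where "ys = remove1 x (fst e)"
  have xin: "x \<in> set (fst e)" using x by (metis count_notin zero_neq_one)
  have perm: "mset (fst e) = mset (x # ys)" using xin by (simp add: ys_def)
  have cnt: "count_list (fst e) j = count_list (x # ys) j" for j
    using perm by (metis count_mset)
  then have "count_list ys x = 0" using x(2) by (metis add_cancel_right_left count_list.simps(2) plus_1_eq_Suc add.commute)
  then have xnot: "x \<notin> set ys" by (simp add: count_list_0_iff)
  have "set (fst e) = insert x (set ys)" using arg_cong[OF perm, of set_mset] by simp
  then have ys: "set ys \<subseteq> frozen k n G" using others xnot by auto
  have lys: "length ys = k - 1" using len xin by (simp add: ys_def length_remove1)
  then have "ys \<noteq> []" using k by auto
  then obtain z where z: "z \<in> set ys" using hd_in_set by blast
  then have zG: "z \<in> frozen k n G" using ys by auto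
  have zF: "z \<in> frozen k n F" using zG frozen_mono[OF GF e(2)] by auto
  have "in_span F (\<lambda>j. int (length ys) * unit z j - int (count_list ys j))"
    using frozen_linked[of k n z G] k n zG ys linked_mono[OF _ GF e(2)] by (intro linked_list) auto
  then have "in_span F (\<lambda>j. row e j + (int (length ys) * unit z j - int (count_list ys j)))"
    using e by (intro in_span_add in_span_row)
  moreover have kz: "in_span F (\<lambda>j. int k * unit z j)" using zF by (simp add: frozen_def)
  ultimately have "in_span F (\<lambda>j. (row e j + (int (length ys) * unit z j - int (count_list ys j))) - int k * unit z j)"
    by (rule in_span_diff)
  moreover have "(row e j + (int (length ys) * unit z j - int (count_list ys j))) - int k * unit z j = unit x j - unit z j" for j
    using k by (simp add: row_def cnt lys unit_def of_nat_diff algebra_simps)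
  ultimately have xz: "linked F x z" by (simp add: linked_def)
  have "{y \<in> {1..n}. linked F z y} \<subseteq> {y \<in> {1..n}. linked F x y}"
    using linked_trans[OF xz] by auto
  then have "card {y \<in> {1..n}. linked F z y} \<le> card {y \<in> {1..n}. linked F x y}"
    by (intro card_mono) auto
  then have "real (card {y \<in> {1..n}. linked F z y}) \<le> real (card {y \<in> {1..n}. linked F x y})" by simp
  moreover have "in_span F (\<lambda>j. int k * unit x j)"
  proof -
    have "in_span F (\<lambda>j. int k * (unit x j - unit z j) + 1 * (int k * unit z j))"
      using xz kz by (intro in_span_linear) (auto simp: linked_def)
    then show ?thesis by (rule in_span_cong) (simp add: algebra_simps)
  qed
  ultimately show ?thesis using x zF unfolding frozen_def by auto
qed

text \<open>By averaging, some tail \<open>zs\<close> is completed to a spanned tuple by at least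
  \<open>(1 - s) * n\<close> first entries. The differences of these tuples link all those entries,
  which form \<open>X\<close>. The tuples over \<open>X\<close> are at least 3/4 of all, the spanned
  ones more than 1/4, so some spanned tuple lies over \<open>X\<close>; collapsing it to one
  variable spans \<open>k * unit x\<close>.\<close>

lemma almost_spanning_frozen:
  assumes k: "k \<ge> 16" and n: "n > 0" and F: "almost_spanning k n F"
  shows "(1 - 1 / (4 * real k)) * n \<le> card (frozen k n F)"
proof -
  define s where "s = 1 / (4 * real k)"
  have s: "0 < s" "s \<le> 1 / 64" "real k * s = 1 / 4" using k by (auto simp: s_def field_simps)
  let ?sp = "\<lambda>ys. in_span F (\<lambda>j. int (count_list ys j))"
  have sp: "spanned k n F = {e \<in> equations k n. ?sp (fst e)}"
    unfolding spanned_def row_def ..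
  have "(1 - s) * (3 * real n ^ k) \<le> 3 * real (card {ys \<in> tuples k n. ?sp ys})"
    using F card_equations_fst[where P = ?sp] unfolding almost_spanning_def s_def sp by simp
  then have T: "(1 - s) * real n ^ k \<le> card {ys \<in> tuples k n. ?sp ys}" by simp
  have nk: "real n ^ k = real n * real n ^ (k - 1)" using k by (metis not_numeral_le_zero power_eq_if)
  have "\<exists>zs\<in>tuples (k - 1) n. (1 - s) * n \<le> card {x \<in> {1..n}. ?sp (x # zs)}"
  proof (rule ccontr)
    assume "\<not> ?thesis"
    then have less: "real (card {x \<in> {1..n}. ?sp (x # zs)}) < (1 - s) * n" if "zs \<in> tuples (k - 1) n" for zs
      using that by force
    have "{ys \<in> tuples k n. ?sp ys} \<subseteq> (\<lambda>(zs, x). x # zs) ` (SIGMA zs : tuples (k - 1) n. {x \<in> {1..n}. ?sp (x # zs)})"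
    proof
      fix ys assume ys: "ys \<in> {ys \<in> tuples k n. ?sp ys}"
      then obtain x zs where "ys = x # zs" using k by (cases ys) auto
      then show "ys \<in> (\<lambda>(zs, x). x # zs) ` (SIGMA zs : tuples (k - 1) n. {x \<in> {1..n}. ?sp (x # zs)})"
        using ys by (auto intro!: image_eqI[of _ _ "(zs, x)"])
    qed
    then have "card {ys \<in> tuples k n. ?sp ys} \<le> card (SIGMA zs : tuples (k - 1) n. {x \<in> {1..n}. ?sp (x # zs)})"
      using finite_tuples[of "k - 1" n] by (intro surj_card_le) (auto intro!: finite_SigmaI)
    also have "\<dots> = (\<Sum>zs\<in>tuples (k - 1) n. card {x \<in> {1..n}. ?sp (x # zs)})"
      using finite_tuples by (subst card_SigmaI) auto
    finally have "real (card {ys \<in> tuples k n. ?sp ys}) \<le> (\<Sum>zs\<in>tuples (k - 1) n. real (card {x \<in> {1..n}. ?sp (x # zs)}))"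
      by (simp only: of_nat_sum[symmetric] of_nat_le_iff)
    also have "\<dots> < (\<Sum>zs\<in>tuples (k - 1) n. (1 - s) * n)"
    proof (rule sum_strict_mono[OF finite_tuples _ less])
      have "card (tuples (k - 1) n) > 0" using n by (simp only: card_tuples zero_less_power)
      then show "tuples (k - 1) n \<noteq> {}" by (metis card.empty less_irrefl)
    qed
    also have "\<dots> = (1 - s) * real n ^ k" unfolding sum_constant card_tuples by (simp add: nk)
    finally show False using T by simp
  qed
  then obtain zs where zs: "zs \<in> tuples (k - 1) n" "(1 - s) * n \<le> card {x \<in> {1..n}. ?sp (x # zs)}" by blast
  define X where "X = {x \<in> {1..n}. ?sp (x # zs)}"
  have finX: "finite X" and XV: "X \<subseteq> {1..n}" by (auto simp: X_def)
  have link: "linked F x y" if "x \<in> X" "y \<in> X" for x y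
  proof -
    have "in_span F (\<lambda>j. int (count_list (x # zs) j) - int (count_list (y # zs) j))"
      using that by (intro in_span_diff) (auto simp: X_def)
    then show ?thesis unfolding linked_def by (rule in_span_cong) (auto simp: unit_def)
  qed
  have Xcard: "(1 - s) * n \<le> card X" using zs by (simp add: X_def)
  have "\<exists>ys\<in>{ys. length ys = k \<and> set ys \<subseteq> X}. ?sp ys"
  proof (rule ccontr)
    assume no: "\<not> ?thesis"
    have "{ys. length ys = k \<and> set ys \<subseteq> X} \<union> {ys \<in> tuples k n. ?sp ys} \<subseteq> tuples k n" using XV by auto
    then have "card ({ys. length ys = k \<and> set ys \<subseteq> X} \<union> {ys \<in> tuples k n. ?sp ys}) \<le> n ^ k"
      using card_mono[OF finite_tuples[of k n]] by (simp only: card_tuples)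
    moreover have "card ({ys. length ys = k \<and> set ys \<subseteq> X} \<union> {ys \<in> tuples k n. ?sp ys})
        = card {ys. length ys = k \<and> set ys \<subseteq> X} + card {ys \<in> tuples k n. ?sp ys}"
    proof (rule card_Un_disjoint)
      show "finite {ys. length ys = k \<and> set ys \<subseteq> X}"
        using finite_lists_length_eq[OF finX, of k] by (simp add: conj_commute)
      show "finite {ys \<in> tuples k n. ?sp ys}" by (rule finite_tuples_filter)
      show "{ys. length ys = k \<and> set ys \<subseteq> X} \<inter> {ys \<in> tuples k n. ?sp ys} = {}" using no by blast
    qed
    moreover have "card {ys. length ys = k \<and> set ys \<subseteq> X} = card X ^ k"
      using card_lists_length_eq[OF finX, of k] by (simp add: conj_commute)
    ultimately have "card X ^ k + card {ys \<in> tuples k n. ?sp ys} \<le> n ^ k" by simp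
    then have "real (card X) ^ k + real (card {ys \<in> tuples k n. ?sp ys}) \<le> real n ^ k"
      by (simp only: of_nat_add[symmetric] of_nat_le_iff of_nat_power[symmetric])
    moreover have "3 / 4 * real n ^ k \<le> real (card X) ^ k"
    proof -
      have "1 + real k * (- s) \<le> (1 + (- s)) ^ k" using s by (intro Bernoulli_inequality) auto
      then have "3 / 4 * real n ^ k \<le> (1 - s) ^ k * real n ^ k" using s by (intro mult_right_mono) auto
      also have "\<dots> = ((1 - s) * n) ^ k" by (simp add: power_mult_distrib)
      also have "\<dots> \<le> real (card X) ^ k" using Xcard s by (intro power_mono) auto
      finally show ?thesis .
    qed
    moreover have "real n ^ k > 0" using n by simp
    moreover have "63 / 64 * real n ^ k \<le> (1 - s) * real n ^ k" using s by (intro mult_right_mono) auto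
    ultimately show False using T by linarith
  qed
  then obtain ys where ys: "length ys = k" "set ys \<subseteq> X" "?sp ys" by blast
  have "X \<subseteq> frozen k n F"
  proof
    fix x assume x: "x \<in> X"
    have "in_span F (\<lambda>j. (int (length ys) * unit x j - int (count_list ys j)) + int (count_list ys j))"
      using ys x link by (intro in_span_add linked_list) auto
    then have "in_span F (\<lambda>j. int k * unit x j)" using ys by simp
    moreover have "X \<subseteq> {y \<in> {1..n}. linked F x y}" using XV link x by auto
    then have "card X \<le> card {y \<in> {1..n}. linked F x y}" by (intro card_mono) auto
    then have "real (card X) \<le> real (card {y \<in> {1..n}. linked F x y})" by simp
    ultimately show "x \<in> frozen k n F"
      using x XV Xcard unfolding frozen_def s_def by auto
  qed
  then have "card X \<le> card (frozen k n F)" by (intro card_mono) (auto simp: frozen_def)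
  then have "real (card X) \<le> real (card (frozen k n F))" by simp
  then show ?thesis using Xcard unfolding s_def by linarith
qed

subsection \<open>Deleting the equations of a variable\<close>

definition touching :: "nat \<Rightarrow> nat \<Rightarrow> nat \<Rightarrow> equation set" where
  "touching k n x = {e \<in> equations k n. x \<in> set (fst e)}"

definition del :: "nat \<Rightarrow> equation set \<Rightarrow> equation set" where
  "del x F = {e \<in> F. x \<notin> set (fst e)}"

lemma finite_touching: "finite (touching k n x)"
  unfolding touching_def using finite_equations by auto

lemma card_touching:
  assumes "x \<in> {1..n}"
  shows "card (touching k n x) = 3 * (n ^ k - (n - 1) ^ k)"
proof -
  let ?W = "{ys. set ys \<subseteq> {1..n} - {x} \<and> length ys = k}"
  have "{ys \<in> tuples k n. x \<in> set ys} = tuples k n - ?W" by auto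
  also have "card \<dots> = card (tuples k n) - card ?W"
    by (rule card_Diff_subset) (auto intro!: finite_lists_length_eq)
  also have "card ?W = (n - 1) ^ k"
    using assms by (subst card_lists_length_eq) auto
  also have "card (tuples k n) = n ^ k" by (rule card_tuples)
  finally have "card {ys \<in> tuples k n. x \<in> set ys} = n ^ k - (n - 1) ^ k" .
  then show ?thesis unfolding touching_def by (subst card_equations_fst) simp
qed

lemma card_touching_le:
  assumes "x \<in> {1..n}"
  shows "card (touching k n x) \<le> 3 * (k * n ^ (k - 1))"
proof -
  have "{ys \<in> tuples k n. x \<in> set ys} = {ys \<in> tuples k n. set ys \<inter> {x} \<noteq> {}}" by auto
  then have "card {ys \<in> tuples k n. x \<in> set ys} \<le> k * (card ({x} \<inter> {1..n}) * n ^ (k - 1))"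
    using card_tuples_meeting[of k n "{x}"] by simp
  then show ?thesis unfolding touching_def using assms by (subst card_equations_fst) simp
qed

lemma card_touching_two:
  assumes "x \<in> {1..n}" "y \<in> {1..n}" "x \<noteq> y"
  shows "card (touching k n x \<inter> touching k n y) \<le> 3 * (k\<^sup>2 * n ^ (k - 2))"
proof -
  have "touching k n x \<inter> touching k n y = {e \<in> equations k n. x \<in> set (fst e) \<and> y \<in> set (fst e)}"
    by (auto simp: touching_def)
  then have "card (touching k n x \<inter> touching k n y) = 3 * card {ys \<in> tuples k n. x \<in> set ys \<and> y \<in> set ys}"
    using card_equations_fst[where P = "\<lambda>ys. x \<in> set ys \<and> y \<in> set ys"] by simp
  also have "card {ys \<in> tuples k n. x \<in> set ys \<and> y \<in> set ys} \<le> k ^ 2 * (card ({x} \<inter> {1..n}) * card ({y} \<inter> {1..n}) * n ^ (k - 2))"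
  proof (rule order_trans[OF _ card_tuples_pair])
    show "card {ys \<in> tuples k n. x \<in> set ys \<and> y \<in> set ys}
      \<le> card {ys \<in> tuples k n. \<exists>i<k. \<exists>j<k. i \<noteq> j \<and> ys ! i \<in> {x} \<and> ys ! j \<in> {y}}"
  proof (intro card_mono finite_tuples_filter subsetI)
    fix ys assume ys: "ys \<in> {ys \<in> tuples k n. x \<in> set ys \<and> y \<in> set ys}"
    then obtain i j where "i < k" "j < k" "ys ! i = x" "ys ! j = y" by (auto simp: in_set_conv_nth)
    moreover then have "i \<noteq> j" using assms by auto
    ultimately show "ys \<in> {ys \<in> tuples k n. \<exists>i<k. \<exists>j<k. i \<noteq> j \<and> ys ! i \<in> {x} \<and> ys ! j \<in> {y}}"
      using ys by blast
  qed
  qed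
  finally show ?thesis using assms by simp
qed

lemma expect_le_half_square:
  fixes p :: real and X :: "'a set \<Rightarrow> real"
  assumes "finite E" "0 \<le> p" "p \<le> 1" "q > 0"
  shows "expect p E (\<lambda>F. \<bar>X F\<bar>) \<le> (q + expect p E (\<lambda>F. (X F)\<^sup>2) / q) / 2"
proof -
  have "expect p E (\<lambda>F. \<bar>X F\<bar>) \<le> expect p E (\<lambda>F. q / 2 + 1 / (2 * q) * (X F)\<^sup>2)"
  proof (rule expect_mono[OF assms(2,3)])
    fix F
    have "0 \<le> (\<bar>X F\<bar> - q)\<^sup>2" by simp
    then have "2 * q * \<bar>X F\<bar> \<le> q * q + (X F)\<^sup>2"
      unfolding power2_diff power2_abs by (simp add: power2_eq_square algebra_simps)
    then show "\<bar>X F\<bar> \<le> q / 2 + 1 / (2 * q) * (X F)\<^sup>2" using assms by (simp add: field_simps power2_eq_square)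
  qed
  also have "\<dots> = q / 2 + 1 / (2 * q) * expect p E (\<lambda>F. (X F)\<^sup>2)"
    unfolding expect_add expect_cmult using assms by simp
  finally show ?thesis by (simp add: field_simps)
qed

lemma power_one_minus_ge_exp:
  fixes p :: real
  assumes "0 \<le> p" "p \<le> 1 / 2"
  shows "exp (- 2 * p * real d) \<le> (1 - p) ^ d"
proof -
  have "p * p \<le> p * (1 / 2)" using assms by (intro mult_left_mono) auto
  then have "- 2 * p \<le> - p - 2 * p\<^sup>2" by (simp add: power2_eq_square)
  also have "\<dots> \<le> ln (1 - p)" using ln_one_minus_pos_lower_bound assms by blast
  finally have "exp (- 2 * p) \<le> exp (ln (1 - p))" by simp
  also have "\<dots> = 1 - p" using assms by simp
  finally have "exp (- 2 * p) ^ d \<le> (1 - p) ^ d" by (intro power_mono) auto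
  moreover have "exp (- 2 * p) ^ d = exp (- 2 * p * real d)"
    by (simp add: exp_of_nat_mult[symmetric] mult_ac)
  ultimately show ?thesis by simp
qed

text \<open>The factor \<open>exp (2 * k)\<close> bounds the inverse of the probability that a
  variable is isolated; the rest comes from the bound \<open>n * (1 + k\<^sup>2)\<close> on the
  variance of the number of isolated variables.\<close>

definition deletion_error :: "nat \<Rightarrow> nat \<Rightarrow> real" where
  "deletion_error k n = exp (2 * real k) * (1 + (real k)\<^sup>2) * sqrt n"

text \<open>Deleting the equations through a fixed \<open>x\<close> amounts to conditioning on \<open>x\<close> being isolated.
  Averaged over \<open>x\<close>, this only reweights the formula by its number of isolated variables, which is
  concentrated.\<close>

lemma average_deletion:
  fixes k n :: nat and c :: real
  assumes k: "k \<ge> 2" and n: "n > 0" and c: "0 \<le> c" "c \<le> 1 / 3"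
  defines "E \<equiv> equations k n" and "p \<equiv> c / real n ^ (k - 1)"
  assumes h: "\<And>F. F \<subseteq> E \<Longrightarrow> 0 \<le> h F" "\<And>F. F \<subseteq> E \<Longrightarrow> h F \<le> 1"
  shows "\<bar>(\<Sum>x\<in>{1..n}. expect p E (\<lambda>F. h (F - touching k n x))) - n * expect p E h\<bar> \<le> deletion_error k n"
proof -
  let ?V = "{1..n}" and ?D = "touching k n"
  define d where "d = 3 * (n ^ k - (n - 1) ^ k)"
  define q where "q = (1 - p) ^ d"
  define I :: "equation set \<Rightarrow> real" where "I F = (\<Sum>x\<in>?V. of_bool (F \<inter> ?D x = {}))" for F
  have fin: "finite E" by (simp add: E_def finite_equations)
  have p: "0 \<le> p" "p \<le> 1" "p \<le> 1 / 2"
    using edge_probability[of c n "k - 1"] edge_probability_third[of c n "k - 1"] c by (auto simp: p_def)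
  have D: "?D x \<subseteq> E" "card (?D x) = d" if "x \<in> ?V" for x
    using card_touching[OF that] by (auto simp: touching_def E_def d_def)
  have pn: "p * real n ^ (k - 1) = c" using n by (simp add: p_def)
  have q0: "exp (- 2 * real k) \<le> q"
  proof -
    have "d \<le> 3 * (k * n ^ (k - 1))" using card_touching_le[of 1 n k] card_touching[of 1 n k] n by (simp add: d_def)
    then have "real d \<le> real (3 * (k * n ^ (k - 1)))" by (simp only: of_nat_le_iff)
    then have "p * real d \<le> p * real (3 * (k * n ^ (k - 1)))" using p by (intro mult_left_mono) auto
    also have "\<dots> = 3 * k * (p * real n ^ (k - 1))" by simp
    also have "\<dots> \<le> k" unfolding pn using c mult_right_mono[of "3 * c" 1 "real k"] by (simp add: mult_ac)
    finally have "exp (- 2 * real k) \<le> exp (- 2 * p * real d)" by simp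
    also have "\<dots> \<le> q" unfolding q_def by (rule power_one_minus_ge_exp[OF p(1,3)])
    finally show ?thesis .
  qed
  then have qpos: "0 < q" by (rule less_le_trans[rotated]) simp
  have iso: "expect p E (\<lambda>F. of_bool (F \<inter> ?D x = {}) * g F) = q * expect p E (\<lambda>F. g (F - ?D x))" if "x \<in> ?V" for x g
    using expect_disjoint[OF fin D(1)[OF that], of p g] D(2)[OF that] by (simp add: q_def)
  have Ih: "expect p E (\<lambda>F. I F * h F) = q * (\<Sum>x\<in>?V. expect p E (\<lambda>F. h (F - ?D x)))"
    unfolding I_def sum_distrib_right expect_sum sum_distrib_left by (intro sum.cong refl iso)
  have I1: "expect p E I = n * q"
  proof -
    have "expect p E I = (\<Sum>x\<in>?V. expect p E (\<lambda>F. of_bool (F \<inter> ?D x = {}) * 1))"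
      unfolding I_def expect_sum by simp
    also have "\<dots> = (\<Sum>x\<in>?V. q * expect p E (\<lambda>F. 1))" by (intro sum.cong refl iso)
    finally show ?thesis using fin by simp
  qed
  \<comment> \<open>Isolation of \<open>x\<close> and of \<open>y\<close> is correlated only through
    the equations containing both, at most \<open>3 * k\<^sup>2 * n ^ (k - 2)\<close> of them, so
    the covariance is of order \<open>1 / n\<close>.\<close>
  have pair: "expect p E (\<lambda>F. of_bool (F \<inter> ?D x = {}) * of_bool (F \<inter> ?D y = {})) \<le> q\<^sup>2 + (real k)\<^sup>2 / n + of_bool (x = y)"
    if x: "x \<in> ?V" and y: "y \<in> ?V" for x y
  proof (cases "x = y")
    case True
    have "expect p E (\<lambda>F. of_bool (F \<inter> ?D x = {}) * of_bool (F \<inter> ?D y = {})) \<le> expect p E (\<lambda>F. 1)"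
      using p by (intro expect_mono) auto
    then show ?thesis using True fin by (simp add: add_increasing)
  next
    case False
    let ?U = "?D x \<union> ?D y" and ?i = "card (?D x \<inter> ?D y)"
    have "expect p E (\<lambda>F. of_bool (F \<inter> ?D x = {}) * of_bool (F \<inter> ?D y = {}))
        = expect p E (\<lambda>F. of_bool (F \<inter> ?U = {}) * 1)"
      by (intro expect_cong) (auto simp: Int_Un_distrib)
    also have "\<dots> = (1 - p) ^ card ?U"
      using expect_disjoint[OF fin, of ?U p "\<lambda>_. 1"] D x y fin by simp
    also have "\<dots> \<le> q\<^sup>2 + (real k)\<^sup>2 / n"
    proof -
      have "card ?U + ?i = 2 * d"
        using card_Un_Int[of "?D x" "?D y"] D x y finite_touching by simp
      then have "q\<^sup>2 = (1 - p) ^ (card ?U + ?i)" unfolding q_def by (simp only: power_mult[symmetric] mult.commute)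
      then have "q\<^sup>2 = (1 - p) ^ card ?U * (1 - p) ^ ?i" by (simp only: power_add)
      then have "(1 - p) ^ card ?U = q\<^sup>2 + (1 - p) ^ card ?U * (1 - (1 - p) ^ ?i)"
        by (simp add: algebra_simps)
      also have "\<dots> \<le> q\<^sup>2 + 1 * (real ?i * p)"
      proof (intro add_left_mono mult_mono)
        have "1 + real ?i * (- p) \<le> (1 + (- p)) ^ ?i" using p by (intro Bernoulli_inequality) auto
        then show "1 - (1 - p) ^ ?i \<le> real ?i * p" by simp
        show "(1 - p) ^ card ?U \<le> 1" using p by (intro power_le_one) auto
        show "0 \<le> 1 - (1 - p) ^ ?i" using p by (simp add: power_le_one)
      qed simp
      also have "real ?i * p \<le> real (3 * (k\<^sup>2 * n ^ (k - 2))) * p"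
        using card_touching_two[OF x y False, of k] p by (intro mult_right_mono) (simp_all only: of_nat_le_iff)
      also have "\<dots> = 3 * c * (real k)\<^sup>2 / n"
      proof -
        have "k - 1 = Suc (k - 2)" using k by simp
        then have "real n ^ (k - 1) = n * real n ^ (k - 2)" by simp
        then show ?thesis using n by (simp add: p_def)
      qed
      also have "\<dots> \<le> (real k)\<^sup>2 / n"
        using c mult_right_mono[of "3 * c" 1 "(real k)\<^sup>2"] by (intro divide_right_mono) auto
      finally show ?thesis by simp
    qed
    finally show ?thesis using False by simp
  qed
  have I2: "expect p E (\<lambda>F. (I F)\<^sup>2) \<le> (n * q)\<^sup>2 + n * (1 + (real k)\<^sup>2)"
  proof -
    have "expect p E (\<lambda>F. (I F)\<^sup>2)
        = (\<Sum>x\<in>?V. \<Sum>y\<in>?V. expect p E (\<lambda>F. of_bool (F \<inter> ?D x = {}) * of_bool (F \<inter> ?D y = {})))"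
      unfolding I_def power2_eq_square sum_product expect_sum ..
    also have "\<dots> \<le> (\<Sum>x\<in>?V. \<Sum>y\<in>?V. q\<^sup>2 + (real k)\<^sup>2 / n + of_bool (x = y))"
      by (intro sum_mono pair)
    also have "\<dots> = n * (n * (q\<^sup>2 + (real k)\<^sup>2 / n)) + n"
      by (simp add: sum.distrib of_bool_def distrib_left)
    also have "\<dots> = (n * q)\<^sup>2 + n * (1 + (real k)\<^sup>2)"
      using n by (simp add: power2_eq_square field_simps)
    finally show ?thesis .
  qed
  have var: "expect p E (\<lambda>F. (I F - n * q)\<^sup>2) \<le> n * (1 + (real k)\<^sup>2)"
  proof -
    have "expect p E (\<lambda>F. (I F - n * q)\<^sup>2) = expect p E (\<lambda>F. (I F)\<^sup>2 + (- (2 * (n * q))) * I F + (n * q)\<^sup>2)"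
      by (intro expect_cong) (simp add: power2_eq_square algebra_simps)
    also have "\<dots> = expect p E (\<lambda>F. (I F)\<^sup>2) - (n * q)\<^sup>2"
      unfolding expect_add expect_cmult I1 using fin by (simp add: power2_eq_square algebra_simps)
    finally show ?thesis using I2 by simp
  qed
  have "\<bar>expect p E (\<lambda>F. (I F - n * q) * h F)\<bar> \<le> expect p E (\<lambda>F. \<bar>I F - n * q\<bar>)"
  proof -
    have neg: "(-1) * b \<le> a" if "- a \<le> b" for a b :: real using that by linarith
    have B: "\<bar>(I F - n * q) * h F\<bar> \<le> \<bar>I F - n * q\<bar>" if "F \<subseteq> E" for F
      using h[OF that] mult_left_mono[of "h F" 1 "\<bar>I F - n * q\<bar>"] by (simp add: abs_mult)
    have "expect p E (\<lambda>F. (I F - n * q) * h F) \<le> expect p E (\<lambda>F. \<bar>I F - n * q\<bar>)"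
      by (intro expect_mono p abs_le_D1[OF B])
    moreover have "expect p E (\<lambda>F. (-1) * \<bar>I F - n * q\<bar>) \<le> expect p E (\<lambda>F. (I F - n * q) * h F)"
    proof (intro expect_mono p)
      fix F assume "F \<subseteq> E"
      then have "- ((I F - n * q) * h F) \<le> \<bar>I F - n * q\<bar>" by (rule abs_le_D2[OF B])
      then show "(-1) * \<bar>I F - n * q\<bar> \<le> (I F - n * q) * h F" by (rule neg)
    qed
    ultimately show ?thesis unfolding expect_cmult by linarith
  qed
  also have "\<dots> \<le> (sqrt n + expect p E (\<lambda>F. (I F - n * q)\<^sup>2) / sqrt n) / 2"
    using fin p n by (intro expect_le_half_square) auto
  also have "\<dots> \<le> (sqrt n + n * (1 + (real k)\<^sup>2) / sqrt n) / 2"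
    using var by (intro divide_right_mono add_left_mono) auto
  also have "\<dots> = sqrt n * (2 + (real k)\<^sup>2) / 2"
  proof -
    have "n * (1 + (real k)\<^sup>2) / sqrt n = (n / sqrt n) * (1 + (real k)\<^sup>2)" by simp
    also have "n / sqrt n = sqrt n" by (simp add: real_div_sqrt)
    finally have "sqrt n + n * (1 + (real k)\<^sup>2) / sqrt n = sqrt n * (2 + (real k)\<^sup>2)" by (simp add: distrib_left)
    then show ?thesis by (simp only:)
  qed
  also have "\<dots> \<le> sqrt n * (1 + (real k)\<^sup>2)"
  proof -
    have "sqrt n * (2 + (real k)\<^sup>2) / 2 = sqrt n * ((2 + (real k)\<^sup>2) / 2)" by simp
    also have "\<dots> \<le> sqrt n * (1 + (real k)\<^sup>2)" by (intro mult_left_mono) auto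
    finally show ?thesis .
  qed
  finally have J: "\<bar>expect p E (\<lambda>F. (I F - n * q) * h F)\<bar> \<le> sqrt n * (1 + (real k)\<^sup>2)" .
  \<comment> \<open>Weighting by the deviation of \<open>I F\<close> from its mean produces exactly
    \<open>q\<close> times the quantity to be bounded.\<close>
  define X where "X = (\<Sum>x\<in>?V. expect p E (\<lambda>F. h (F - ?D x))) - n * expect p E h"
  have "expect p E (\<lambda>F. (I F - n * q) * h F) = q * X"
    unfolding left_diff_distrib expect_diff Ih X_def expect_cmult by (simp add: algebra_simps)
  then have "q * \<bar>X\<bar> \<le> sqrt n * (1 + (real k)\<^sup>2)" using J qpos by (simp add: abs_mult)
  moreover have "exp (- 2 * real k) * \<bar>X\<bar> \<le> q * \<bar>X\<bar>" using q0 by (intro mult_right_mono) auto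
  ultimately have "exp (- 2 * real k) * \<bar>X\<bar> \<le> sqrt n * (1 + (real k)\<^sup>2)" by linarith
  then have "exp (2 * real k) * (exp (- 2 * real k) * \<bar>X\<bar>) \<le> exp (2 * real k) * (sqrt n * (1 + (real k)\<^sup>2))"
    by (rule mult_left_mono) simp
  moreover have "exp (2 * real k) * (exp (- 2 * real k) * \<bar>X\<bar>) = \<bar>X\<bar>"
    by (simp flip: mult.assoc exp_add)
  ultimately have "\<bar>X\<bar> \<le> exp (2 * real k) * (sqrt n * (1 + (real k)\<^sup>2))" by (simp only:)
  then show ?thesis unfolding X_def deletion_error_def by (simp only: mult_ac)
qed

text \<open>Survival for \<open>t\<close> rounds of leaf removal in the tree hanging off \<open>x\<close>; passing to \<open>del x F\<close> forbids
  the exploration to return to \<open>x\<close> and makes the subtrees independent of the equations at \<open>x\<close>.\<close>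

primrec live :: "nat \<Rightarrow> nat \<Rightarrow> equation set \<Rightarrow> nat set" where
  "live n 0 F = {1..n}"
| "live n (Suc t) F = {x \<in> {1..n}. \<exists>e\<in>F. x \<in> set (fst e) \<and> set (fst e) - {x} \<subseteq> live n t (del x F)}"

lemma live_subset: "live n t F \<subseteq> {1..n}"
  by (cases t) auto

text \<open>The column of an isolated variable is zero, so it is linked to no variable but itself,
  too few for a frozen variable.\<close>

lemma isolated_not_frozen:
  assumes k: "k \<ge> 1" and n: "n \<ge> 2" and x: "\<And>e. e \<in> F \<Longrightarrow> x \<notin> set (fst e)"
  shows "x \<notin> frozen k n F"
proof
  assume fr: "x \<in> frozen k n F"
  have "y = x" if lk: "linked F x y" for y
  proof -
    obtain l where "\<forall>j. [unit x j - unit y j = comb F l j] (mod 3)"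
      using lk unfolding linked_def in_span_def by blast
    then have "[unit x x - unit y x = comb F l x] (mod 3)" by blast
    moreover have "comb F l x = 0"
    proof -
      have "row e x = 0" if "e \<in> F" for e using x[OF that] row_nonzero_iff by blast
      then show ?thesis by (simp add: comb_def)
    qed
    ultimately show ?thesis by (auto simp: unit_def cong_def split: if_splits)
  qed
  then have "card {y \<in> {1..n}. linked F x y} \<le> card {x}" by (intro card_mono) auto
  then have "(1 - 1 / (4 * real k)) * n \<le> 1" using fr by (simp add: frozen_def)
  moreover have "1 / (4 * real k) \<le> 1 / 4" using k by (intro divide_left_mono) auto
  then have "3 / 4 * 2 \<le> (1 - 1 / (4 * real k)) * n" using n by (intro mult_mono) auto
  ultimately show False by simp
qed

text \<open>The expected number of equations joining \<open>x\<close> to a given variable is at most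
  \<open>3 * c * k\<^sup>2 / n\<close>; the exponential bounds the probability that no equation at
  \<open>x\<close> has all its other variables frozen.\<close>

definition contraction :: "real \<Rightarrow> nat \<Rightarrow> real" where
  "contraction c k = 3 * c * (real k)\<^sup>2 * exp (- (9 / 4) * c * k)"

text \<open>\<open>G\<close> is the formula away from \<open>x\<close>, and the independent part at
  \<open>x\<close> is random. An equation of \<open>D1\<close> would freeze \<open>x\<close>, so
  none may occur; survival of \<open>x\<close> then needs an equation that leads to a live
  non-frozen variable (\<open>D2\<close>) or contains \<open>x\<close> twice (\<open>D3\<close>).
  Since \<open>D2\<close> avoids \<open>D1\<close>, the absence of \<open>D1\<close> and the
  presence of an element of \<open>D2\<close> are independent, and their probabilities
  multiply.\<close>

lemma live_not_frozen_step:
  fixes k n x :: nat and c :: real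
  assumes k: "k \<ge> 2" and n: "n \<ge> 2" and c: "0 \<le> c" "c \<le> 1 / 3" and x: "x \<in> {1..n}"
    and G: "G \<subseteq> equations k n - touching k n x"
    and big: "(1 - 1 / (4 * real k)) * n \<le> card (frozen k n G)"
  defines "p \<equiv> c / real n ^ (k - 1)"
  shows "expect p (touching k n x) (\<lambda>H. of_bool (x \<in> live n (Suc t) (G \<union> H) - frozen k n (G \<union> H)))
    \<le> contraction c k / n * card (live n t G - frozen k n G) + (real k)\<^sup>2 / n"
proof -
  let ?D = "touching k n x" and ?B = "frozen k n G" and ?lv = "live n t G"
  define D1 where "D1 = {e \<in> ?D. count_list (fst e) x = 1 \<and> set (fst e) - {x} \<subseteq> ?B}"
  define D2 where "D2 = {e \<in> ?D. \<exists>i<k. \<exists>j<k. i \<noteq> j \<and> fst e ! i \<in> {x} \<and> fst e ! j \<in> ?lv - ?B} - D1"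
  define D3 where "D3 = {e \<in> ?D. \<exists>i<k. \<exists>j<k. i \<noteq> j \<and> fst e ! i \<in> {x} \<and> fst e ! j \<in> {x}}"
  have finD: "finite ?D" by (rule finite_touching)
  have fin: "finite D1" "finite D2" "finite D3" using finD by (auto simp: D1_def D2_def D3_def)
  have finG: "finite G" using G finite_equations by (meson Diff_subset finite_subset)
  have p: "0 \<le> p" "p \<le> 1" using edge_probability[of c n "k - 1"] c by (auto simp: p_def)
  have xB: "x \<notin> ?B"
    using isolated_not_frozen[of k n G x] k n G by (auto simp: touching_def)
  \<comment> \<open>After deletion of the equations at \<open>x\<close> only \<open>G\<close>
    remains, so the sets \<open>?lv\<close> and \<open>?B\<close> do not depend on
    \<open>H\<close>.\<close>
  have delG: "del x (G \<union> H) = G" if "H \<subseteq> ?D" for H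
    using that G unfolding del_def touching_def by blast
  have pt: "of_bool (x \<in> live n (Suc t) (G \<union> H) - frozen k n (G \<union> H))
      \<le> (\<Sum>e\<in>D2. of_bool (H \<inter> D1 = {}) * of_bool (e \<in> H)) + (\<Sum>e\<in>D3. of_bool (e \<in> H) :: real)"
    if H: "H \<subseteq> ?D" for H
  proof (cases "x \<in> live n (Suc t) (G \<union> H) - frozen k n (G \<union> H)")
    case True
    have finGH: "finite (G \<union> H)" using finG H finD finite_subset by blast
    have ext: "x \<in> frozen k n (G \<union> H)" if "e \<in> H" "count_list (fst e) x = 1" "set (fst e) - {x} \<subseteq> ?B" for e
    proof (rule frozen_extend[OF k _ _ finGH, where G = G and e = e])
      show "length (fst e) = k" using that H by (auto simp: touching_def equations_iff)
    qed (use that n x in auto)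
    have nfr: "x \<notin> frozen k n (G \<union> H)" using True by blast
    then have H1: "H \<inter> D1 = {}" using ext unfolding D1_def by blast
    obtain e where e: "e \<in> G \<union> H" "x \<in> set (fst e)" "set (fst e) - {x} \<subseteq> live n t (del x (G \<union> H))"
      using True by auto
    then have eH: "e \<in> H" using G by (auto simp: touching_def)
    have others: "set (fst e) - {x} \<subseteq> ?lv" using e delG[OF H] by simp
    have len: "length (fst e) = k" using eH H by (auto simp: touching_def equations_iff)
    have "e \<in> D2 \<or> e \<in> D3"
    proof (cases "count_list (fst e) x = 1")
      case True
      then have nB: "\<not> set (fst e) - {x} \<subseteq> ?B" using ext[OF eH] nfr by blast
      then obtain y where y: "y \<in> set (fst e)" "y \<noteq> x" "y \<in> ?lv - ?B" using others by auto
      obtain i where i: "i < k" "fst e ! i = x" using e(2) len by (auto simp: in_set_conv_nth)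
      obtain j where j: "j < k" "fst e ! j = y" using y(1) len by (auto simp: in_set_conv_nth)
      have "i \<noteq> j" using i j y by auto
      then have "\<exists>i<k. \<exists>j<k. i \<noteq> j \<and> fst e ! i \<in> {x} \<and> fst e ! j \<in> ?lv - ?B" using i j y by blast
      then have "e \<in> D2" using eH H H1 unfolding D2_def by blast
      then show ?thesis ..
    next
      case False
      have "card {i. i < length (fst e) \<and> x = fst e ! i} \<noteq> 1"
        using False by (simp add: count_list_eq_length_filter length_filter_conv_card)
      moreover obtain i where i: "i < k" "fst e ! i = x" using e(2) len by (auto simp: in_set_conv_nth)
      ultimately have "{i. i < length (fst e) \<and> x = fst e ! i} \<noteq> {i}" by (metis is_singletonI is_singleton_altdef)
      moreover have "i \<in> {i. i < length (fst e) \<and> x = fst e ! i}" using i len by simp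
      ultimately obtain j where "j \<in> {i. i < length (fst e) \<and> x = fst e ! i}" "j \<noteq> i" by blast
      then have "j < k" "fst e ! j = x" "j \<noteq> i" using len by simp_all
      then have "\<exists>i<k. \<exists>j<k. i \<noteq> j \<and> fst e ! i \<in> {x} \<and> fst e ! j \<in> {x}" using i by blast
      then have "e \<in> D3" using eH H unfolding D3_def by blast
      then show ?thesis ..
    qed
    moreover have "1 \<le> (\<Sum>e\<in>D2. of_bool (H \<inter> D1 = {}) * of_bool (e \<in> H) :: real)" if "e \<in> D2"
      using member_le_sum[of e D2 "\<lambda>e. of_bool (H \<inter> D1 = {}) * of_bool (e \<in> H) :: real"] that fin H1 eH by simp
    moreover have "1 \<le> (\<Sum>e\<in>D3. of_bool (e \<in> H) :: real)" if "e \<in> D3"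
      using member_le_sum[of e D3 "\<lambda>e. of_bool (e \<in> H) :: real"] that fin eH by simp
    moreover have "0 \<le> (\<Sum>e\<in>D2. of_bool (H \<inter> D1 = {}) * of_bool (e \<in> H) :: real)" "0 \<le> (\<Sum>e\<in>D3. of_bool (e \<in> H) :: real)"
      by (simp_all add: sum_nonneg)
    ultimately have "1 \<le> (\<Sum>e\<in>D2. of_bool (H \<inter> D1 = {}) * of_bool (e \<in> H)) + (\<Sum>e\<in>D3. of_bool (e \<in> H) :: real)"
      by linarith
    then show ?thesis by (simp only: True of_bool_eq)
  next
    case False
    show ?thesis unfolding of_bool_eq_0_iff[THEN iffD2, OF False]
      by (intro add_nonneg_nonneg sum_nonneg) auto
  qed
  have "expect p ?D (\<lambda>H. of_bool (x \<in> live n (Suc t) (G \<union> H) - frozen k n (G \<union> H)))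
      \<le> expect p ?D (\<lambda>H. (\<Sum>e\<in>D2. of_bool (H \<inter> D1 = {}) * of_bool (e \<in> H)) + (\<Sum>e\<in>D3. of_bool (e \<in> H)))"
    using p pt by (intro expect_mono) auto
  also have "\<dots> = (\<Sum>e\<in>D2. (1 - p) ^ card D1 * p) + (\<Sum>e\<in>D3. p)"
  proof -
    have single: "expect p ?D (\<lambda>H. of_bool (e \<in> H)) = p" if "e \<in> ?D" for e
      using expect_superset[OF finD, of "{e}" p] that by simp
    have "expect p ?D (\<lambda>H. of_bool (H \<inter> D1 = {}) * of_bool (e \<in> H)) = (1 - p) ^ card D1 * p" if e: "e \<in> D2" for e
    proof -
      have "D1 \<subseteq> ?D" "e \<in> ?D" "e \<notin> D1" using e by (auto simp: D1_def D2_def)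
      then show ?thesis
        using expect_disjoint[OF finD, of D1 p "\<lambda>H. of_bool (e \<in> H)"] single by simp
    qed
    moreover have "expect p ?D (\<lambda>H. of_bool (e \<in> H)) = p" if e: "e \<in> D3" for e
      using single e by (simp add: D3_def)
    ultimately show ?thesis unfolding expect_add expect_sum by simp
  qed
  also have "\<dots> = (1 - p) ^ card D1 * (p * card D2) + p * card D3" by (simp add: mult_ac)
  also have "\<dots> \<le> exp (- (9 / 4) * c * k) * (3 * c * (real k)\<^sup>2 / n * card (?lv - ?B)) + (real k)\<^sup>2 / n"
  proof (rule add_mono[OF mult_mono])
    have "k - 1 = Suc (k - 2)" using k by simp
    then have nk: "real n ^ (k - 1) = n * real n ^ (k - 2)" by simp
    have Dsub: "{e \<in> ?D. P (fst e)} \<subseteq> {e \<in> equations k n. P (fst e)}" for P by (auto simp: touching_def)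
    have pairs: "p * real (card S) \<le> 3 * c * (real k)\<^sup>2 / n * card (C \<inter> {1..n})"
      if S: "S \<subseteq> {e \<in> ?D. \<exists>i<k. \<exists>j<k. i \<noteq> j \<and> fst e ! i \<in> {x} \<and> fst e ! j \<in> C}" for S C
    proof -
      have "card S \<le> card {e \<in> equations k n. \<exists>i<k. \<exists>j<k. i \<noteq> j \<and> fst e ! i \<in> {x} \<and> fst e ! j \<in> C}"
        using S by (intro card_mono) (auto simp: finite_equations touching_def)
      also have "\<dots> = 3 * card {ys \<in> tuples k n. \<exists>i<k. \<exists>j<k. i \<noteq> j \<and> ys ! i \<in> {x} \<and> ys ! j \<in> C}"
        by (rule card_equations_fst)
      also have "\<dots> \<le> 3 * (k\<^sup>2 * (card ({x} \<inter> {1..n}) * card (C \<inter> {1..n}) * n ^ (k - 2)))"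
        by (intro mult_left_mono card_tuples_pair) simp
      also have "\<dots> = 3 * (k\<^sup>2 * (card (C \<inter> {1..n}) * n ^ (k - 2)))" using x by simp
      finally have "p * real (card S) \<le> p * real (3 * (k\<^sup>2 * (card (C \<inter> {1..n}) * n ^ (k - 2))))"
        using p by (intro mult_left_mono) (simp_all only: of_nat_le_iff)
      also have "\<dots> = 3 * c * (real k)\<^sup>2 / n * card (C \<inter> {1..n})"
        unfolding p_def nk using n by simp
      finally show ?thesis .
    qed
    show "p * real (card D2) \<le> 3 * c * (real k)\<^sup>2 / n * card (?lv - ?B)"
    proof -
      have "(?lv - ?B) \<inter> {1..n} = ?lv - ?B" using live_subset by blast
      then show ?thesis using pairs[of D2 "?lv - ?B"] by (auto simp: D2_def)
    qed
    have "p * real (card D3) \<le> 3 * c * (real k)\<^sup>2 / n * card ({x} \<inter> {1..n})"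
      by (rule pairs) (auto simp: D3_def)
    also have "\<dots> \<le> (real k)\<^sup>2 / n"
      using x c mult_right_mono[of "3 * c" 1 "(real k)\<^sup>2"] by (simp add: divide_right_mono)
    finally show "p * real (card D3) \<le> (real k)\<^sup>2 / n" .
    show "(1 - p) ^ card D1 \<le> exp (- (9 / 4) * c * k)"
    proof -
      let ?b = "real (card ?B)"
      have "3 * (k * card ?B ^ (k - 1)) \<le> 3 * card {ys \<in> tuples k n. count_list ys x = 1 \<and> set ys - {x} \<subseteq> ?B}"
        by (intro mult_le_mono2 card_tuples_once x xB) (auto simp: frozen_def)
      also have "\<dots> = card {e \<in> equations k n. count_list (fst e) x = 1 \<and> set (fst e) - {x} \<subseteq> ?B}"
        by (rule card_equations_fst[symmetric])
      also have "{e \<in> equations k n. count_list (fst e) x = 1 \<and> set (fst e) - {x} \<subseteq> ?B} = D1"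
      proof -
        have "x \<in> set ys" if "count_list ys x = 1" for ys using that by (metis count_notin zero_neq_one)
        then show ?thesis by (auto simp: D1_def touching_def)
      qed
      finally have "real (3 * (k * card ?B ^ (k - 1))) \<le> real (card D1)" by (simp only: of_nat_le_iff)
      then have D1: "3 * (real k * ?b ^ (k - 1)) \<le> real (card D1)" by simp
      have s: "0 \<le> 1 / (4 * real k)" "1 / (4 * real k) \<le> 1" "real k * (1 / (4 * real k)) = 1 / 4"
        using k by (auto simp: divide_le_eq_1)
      \<comment> \<open>By Bernoulli's inequality frozen variables alone still fill 3/4 of the
        remaining positions; this gives \<open>9 / 4 = 3 * (3 / 4)\<close> in the exponent.\<close>
      have "3 / 4 * real n ^ (k - 1) \<le> ?b ^ (k - 1)"
      proof -
        have "real (k - 1) * (1 / (4 * real k)) \<le> 1 / 4"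
          using s mult_right_mono[of "real (k - 1)" "real k" "1 / (4 * real k)"] by simp
        then have "3 / 4 \<le> 1 + real (k - 1) * (- (1 / (4 * real k)))" by simp
        also have "\<dots> \<le> (1 + (- (1 / (4 * real k)))) ^ (k - 1)" using s by (intro Bernoulli_inequality) auto
        finally have "3 / 4 * real n ^ (k - 1) \<le> (1 - 1 / (4 * real k)) ^ (k - 1) * real n ^ (k - 1)"
          by (intro mult_right_mono) auto
        also have "\<dots> = ((1 - 1 / (4 * real k)) * n) ^ (k - 1)" by (simp only: power_mult_distrib)
        also have "\<dots> \<le> ?b ^ (k - 1)" using big s by (intro power_mono) auto
        finally show ?thesis .
      qed
      then have "3 * (real k * (3 / 4 * real n ^ (k - 1))) \<le> 3 * (real k * ?b ^ (k - 1))"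
        by (intro mult_left_mono) auto
      then have "9 / 4 * k * real n ^ (k - 1) \<le> real (card D1)" using D1 by simp
      then have "p * (9 / 4 * k * real n ^ (k - 1)) \<le> p * real (card D1)" using p by (intro mult_left_mono) auto
      moreover have "p * (9 / 4 * k * real n ^ (k - 1)) = 9 / 4 * c * k" using n by (simp add: p_def)
      ultimately have "9 / 4 * c * k \<le> p * real (card D1)" by (simp only:)
      then have le: "- (p * real (card D1)) \<le> - (9 / 4) * c * k" by simp
      have "(1 - p) ^ card D1 \<le> exp (- p) ^ card D1"
        using p exp_ge_add_one_self[of "- p"] by (intro power_mono) auto
      also have "\<dots> = exp (- (p * real (card D1)))" by (simp add: exp_of_nat_mult[symmetric] mult_ac)
      also have "\<dots> \<le> exp (- (9 / 4) * c * k)" using le by simp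
      finally show ?thesis .
    qed
  qed (use p c in auto)
  also have "\<dots> = contraction c k / n * card (?lv - ?B) + (real k)\<^sup>2 / n"
    by (simp add: contraction_def)
  finally show ?thesis .
qed

subsection \<open>Contraction\<close>

text \<open>Both conditions are increasing in the formula, which makes the comparison of
  \<open>F\<close> with \<open>F - touching k n x\<close> one-sided.\<close>

definition good :: "nat \<Rightarrow> nat \<Rightarrow> equation set \<Rightarrow> bool" where
  "good k n F \<longleftrightarrow> dependent 2 F \<and> (1 - 1 / (4 * real k)) * n \<le> card (frozen k n F)"

lemma good_mono:
  assumes "good k n F" "F \<subseteq> G" "finite G"
  shows "good k n G"
proof -
  have "card (frozen k n F) \<le> card (frozen k n G)"
    using frozen_mono[OF assms(2,3)] by (intro card_mono) (auto simp: frozen_def)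
  then have "real (card (frozen k n F)) \<le> real (card (frozen k n G))" by simp
  then show ?thesis using assms dependent_mono unfolding good_def by (blast intro: order_trans)
qed

text \<open>The indicator replaces conditioning on \<open>good\<close>, whose probability is the
  unknown of the argument.\<close>

definition discrepancy :: "nat \<Rightarrow> nat \<Rightarrow> nat \<Rightarrow> equation set \<Rightarrow> real" where
  "discrepancy k n t F = card (live n t F - frozen k n F) / n * of_bool (good k n F)"

lemma discrepancy_bounds: "0 \<le> discrepancy k n t F" "discrepancy k n t F \<le> 1"
proof -
  show "0 \<le> discrepancy k n t F" by (simp add: discrepancy_def)
  have "card (live n t F - frozen k n F) \<le> card {1..n}"
    using live_subset by (intro card_mono) auto
  then have "real (card (live n t F - frozen k n F)) / n \<le> 1" by (cases "n = 0") (simp_all add: divide_le_eq_1)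
  then show "discrepancy k n t F \<le> 1" by (simp add: discrepancy_def)
qed

text \<open>Requiring \<open>good\<close> only of the equations away from \<open>x\<close> keeps it
  independent of those at \<open>x\<close>, so that the estimate for a single variable applies for
  each fixed \<open>G\<close>.\<close>

lemma discrepancy_vertex:
  fixes k n x :: nat and c :: real
  assumes k: "k \<ge> 2" and n: "n \<ge> 2" and c: "0 \<le> c" "c \<le> 1 / 3" and x: "x \<in> {1..n}"
  defines "p \<equiv> c / real n ^ (k - 1)" and "E \<equiv> equations k n" and "D \<equiv> touching k n x"
  shows "expect p E (\<lambda>F. of_bool (x \<in> live n (Suc t) F - frozen k n F) * of_bool (good k n (F - D)))
    \<le> contraction c k * expect p E (\<lambda>F. discrepancy k n t (F - D)) + (real k)\<^sup>2 / n"
proof -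
  let ?\<kappa> = "contraction c k"
  have p: "0 \<le> p" "p \<le> 1" using edge_probability[of c n "k - 1"] c by (auto simp: p_def)
  have fin: "finite E" "finite D" "finite (E - D)" by (auto simp: E_def D_def finite_equations finite_touching)
  have split: "expect p E g = expect p (E - D) (\<lambda>G. expect p D (\<lambda>H. g (G \<union> H)))" for g
  proof -
    have "(E - D) \<union> D = E" by (auto simp: E_def D_def touching_def)
    then show ?thesis using expect_Un[of "E - D" D p g] fin by auto
  qed
  have "expect p E (\<lambda>F. of_bool (x \<in> live n (Suc t) F - frozen k n F) * of_bool (good k n (F - D)))
      \<le> expect p E (\<lambda>F. ?\<kappa> * discrepancy k n t (F - D) + (real k)\<^sup>2 / n)"
    unfolding split
  proof (rule expect_mono[OF p])
    fix G assume G: "G \<subseteq> E - D"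
    have GH: "(G \<union> H) - D = G" if "H \<subseteq> D" for H using that G by blast
    have "expect p D (\<lambda>H. of_bool (x \<in> live n (Suc t) (G \<union> H) - frozen k n (G \<union> H)) * of_bool (good k n (G \<union> H - D)))
        = expect p D (\<lambda>H. of_bool (good k n G) * of_bool (x \<in> live n (Suc t) (G \<union> H) - frozen k n (G \<union> H)))"
      by (intro expect_cong) (simp only: GH mult.commute)
    also have "\<dots> = of_bool (good k n G) * expect p D (\<lambda>H. of_bool (x \<in> live n (Suc t) (G \<union> H) - frozen k n (G \<union> H)))"
      by (rule expect_cmult)
    also have "\<dots> \<le> ?\<kappa> * discrepancy k n t G + (real k)\<^sup>2 / n"
    proof (cases "good k n G")
      case True
      have "expect p D (\<lambda>H. of_bool (x \<in> live n (Suc t) (G \<union> H) - frozen k n (G \<union> H)))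
          \<le> ?\<kappa> / n * card (live n t G - frozen k n G) + (real k)\<^sup>2 / n"
        unfolding p_def D_def
        using True G by (intro live_not_frozen_step k n c x) (auto simp: good_def E_def D_def)
      then show ?thesis using True by (simp add: discrepancy_def)
    qed (simp add: discrepancy_def)
    also have "\<dots> = expect p D (\<lambda>H. ?\<kappa> * discrepancy k n t G + (real k)\<^sup>2 / n)"
      using fin by simp
    also have "\<dots> = expect p D (\<lambda>H. ?\<kappa> * discrepancy k n t (G \<union> H - D) + (real k)\<^sup>2 / n)"
      by (intro expect_cong) (simp only: GH)
    finally show "expect p D (\<lambda>H. of_bool (x \<in> live n (Suc t) (G \<union> H) - frozen k n (G \<union> H)) * of_bool (good k n (G \<union> H - D)))
        \<le> expect p D (\<lambda>H. ?\<kappa> * discrepancy k n t (G \<union> H - D) + (real k)\<^sup>2 / n)" .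
  qed
  also have "\<dots> = ?\<kappa> * expect p E (\<lambda>F. discrepancy k n t (F - D)) + (real k)\<^sup>2 / n"
    unfolding expect_add expect_cmult using fin by simp
  finally show ?thesis .
qed

text \<open>Summed over \<open>x\<close>, two replacements are made: \<open>good\<close> of
  \<open>F\<close> by \<open>good\<close> of \<open>F - touching k n x\<close>, and the discrepancy
  of \<open>F - touching k n x\<close> by that of \<open>F\<close>. By
  \<open>average_deletion\<close> each costs an error of order \<open>sqrt n\<close>; between them
  the contraction applies.\<close>

lemma discrepancy_step:
  fixes k n :: nat and c :: real
  assumes k: "k \<ge> 2" and n: "n \<ge> 2" and c: "0 \<le> c" "c \<le> 1 / 3" and \<kappa>: "contraction c k \<le> 1 / 2"
  defines "p \<equiv> c / real n ^ (k - 1)" and "E \<equiv> equations k n"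
  shows "expect p E (discrepancy k n (Suc t))
    \<le> 1 / 2 * expect p E (discrepancy k n t) + (2 * deletion_error k n + (real k)\<^sup>2) / n"
proof -
  let ?\<kappa> = "contraction c k" and ?V = "{1..n}" and ?D = "touching k n" and ?err = "deletion_error k n"
  let ?g = "\<lambda>F. of_bool (good k n F) :: real"
  have p: "0 \<le> p" "p \<le> 1" using edge_probability[of c n "k - 1"] c by (auto simp: p_def)
  have fin: "finite E" by (simp add: E_def finite_equations)
  have n0: "n > 0" using n by simp
  have \<kappa>0: "0 \<le> ?\<kappa>" using c by (simp add: contraction_def)
  have err0: "0 \<le> ?err" by (simp add: deletion_error_def)
  have gen: "of_bool A * b \<le> of_bool A * b' + (b - b')" if "b' \<le> b" for A and b b' :: real
    using that by (cases A) auto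
  have d0: "0 \<le> expect p E (discrepancy k n t)" using p discrepancy_bounds by (intro expect_nonneg) auto
  have "n * expect p E (discrepancy k n (Suc t)) = expect p E (\<lambda>F. n * discrepancy k n (Suc t) F)"
    by (simp only: expect_cmult)
  also have "\<dots> = expect p E (\<lambda>F. \<Sum>x\<in>?V. of_bool (x \<in> live n (Suc t) F - frozen k n F) * ?g F)"
  proof (rule expect_cong)
    fix F
    have "real (card A) = (\<Sum>x\<in>?V. of_bool (x \<in> A))" if "A \<subseteq> ?V" for A
      using that by (simp add: of_bool_def sum.If_cases Int_absorb1)
    moreover have "live n (Suc t) F - frozen k n F \<subseteq> ?V" using live_subset[of n "Suc t" F] by blast
    ultimately have "real (card (live n (Suc t) F - frozen k n F)) = (\<Sum>x\<in>?V. of_bool (x \<in> live n (Suc t) F - frozen k n F))"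
      by blast
    then show "n * discrepancy k n (Suc t) F = (\<Sum>x\<in>?V. of_bool (x \<in> live n (Suc t) F - frozen k n F) * ?g F)"
      using n0 by (simp only: discrepancy_def sum_distrib_right[symmetric]) simp
  qed
  also have "\<dots> = (\<Sum>x\<in>?V. expect p E (\<lambda>F. of_bool (x \<in> live n (Suc t) F - frozen k n F) * ?g F))"
    by (rule expect_sum)
  also have "\<dots> \<le> (\<Sum>x\<in>?V. ?\<kappa> * expect p E (\<lambda>F. discrepancy k n t (F - ?D x)) + (real k)\<^sup>2 / n
      + (expect p E ?g - expect p E (\<lambda>F. ?g (F - ?D x))))"
  proof (rule sum_mono)
    fix x assume x: "x \<in> ?V"
    have "expect p E (\<lambda>F. of_bool (x \<in> live n (Suc t) F - frozen k n F) * ?g F)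
        \<le> expect p E (\<lambda>F. of_bool (x \<in> live n (Suc t) F - frozen k n F) * ?g (F - ?D x) + (?g F - ?g (F - ?D x)))"
    proof (intro expect_mono p)
      fix F assume F: "F \<subseteq> E"
      then have "good k n (F - ?D x) \<Longrightarrow> good k n F"
        using good_mono[of k n "F - ?D x" F] fin finite_subset by blast
      then have "?g (F - ?D x) \<le> ?g F" by simp
      then show "of_bool (x \<in> live n (Suc t) F - frozen k n F) * ?g F
          \<le> of_bool (x \<in> live n (Suc t) F - frozen k n F) * ?g (F - ?D x) + (?g F - ?g (F - ?D x))"
        by (rule gen)
    qed
    also have "\<dots> = expect p E (\<lambda>F. of_bool (x \<in> live n (Suc t) F - frozen k n F) * ?g (F - ?D x))
        + (expect p E ?g - expect p E (\<lambda>F. ?g (F - ?D x)))"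
      by (simp only: expect_add expect_diff)
    also have "\<dots> \<le> ?\<kappa> * expect p E (\<lambda>F. discrepancy k n t (F - ?D x)) + (real k)\<^sup>2 / n
        + (expect p E ?g - expect p E (\<lambda>F. ?g (F - ?D x)))"
      unfolding p_def E_def by (intro add_right_mono discrepancy_vertex k n c x)
    finally show "expect p E (\<lambda>F. of_bool (x \<in> live n (Suc t) F - frozen k n F) * ?g F)
        \<le> ?\<kappa> * expect p E (\<lambda>F. discrepancy k n t (F - ?D x)) + (real k)\<^sup>2 / n
          + (expect p E ?g - expect p E (\<lambda>F. ?g (F - ?D x)))" .
  qed
  also have "\<dots> = ?\<kappa> * (\<Sum>x\<in>?V. expect p E (\<lambda>F. discrepancy k n t (F - ?D x))) + (real k)\<^sup>2
      + (n * expect p E ?g - (\<Sum>x\<in>?V. expect p E (\<lambda>F. ?g (F - ?D x))))"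
    using n0 by (simp add: sum.distrib sum_subtractf sum_distrib_left)
  also have "\<dots> \<le> ?\<kappa> * (n * expect p E (discrepancy k n t) + ?err) + (real k)\<^sup>2 + ?err"
  proof (intro add_mono mult_left_mono \<kappa>0 order_refl)
    have "\<bar>(\<Sum>x\<in>?V. expect p E (\<lambda>F. discrepancy k n t (F - ?D x))) - n * expect p E (discrepancy k n t)\<bar> \<le> ?err"
      unfolding p_def E_def by (intro average_deletion k n0 c discrepancy_bounds)
    then show "(\<Sum>x\<in>?V. expect p E (\<lambda>F. discrepancy k n t (F - ?D x))) \<le> n * expect p E (discrepancy k n t) + ?err"
      by linarith
    have "\<bar>(\<Sum>x\<in>?V. expect p E (\<lambda>F. ?g (F - ?D x))) - n * expect p E ?g\<bar> \<le> ?err"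
      unfolding p_def E_def by (intro average_deletion k n0 c) auto
    then show "n * expect p E ?g - (\<Sum>x\<in>?V. expect p E (\<lambda>F. ?g (F - ?D x))) \<le> ?err"
      by linarith
  qed
  also have "\<dots> \<le> 1 / 2 * (n * expect p E (discrepancy k n t) + ?err) + (real k)\<^sup>2 + ?err"
    using \<kappa> d0 err0 by (intro add_right_mono mult_right_mono) auto
  also have "\<dots> \<le> n * (1 / 2 * expect p E (discrepancy k n t)) + (2 * ?err + (real k)\<^sup>2)"
    using err0 by simp
  also have "\<dots> = n * (1 / 2 * expect p E (discrepancy k n t) + (2 * ?err + (real k)\<^sup>2) / n)"
  proof -
    have "n * (a + b / n) = n * a + b" for a b :: real using n0 by (simp add: distrib_left)
    then show ?thesis by (simp only:)
  qed
  finally show ?thesis using n0 by simp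
qed

lemma discrepancy_le:
  fixes k n :: nat and c :: real
  assumes k: "k \<ge> 2" and n: "n \<ge> 2" and c: "0 \<le> c" "c \<le> 1 / 3" and \<kappa>: "contraction c k \<le> 1 / 2"
  shows "expect (c / real n ^ (k - 1)) (equations k n) (discrepancy k n t)
    \<le> (1 / 2) ^ t + 2 * ((2 * deletion_error k n + (real k)\<^sup>2) / n)"
proof (induction t)
  case 0
  have "expect (c / real n ^ (k - 1)) (equations k n) (discrepancy k n 0)
      \<le> expect (c / real n ^ (k - 1)) (equations k n) (\<lambda>F. 1)"
    using edge_probability[of c n "k - 1"] c discrepancy_bounds by (intro expect_mono) auto
  moreover have "0 \<le> 2 * ((2 * deletion_error k n + (real k)\<^sup>2) / n)" by (simp add: deletion_error_def)
  ultimately show ?case by (simp add: finite_equations)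
next
  case (Suc t)
  let ?e = "(2 * deletion_error k n + (real k)\<^sup>2) / n"
  have "expect (c / real n ^ (k - 1)) (equations k n) (discrepancy k n (Suc t))
      \<le> 1 / 2 * expect (c / real n ^ (k - 1)) (equations k n) (discrepancy k n t) + ?e"
    by (rule discrepancy_step[OF k n c \<kappa>])
  also have "\<dots> \<le> 1 / 2 * ((1 / 2) ^ t + 2 * ?e) + ?e" using Suc by simp
  also have "\<dots> = (1 / 2) ^ Suc t + 2 * ?e"
  proof -
    have "1 / 2 * (a + 2 * b) + b = 1 / 2 * a + 2 * b" for a b :: real by simp
    then show ?thesis by (simp only: power_Suc)
  qed
  finally show ?case .
qed

text \<open>With \<open>y = 9 / 40 * k\<close> the exponent is at least \<open>3 * y\<close>. One
  factor \<open>exp y\<close> is bounded below by a constant and the other two by multiples of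
  \<open>y\<close>, which together beat \<open>2 * k\<^sup>2\<close>.\<close>

lemma contraction_le_half:
  assumes k: "k \<ge> 16" and c: "3 / 10 \<le> c" "c \<le> 1 / 3"
  shows "contraction c k \<le> 1 / 2"
proof -
  define y where "y = 9 / 40 * real k"
  have y: "y \<ge> 18 / 5" using k by (simp add: y_def)
  have "1 + y + y\<^sup>2 / 2 \<le> exp y" using y by (intro exp_lower_Taylor_quadratic) auto
  moreover have "11 \<le> 1 + y + y\<^sup>2 / 2"
  proof -
    have "(18 / 5) * (18 / 5) \<le> y * y" using y by (intro mult_mono) auto
    then show ?thesis using y by (simp add: power2_eq_square)
  qed
  moreover have "14 / 5 * y \<le> 1 + y + y\<^sup>2 / 2"
  proof -
    have "(18 / 5) * y \<le> y * y" using y by (intro mult_right_mono) auto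
    then show ?thesis by (simp add: power2_eq_square)
  qed
  ultimately have e: "11 \<le> exp y" "14 / 5 * y \<le> exp y" by linarith+
  have "2 * (real k)\<^sup>2 \<le> 11 * ((14 / 5 * y) * (14 / 5 * y))"
    by (simp add: y_def power2_eq_square)
  also have "\<dots> \<le> exp y * (exp y * exp y)" using e y by (intro mult_mono) auto
  also have "\<dots> = exp (27 / 40 * real k)" by (simp add: y_def flip: exp_add)
  also have "\<dots> \<le> exp (9 / 4 * c * k)"
  proof -
    have "9 / 4 * (3 / 10) * real k \<le> 9 / 4 * c * k" using c by (intro mult_right_mono) auto
    then show ?thesis by simp
  qed
  finally have *: "2 * (real k)\<^sup>2 \<le> exp (9 / 4 * c * k)" .
  have "contraction c k = 3 * c * (real k)\<^sup>2 / exp (9 / 4 * c * k)"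
  proof -
    have "exp (- (9 / 4) * c * k) = 1 / exp (9 / 4 * c * k)"
      using exp_minus[of "9 / 4 * c * k"] by (simp only: inverse_eq_divide mult_minus_left)
    then show ?thesis by (simp only: contraction_def times_divide_eq_right mult_1_right)
  qed
  also have "\<dots> \<le> 1 * (real k)\<^sup>2 / exp (9 / 4 * c * k)"
    using c by (intro divide_right_mono mult_right_mono) auto
  also have "\<dots> \<le> 1 / 2" using * by (simp add: pos_divide_le_eq)
  finally show ?thesis .
qed

subsection \<open>Local exploration of the 2-core\<close>

definition explored :: "nat \<Rightarrow> equation list \<Rightarrow> nat set" where
  "explored x es = insert x (\<Union>e\<in>set es. set (fst e))"

text \<open>The list is stored newest first, so that its tail is the exploration before the last
  step.\<close>

fun chain :: "nat \<Rightarrow> equation list \<Rightarrow> bool" where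
  "chain x [] \<longleftrightarrow> True"
| "chain x (e # es) \<longleftrightarrow> chain x es \<and> e \<notin> set es \<and> set (fst e) \<inter> explored x es \<noteq> {}"

text \<open>The last equation of the chain closes a cycle: apart from the variable through which it is
  reached, it repeats an explored variable or one of its own.\<close>

definition closes :: "nat \<Rightarrow> nat \<Rightarrow> equation list \<Rightarrow> equation \<Rightarrow> bool" where
  "closes k x es e \<longleftrightarrow> chain x (e # es) \<and> card (set (fst e) - explored x es) + 2 \<le> k"

definition near_cycle :: "nat \<Rightarrow> nat \<Rightarrow> nat \<Rightarrow> equation set \<Rightarrow> bool" where
  "near_cycle k t x F \<longleftrightarrow> (\<exists>es e. closes k x es e \<and> length es \<le> t \<and> set (e # es) \<subseteq> F)"

lemma chain_distinct: "chain x es \<Longrightarrow> distinct es"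
  by (induction es) auto

text \<open>The chain \<open>es\<close> leads from \<open>x\<close> to \<open>y\<close>, and
  \<open>X\<close> collects the variables deleted on the way. A core variable has two occurrences in
  the core; the equation that led to \<open>y\<close> accounts for one only, because without a short
  cycle its variables are distinct. Hence another core equation contains \<open>y\<close>. It meets
  the explored part in \<open>y\<close> alone, its other variables are fresh and in the core, and
  the induction hypothesis applies to them.\<close>

lemma core_subset_live_aux:
  assumes F: "F \<subseteq> equations k n" and k: "k \<ge> 2" and V: "V = fst (two_core n F)" and C: "C = snd (two_core n F)"
    and acyclic: "\<not> near_cycle k T x F"
    and "chain x es" "set es \<subseteq> F" "length es + t \<le> T"
    and "y \<in> V" "y \<in> explored x es" "y \<notin> X" "X \<subseteq> explored x es"
    and fresh: "es = [] \<or> y \<in> set (fst (hd es)) - explored x (tl es)"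
  shows "y \<in> live n t {e \<in> F. set (fst e) \<inter> X = {}}"
  using assms(6-)
proof (induction t arbitrary: es y X)
  case 0
  then show ?case using core_subset(2)[of n F] V by auto
next
  case (Suc t)
  have finC: "finite C" using core_subset(1)[of n F] C F finite_equations by (metis finite_subset)
  have CF: "C \<subseteq> F" using core_subset(1) C by blast
  have CV: "set (fst e) \<subseteq> V" if "e \<in> C" for e using core_equation_vars[OF F] that V C by blast
  \<comment> \<open>Each extension of a chain brings at least \<open>k - 1\<close> new variables,
    for otherwise it would close a cycle.\<close>
  have new: "card (set (fst e) - explored x fs) + 1 \<ge> k" if "chain x (e # fs)" "length fs \<le> T" "set (e # fs) \<subseteq> F" for e fs
    using acyclic that unfolding near_cycle_def closes_def by (metis Suc_eq_plus1 add_2_eq_Suc' not_less_eq_eq)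
  have occ: "2 \<le> (\<Sum>e\<in>C. count_list (fst e) y)"
    using core_occurrences[of y n F] Suc.prems V C by (simp add: occurrences_def)
  have "\<exists>e\<in>C. y \<in> set (fst e) \<and> e \<notin> set es"
  proof (cases es)
    case Nil
    then have "\<exists>e\<in>C. count_list (fst e) y \<noteq> 0" using occ by (metis not_numeral_le_zero sum.neutral)
    then show ?thesis using Nil by (auto simp: count_list_0_iff)
  next
    case (Cons e1 fs)
    have y1: "y \<in> set (fst e1)" "y \<notin> explored x fs" using Suc.prems(8) Cons by auto
    have ch: "chain x (e1 # fs)" "length fs \<le> T" "set (e1 # fs) \<subseteq> F" using Suc.prems Cons by auto
    have len: "length (fst e1) = k" 
    proof -
      have "e1 \<in> equations k n" using ch(3) F by auto
      then show ?thesis by (simp add: equations_iff)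
    qed
    have "card (set (fst e1) \<inter> explored x fs) \<ge> 1"
      using ch(1) by (simp add: Suc_le_eq card_gt_0_iff)
    moreover have "card (set (fst e1)) = card (set (fst e1) - explored x fs) + card (set (fst e1) \<inter> explored x fs)"
      using card_Int_Diff[of "set (fst e1)" "explored x fs"] by simp
    ultimately have "card (set (fst e1)) = length (fst e1)"
      using new[OF ch] len card_length[of "fst e1"] by linarith
    then have "distinct (fst e1)" by (rule card_distinct)
    then have one: "count_list (fst e1) y = 1"
      using y1 by (simp add: count_mset[symmetric] distinct_count_atmost_1)
    have "\<exists>e\<in>C - {e1}. count_list (fst e) y \<noteq> 0"
    proof (rule ccontr)
      assume "\<not> ?thesis"
      then have "(\<Sum>e\<in>C - {e1}. count_list (fst e) y) = 0" by simp
      moreover have "(\<Sum>e\<in>C. count_list (fst e) y) \<le> count_list (fst e1) y + (\<Sum>e\<in>C - {e1}. count_list (fst e) y)"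
        using finC by (cases "e1 \<in> C") (simp_all add: sum.remove)
      ultimately show False using occ one by simp
    qed
    then obtain e where e: "e \<in> C" "e \<noteq> e1" "y \<in> set (fst e)" by (auto simp: count_list_0_iff)
    moreover have "e \<notin> set fs" using y1 e by (auto simp: explored_def)
    ultimately show ?thesis using Cons by auto
  qed
  then obtain e where e: "e \<in> C" "y \<in> set (fst e)" "e \<notin> set es" by blast
  have eF: "e \<in> F" using e CF by auto
  have ch: "chain x (e # es)" using Suc.prems e by auto
  have len: "length (fst e) = k" using equations_iff[of e] eF F by blast
  have meet: "set (fst e) \<inter> explored x es = {y}"
  proof -
    have "card (set (fst e) - explored x es) + 1 \<ge> k" using Suc.prems eF by (intro new[OF ch]) auto
    moreover have "card (set (fst e)) = card (set (fst e) - explored x es) + card (set (fst e) \<inter> explored x es)"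
      using card_Int_Diff[of "set (fst e)" "explored x es"] by simp
    ultimately have "card (set (fst e) \<inter> explored x es) \<le> 1" using len card_length[of "fst e"] by linarith
    moreover have "y \<in> set (fst e) \<inter> explored x es" using e Suc.prems by auto
    ultimately show ?thesis by (metis One_nat_def card_le_Suc0_iff_eq finite_Int finite_set is_singletonI' is_singleton_the_elem empty_iff singletonD)
  qed
  let ?G = "{e \<in> F. set (fst e) \<inter> X = {}}"
  have eG: "e \<in> ?G" using eF meet Suc.prems by auto
  have del: "del y ?G = {e \<in> F. set (fst e) \<inter> insert y X = {}}" by (auto simp: del_def)
  have "set (fst e) - {y} \<subseteq> live n t (del y ?G)"
  proof
    fix z assume z: "z \<in> set (fst e) - {y}"
    then have zf: "z \<notin> explored x es" using meet by auto
    show "z \<in> live n t (del y ?G)"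
      unfolding del
    proof (rule Suc.IH[OF ch])
      show "set (e # es) \<subseteq> F" using eF Suc.prems by auto
      show "length (e # es) + t \<le> T" using Suc.prems by simp
      show "z \<in> V" using CV[OF e(1)] z by auto
      show "z \<in> explored x (e # es)" using z by (auto simp: explored_def)
      show "z \<notin> insert y X" using z zf Suc.prems by auto
      show "insert y X \<subseteq> explored x (e # es)" using Suc.prems e by (auto simp: explored_def)
      show "e # es = [] \<or> z \<in> set (fst (hd (e # es))) - explored x (tl (e # es))" using z zf by simp
    qed
  qed
  moreover have "y \<in> {1..n}" using core_subset(2)[of n F] V Suc.prems by auto
  ultimately show ?case unfolding live.simps using eG e(2) by blast
qed

lemma core_subset_live:
  assumes "F \<subseteq> equations k n" "k \<ge> 2" "x \<in> fst (two_core n F)" "\<not> near_cycle k t x F"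
  shows "x \<in> live n t F"
  using core_subset_live_aux[OF assms(1,2) refl refl assms(4), of "[]" t x "{}"] assms(3)
  by (simp add: explored_def)

section \<open>Counting chains and cycles\<close>

definition chains :: "nat \<Rightarrow> nat \<Rightarrow> nat \<Rightarrow> nat \<Rightarrow> equation list set" where
  "chains k n x j = {es. chain x es \<and> set es \<subseteq> equations k n \<and> length es = j}"

lemma finite_chains: "finite (chains k n x j)"
proof (rule finite_subset)
  show "finite {es. set es \<subseteq> equations k n \<and> length es = j}"
    by (rule finite_lists_length_eq[OF finite_equations])
qed (auto simp: chains_def)

lemma card_explored:
  assumes "es \<in> chains k n x j"
  shows "card (explored x es) \<le> 1 + k * j"
proof -
  have "card (\<Union>e\<in>set es. set (fst e)) \<le> (\<Sum>e\<in>set es. card (set (fst e)))" by (rule card_UN_le) simp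
  also have "\<dots> \<le> (\<Sum>e\<in>set es. k)"
  proof (rule sum_mono)
    fix e assume "e \<in> set es"
    then have "e \<in> equations k n" using assms by (auto simp: chains_def)
    then show "card (set (fst e)) \<le> k" using card_length[of "fst e"] by (simp add: equations_iff)
  qed
  also have "\<dots> = k * card (set es)" by simp
  also have "\<dots> \<le> k * j" using assms card_length[of es] by (intro mult_le_mono2) (auto simp: chains_def)
  finally have "card (\<Union>e\<in>set es. set (fst e)) \<le> k * j" .
  moreover have "card (explored x es) \<le> Suc (card (\<Union>e\<in>set es. set (fst e)))"
    unfolding explored_def by (simp add: card_insert_if)
  ultimately show ?thesis by linarith
qed

lemma card_chains_Suc: "card (chains k n x (Suc j)) \<le> card (chains k n x j) * (3 * (k * ((1 + k * j) * n ^ (k - 1))))"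
proof -
  let ?S = "\<lambda>es. {e \<in> equations k n. set (fst e) \<inter> explored x es \<noteq> {}}"
  have "chains k n x (Suc j) \<subseteq> (\<lambda>(es, e). e # es) ` (SIGMA es : chains k n x j. ?S es)"
  proof
    fix fs assume fs: "fs \<in> chains k n x (Suc j)"
    then obtain e es where "fs = e # es" by (auto simp: chains_def length_Suc_conv)
    then show "fs \<in> (\<lambda>(es, e). e # es) ` (SIGMA es : chains k n x j. ?S es)"
      using fs by (intro image_eqI[of _ _ "(es, e)"]) (auto simp: chains_def)
  qed
  then have "card (chains k n x (Suc j)) \<le> card (SIGMA es : chains k n x j. ?S es)"
    using finite_chains finite_equations by (intro surj_card_le) auto
  also have "\<dots> = (\<Sum>es\<in>chains k n x j. card (?S es))"
    using finite_chains finite_equations by (intro card_SigmaI) auto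
  also have "\<dots> \<le> (\<Sum>es\<in>chains k n x j. 3 * (k * ((1 + k * j) * n ^ (k - 1))))"
  proof (rule sum_mono)
    fix es assume es: "es \<in> chains k n x j"
    have "card (?S es) = 3 * card {ys \<in> tuples k n. set ys \<inter> explored x es \<noteq> {}}"
      by (rule card_equations_fst)
    also have "\<dots> \<le> 3 * (k * (card (explored x es \<inter> {1..n}) * n ^ (k - 1)))"
      by (intro mult_le_mono2 card_tuples_meeting)
    also have "\<dots> \<le> 3 * (k * ((1 + k * j) * n ^ (k - 1)))"
    proof (intro mult_le_mono2 mult_le_mono1)
      have "card (explored x es \<inter> {1..n}) \<le> card (explored x es)" by (intro card_mono) (auto simp: explored_def)
      then show "card (explored x es \<inter> {1..n}) \<le> 1 + k * j" using card_explored[OF es] by linarith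
    qed
    finally show "card (?S es) \<le> 3 * (k * ((1 + k * j) * n ^ (k - 1)))" .
  qed
  finally show ?thesis by simp
qed

text \<open>Each step has at most \<open>3 * k * (1 + k * t) * n ^ (k - 1)\<close> choices, and
  \<open>3 * c \<le> 1\<close> keeps the expected number bounded in \<open>n\<close>.\<close>

lemma expected_chains:
  fixes c :: real
  assumes c: "0 \<le> c" "c \<le> 1 / 3" and n: "n > 0" and j: "j \<le> t"
  shows "real (card (chains k n x j)) * (c / real n ^ (k - 1)) ^ j \<le> (real k * (1 + real k * t)) ^ j"
  using j
proof (induction j)
  case 0
  have "chains k n x 0 = {[]}" by (auto simp: chains_def)
  then show ?case by simp
next
  case (Suc j)
  define p where "p = c / real n ^ (k - 1)"
  have p: "0 \<le> p" using c by (simp add: p_def)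
  have IH: "real (card (chains k n x j)) * p ^ j \<le> (real k * (1 + real k * t)) ^ j"
    using Suc by (simp add: p_def)
  have "real (card (chains k n x (Suc j))) \<le> real (card (chains k n x j) * (3 * (k * ((1 + k * j) * n ^ (k - 1)))))"
    using card_chains_Suc by (simp only: of_nat_le_iff)
  then have "real (card (chains k n x (Suc j))) * p ^ Suc j
      \<le> real (card (chains k n x j) * (3 * (k * ((1 + k * j) * n ^ (k - 1))))) * p ^ Suc j"
    using p by (intro mult_right_mono zero_le_power)
  also have "\<dots> = (real (card (chains k n x j)) * p ^ j) * (3 * (real n ^ (k - 1) * p) * (real k * (1 + real k * j)))"
    by (simp add: algebra_simps)
  also have "real n ^ (k - 1) * p = c" using n by (simp add: p_def)
  also have "(real (card (chains k n x j)) * p ^ j) * (3 * c * (real k * (1 + real k * j)))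
      \<le> (real k * (1 + real k * t)) ^ j * (1 * (real k * (1 + real k * t)))"
    using Suc.prems c p by (intro mult_mono IH) (auto intro!: mult_left_mono mult_nonneg_nonneg)
  finally show ?case unfolding p_def by (simp add: mult.commute)
qed

text \<open>If only one position has its entry in \<open>U\<close>, the other \<open>k - 1\<close>
  positions share at most \<open>k - 2\<close> values, so two of them agree.\<close>

lemma closing_positions:
  assumes "length ys = k" "k \<ge> 2" "set ys \<inter> U \<noteq> {}" "card (set ys - U) + 2 \<le> k"
  shows "(\<exists>i<k. \<exists>j<k. i \<noteq> j \<and> ys ! i \<in> U \<and> ys ! j \<in> U)
    \<or> (\<exists>i<k. \<exists>j<k. \<exists>l<k. i \<noteq> j \<and> i \<noteq> l \<and> j \<noteq> l \<and> ys ! i \<in> U \<and> ys ! j = ys ! l)"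
proof -
  obtain i where i: "i < k" "ys ! i \<in> U" using assms by (auto simp: set_conv_nth)
  show ?thesis
  proof (cases "\<exists>j<k. i \<noteq> j \<and> ys ! j \<in> U")
    case True
    then show ?thesis using i by blast
  next
    case False
    then have "(!) ys ` ({..<k} - {i}) \<subseteq> set ys - U" using assms by auto
    then have "card ((!) ys ` ({..<k} - {i})) \<le> card (set ys - U)" by (intro card_mono) auto
    also have "\<dots> < card ({..<k} - {i})" using assms i by simp
    finally have "\<not> inj_on ((!) ys) ({..<k} - {i})" using card_image by fastforce
    then obtain j l where "j \<in> {..<k} - {i}" "l \<in> {..<k} - {i}" "ys ! j = ys ! l" "j \<noteq> l"
      by (auto simp: inj_on_def)
    then show ?thesis using i by blast
  qed
qed

text \<open>Either pattern costs a factor \<open>n\<close> against the order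
  \<open>n ^ (k - 1)\<close> of equations that merely touch \<open>U\<close>; this is why a cycle
  near a given variable has probability of order \<open>1 / n\<close>.\<close>

lemma card_closing:
  assumes "k \<ge> 2" "u \<ge> 1" "card U \<le> u" "finite U"
  shows "card {e \<in> equations k n. set (fst e) \<inter> U \<noteq> {} \<and> card (set (fst e) - U) + 2 \<le> k}
    \<le> 6 * (k ^ 3 * u\<^sup>2 * n ^ (k - 2))"
proof -
  let ?A = "{ys \<in> tuples k n. \<exists>i<k. \<exists>j<k. i \<noteq> j \<and> ys ! i \<in> U \<and> ys ! j \<in> U}"
  let ?I = "{(i, j, l). i < k \<and> j < k \<and> l < k \<and> i \<noteq> j \<and> i \<noteq> l \<and> j \<noteq> l}"
  let ?B = "\<lambda>q. {ys \<in> tuples k n. ys ! fst q \<in> U \<and> ys ! fst (snd q) = ys ! snd (snd q)}"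
  have Usub: "card (U \<inter> {1..n}) \<le> u" using card_mono[OF assms(4), of "U \<inter> {1..n}"] assms by simp
  have I: "?I \<subseteq> {..<k} \<times> {..<k} \<times> {..<k}" by auto
  then have finI: "finite ?I" by (rule finite_subset) simp
  have "card ?I \<le> card ({..<k} \<times> {..<k} \<times> {..<k})" using I by (intro card_mono) auto
  then have cardI: "card ?I \<le> k ^ 3" by (simp add: card_cartesian_product power3_eq_cube)
  have "{ys \<in> tuples k n. set ys \<inter> U \<noteq> {} \<and> card (set ys - U) + 2 \<le> k} \<subseteq> ?A \<union> (\<Union>q\<in>?I. ?B q)"
  proof
    fix ys assume ys: "ys \<in> {ys \<in> tuples k n. set ys \<inter> U \<noteq> {} \<and> card (set ys - U) + 2 \<le> k}"
    then consider (1) "\<exists>i<k. \<exists>j<k. i \<noteq> j \<and> ys ! i \<in> U \<and> ys ! j \<in> U"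
      | (2) i j l where "i < k" "j < k" "l < k" "i \<noteq> j" "i \<noteq> l" "j \<noteq> l" "ys ! i \<in> U" "ys ! j = ys ! l"
      using closing_positions[of ys k U] assms(1) by blast
    then show "ys \<in> ?A \<union> (\<Union>q\<in>?I. ?B q)"
    proof cases
      case 1
      then show ?thesis using ys by blast
    next
      case 2
      then have "(i, j, l) \<in> ?I" "ys \<in> ?B (i, j, l)" using ys by auto
      then show ?thesis by blast
    qed
  qed
  then have "card {ys \<in> tuples k n. set ys \<inter> U \<noteq> {} \<and> card (set ys - U) + 2 \<le> k} \<le> card (?A \<union> (\<Union>q\<in>?I. ?B q))"
    using finite_tuples_filter finI by (intro card_mono) auto
  also have "\<dots> \<le> card ?A + card (\<Union>q\<in>?I. ?B q)" by (rule card_Un_le)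
  also have "\<dots> \<le> k\<^sup>2 * (u * u * n ^ (k - 2)) + k ^ 3 * (u * n ^ (k - 2))"
  proof (rule add_mono)
    have "card ?A \<le> k\<^sup>2 * (card (U \<inter> {1..n}) * card (U \<inter> {1..n}) * n ^ (k - 2))" by (rule card_tuples_pair)
    also have "\<dots> \<le> k\<^sup>2 * (u * u * n ^ (k - 2))" using Usub by (intro mult_le_mono le_refl)
    finally show "card ?A \<le> k\<^sup>2 * (u * u * n ^ (k - 2))" .
    have "card (\<Union>q\<in>?I. ?B q) \<le> (\<Sum>q\<in>?I. card (?B q))" by (rule card_UN_le[OF finI])
    also have "\<dots> \<le> (\<Sum>q\<in>?I. u * n ^ (k - 2))"
    proof (rule sum_mono)
      fix q assume "q \<in> ?I"
      then have "card (?B q) \<le> card (U \<inter> {1..n}) * n ^ (k - 2)" by (intro card_tuples_three) auto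
      also have "\<dots> \<le> u * n ^ (k - 2)" using Usub by (intro mult_le_mono1)
      finally show "card (?B q) \<le> u * n ^ (k - 2)" .
    qed
    also have "\<dots> = card ?I * (u * n ^ (k - 2))" by simp
    also have "\<dots> \<le> k ^ 3 * (u * n ^ (k - 2))" using cardI by (intro mult_le_mono1)
    finally show "card (\<Union>q\<in>?I. ?B q) \<le> k ^ 3 * (u * n ^ (k - 2))" .
  qed
  also have "\<dots> \<le> k ^ 3 * (u\<^sup>2 * n ^ (k - 2)) + k ^ 3 * (u\<^sup>2 * n ^ (k - 2))"
  proof (intro add_mono mult_le_mono le_refl)
    show "k\<^sup>2 \<le> k ^ 3" using assms by (intro power_increasing) auto
    show "u * u \<le> u\<^sup>2" by (simp add: power2_eq_square)
    show "u \<le> u\<^sup>2" using assms by (simp add: power2_eq_square)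
  qed
  finally have "card {ys \<in> tuples k n. set ys \<inter> U \<noteq> {} \<and> card (set ys - U) + 2 \<le> k} \<le> 2 * (k ^ 3 * u\<^sup>2 * n ^ (k - 2))"
    by (simp add: mult.assoc)
  then show ?thesis
    using card_equations_fst[where P = "\<lambda>ys. set ys \<inter> U \<noteq> {} \<and> card (set ys - U) + 2 \<le> k"] by simp
qed

text \<open>Independent of \<open>n\<close> but growing with \<open>t\<close>, so that
  \<open>t\<close> is fixed before \<open>n\<close> tends to infinity.\<close>

definition cycle_bound :: "nat \<Rightarrow> nat \<Rightarrow> real" where
  "cycle_bound k t = (\<Sum>j\<le>t. (real k * (1 + real k * t)) ^ j * (6 * (real k ^ 3 * (1 + real k * t)\<^sup>2)))"

lemma expect_near_cycle:
  fixes c :: real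
  assumes k: "k \<ge> 2" and c: "0 \<le> c" "c \<le> 1 / 3" and n: "n > 0"
  shows "expect (c / real n ^ (k - 1)) (equations k n) (\<lambda>F. of_bool (near_cycle k t x F)) \<le> cycle_bound k t / n"
proof -
  define p where "p = c / real n ^ (k - 1)"
  let ?E = "equations k n"
  let ?S = "\<lambda>es. {e \<in> ?E. e \<notin> set es \<and> set (fst e) \<inter> explored x es \<noteq> {} \<and> card (set (fst e) - explored x es) + 2 \<le> k}"
  have p: "0 \<le> p" "p \<le> 1" using edge_probability[of c n "k - 1"] c by (auto simp: p_def)
  have finS: "finite (?S es)" for es using finite_equations by auto
  have "expect p ?E (\<lambda>F. of_bool (near_cycle k t x F))
      \<le> expect p ?E (\<lambda>F. \<Sum>j\<le>t. \<Sum>es\<in>chains k n x j. \<Sum>e\<in>?S es. of_bool (set (e # es) \<subseteq> F))"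
  proof (rule expect_mono[OF p])
    fix F assume F: "F \<subseteq> ?E"
    show "of_bool (near_cycle k t x F) \<le> (\<Sum>j\<le>t. \<Sum>es\<in>chains k n x j. \<Sum>e\<in>?S es. of_bool (set (e # es) \<subseteq> F) :: real)"
    proof (cases "near_cycle k t x F")
      case True
      then obtain es e where e: "closes k x es e" "length es \<le> t" "set (e # es) \<subseteq> F"
        by (auto simp: near_cycle_def)
      have es: "es \<in> chains k n x (length es)" using e F by (auto simp: chains_def closes_def)
      have eS: "e \<in> ?S es" using e F by (auto simp: closes_def)
      have "1 = (of_bool (set (e # es) \<subseteq> F) :: real)" using e(3) by (simp only: of_bool_eq)
      also have "\<dots> \<le> (\<Sum>e\<in>?S es. of_bool (set (e # es) \<subseteq> F))"
        by (rule member_le_sum[where f = "\<lambda>e. of_bool (set (e # es) \<subseteq> F)", OF eS _ finS]) simp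
      also have "\<dots> \<le> (\<Sum>es\<in>chains k n x (length es). \<Sum>e\<in>?S es. of_bool (set (e # es) \<subseteq> F))"
        by (rule member_le_sum[where f = "\<lambda>es. \<Sum>e\<in>?S es. of_bool (set (e # es) \<subseteq> F)", OF es _ finite_chains])
          (auto intro: sum_nonneg)
      also have "\<dots> \<le> (\<Sum>j\<le>t. \<Sum>es\<in>chains k n x j. \<Sum>e\<in>?S es. of_bool (set (e # es) \<subseteq> F))"
        using e(2) by (intro member_le_sum[where f = "\<lambda>j. \<Sum>es\<in>chains k n x j. \<Sum>e\<in>?S es. of_bool (set (e # es) \<subseteq> F)"])
          (auto intro!: sum_nonneg)
      finally show ?thesis using True by simp
    qed (auto intro!: sum_nonneg)
  qed
  also have "\<dots> = (\<Sum>j\<le>t. \<Sum>es\<in>chains k n x j. \<Sum>e\<in>?S es. p ^ Suc j)"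
    unfolding expect_sum
  proof (intro sum.cong refl)
    fix j es e assume es: "es \<in> chains k n x j" and e: "e \<in> ?S es"
    have "card (set (e # es)) = Suc j"
      using es e chain_distinct[of x es] by (simp add: chains_def distinct_card)
    moreover have "set (e # es) \<subseteq> ?E" using es e by (auto simp: chains_def)
    ultimately show "expect p ?E (\<lambda>F. of_bool (set (e # es) \<subseteq> F)) = p ^ Suc j"
      using expect_superset[OF finite_equations, of "set (e # es)" k n p] by (simp only:)
  qed
  also have "\<dots> \<le> (\<Sum>j\<le>t. (real k * (1 + real k * t)) ^ j * (6 * (real k ^ 3 * (1 + real k * t)\<^sup>2)) / n)"
  proof (rule sum_mono)
    fix j assume j: "j \<in> {..t}"
    let ?u = "1 + k * t"
    have nk: "real n ^ (k - 1) = n * real n ^ (k - 2)"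
    proof -
      have "k - 1 = Suc (k - 2)" using k by simp
      then show ?thesis by simp
    qed
    have Sle: "p * real (card (?S es)) \<le> 6 * (real k ^ 3 * (1 + real k * t)\<^sup>2) / n" if es: "es \<in> chains k n x j" for es
    proof -
      have "card (explored x es) \<le> 1 + k * j" by (rule card_explored[OF es])
      also have "\<dots> \<le> ?u" using j by simp
      finally have U: "card (explored x es) \<le> ?u" .
      have "card (?S es) \<le> card {e \<in> ?E. set (fst e) \<inter> explored x es \<noteq> {} \<and> card (set (fst e) - explored x es) + 2 \<le> k}"
        using finite_equations by (intro card_mono) auto
      also have "\<dots> \<le> 6 * (k ^ 3 * ?u\<^sup>2 * n ^ (k - 2))"
        using U by (intro card_closing k) (auto simp: explored_def)
      finally have "real (card (?S es)) \<le> real (6 * (k ^ 3 * ?u\<^sup>2 * n ^ (k - 2)))" by (simp only: of_nat_le_iff)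
      then have "p * real (card (?S es)) \<le> p * real (6 * (k ^ 3 * ?u\<^sup>2 * n ^ (k - 2)))"
        using p by (intro mult_left_mono) auto
      also have "\<dots> = c * (6 * (real k ^ 3 * (1 + real k * t)\<^sup>2) / n)"
        unfolding p_def nk using n by simp
      also have "\<dots> \<le> 1 * (6 * (real k ^ 3 * (1 + real k * t)\<^sup>2) / n)"
        using c by (intro mult_right_mono) auto
      finally show ?thesis by simp
    qed
    have "(\<Sum>es\<in>chains k n x j. \<Sum>e\<in>?S es. p ^ Suc j) = (\<Sum>es\<in>chains k n x j. p ^ j * (p * real (card (?S es))))"
      by (intro sum.cong refl) (simp add: mult_ac)
    also have "\<dots> \<le> (\<Sum>es\<in>chains k n x j. p ^ j * (6 * (real k ^ 3 * (1 + real k * t)\<^sup>2) / n))"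
      using p by (intro sum_mono mult_left_mono Sle) auto
    also have "\<dots> = (real (card (chains k n x j)) * p ^ j) * (6 * (real k ^ 3 * (1 + real k * t)\<^sup>2) / n)"
      by simp
    also have "\<dots> \<le> (real k * (1 + real k * t)) ^ j * (6 * (real k ^ 3 * (1 + real k * t)\<^sup>2) / n)"
      using expected_chains[OF c n, of j t k x] j unfolding p_def by (intro mult_right_mono) auto
    finally show "(\<Sum>es\<in>chains k n x j. \<Sum>e\<in>?S es. p ^ Suc j) \<le> (real k * (1 + real k * t)) ^ j * (6 * (real k ^ 3 * (1 + real k * t)\<^sup>2)) / n"
      by simp
  qed
  also have "\<dots> = cycle_bound k t / n" by (simp add: cycle_bound_def sum_divide_distrib)
  finally show ?thesis by (simp only: p_def)
qed

lemma expect_core_not_live: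
  fixes c :: real
  assumes k: "k \<ge> 2" and c: "0 \<le> c" "c \<le> 1 / 3" and n: "n > 0"
  shows "expect (c / real n ^ (k - 1)) (equations k n) (\<lambda>F. real (card (fst (two_core n F) - live n t F))) \<le> cycle_bound k t"
proof -
  let ?p = "c / real n ^ (k - 1)" and ?E = "equations k n"
  have p: "0 \<le> ?p" "?p \<le> 1" using edge_probability[of c n "k - 1"] c by auto
  have "expect ?p ?E (\<lambda>F. real (card (fst (two_core n F) - live n t F)))
      \<le> expect ?p ?E (\<lambda>F. \<Sum>x\<in>{1..n}. of_bool (near_cycle k t x F))"
  proof (rule expect_mono[OF p])
    fix F assume F: "F \<subseteq> ?E"
    have "fst (two_core n F) - live n t F \<subseteq> {x \<in> {1..n}. near_cycle k t x F}"
      using core_subset_live[OF F k] core_subset(2)[of n F] by blast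
    then have "card (fst (two_core n F) - live n t F) \<le> card {x \<in> {1..n}. near_cycle k t x F}"
      by (intro card_mono) auto
    then have "real (card (fst (two_core n F) - live n t F)) \<le> real (card {x \<in> {1..n}. near_cycle k t x F})" by simp
    also have "\<dots> = (\<Sum>x\<in>{1..n}. of_bool (near_cycle k t x F))"
      by (simp add: of_bool_def sum.If_cases Int_def)
    finally show "real (card (fst (two_core n F) - live n t F)) \<le> (\<Sum>x\<in>{1..n}. of_bool (near_cycle k t x F))" .
  qed
  also have "\<dots> \<le> (\<Sum>x\<in>{1..n}. cycle_bound k t / n)"
    unfolding expect_sum by (intro sum_mono expect_near_cycle k c n)
  also have "\<dots> = cycle_bound k t" using n by simp
  finally show ?thesis .
qed

subsection \<open>The satisfiability threshold\<close>

lemma dependent_2_iff: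
  assumes "finite F"
  shows "dependent 2 F \<longleftrightarrow> (\<exists>l\<in>left_ker F. supp F l \<noteq> {})"
proof
  assume "dependent 2 F"
  then have "2 \<le> card (left_ker F)" by (simp add: dependent_def)
  then have "\<not> left_ker F \<subseteq> {restrict (\<lambda>_. 0) F}"
    using card_mono[of "{restrict (\<lambda>_. 0) F}" "left_ker F"] by auto
  then show "\<exists>l\<in>left_ker F. supp F l \<noteq> {}" using left_ker_eqI by blast
next
  assume "\<exists>l\<in>left_ker F. supp F l \<noteq> {}"
  then obtain l where l: "l \<in> left_ker F" "supp F l \<noteq> {}" by blast
  then have "l \<noteq> restrict (\<lambda>_. 0) F" by (auto simp: supp_def)
  then have "card {l, restrict (\<lambda>_. 0) F} = 2" by simp
  moreover have "card {l, restrict (\<lambda>_. 0) F} \<le> card (left_ker F)"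
    using l zero_in_left_ker finite_left_ker[OF assms] by (intro card_mono) auto
  ultimately show "dependent 2 F" by (simp add: dependent_def)
qed

text \<open>Frozen variables are linked by combinations of all equations. For two variables of the
  core the difference vanishes outside the core, so by \<open>in_span_core\<close> the equations of
  the core alone already link them.\<close>

lemma frozen_core_card:
  assumes k: "k \<ge> 1" and n: "n > 0" and F: "F \<subseteq> equations k n"
  shows "card (fst (two_core n F) \<inter> frozen k n F) \<le> card (snd (two_core n F)) + 1"
proof (cases "fst (two_core n F) \<inter> frozen k n F = {}")
  case True
  then show ?thesis by (simp only: True card.empty)
next
  case False
  then obtain z where z: "z \<in> fst (two_core n F)" "z \<in> frozen k n F" by blast
  have finF: "finite F" using F finite_equations finite_subset by blast
  show ?thesis
  proof (rule card_equivalent_le)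
    show "finite (snd (two_core n F))" using core_subset(1) finF finite_subset by blast
    show "finite (fst (two_core n F) \<inter> frozen k n F)" by (auto simp: frozen_def)
    show "z \<in> fst (two_core n F) \<inter> frozen k n F" using z by blast
    fix x assume x: "x \<in> fst (two_core n F) \<inter> frozen k n F"
    then have "linked F x z" using frozen_linked[OF k n] z by blast
    then show "in_span (snd (two_core n F)) (\<lambda>y. unit x y - unit z y)"
      unfolding linked_def using x z by (intro in_span_core[OF finF]) (auto simp: unit_def)
  qed
qed

text \<open>Only the empty core needs care: its density is 0 by convention, and it has no equations,
  since each would contain a variable of the core.\<close>

lemma core_density_leD:
  fixes \<epsilon> :: real
  assumes k: "k \<ge> 1" and F: "F \<subseteq> equations k n" and d: "core_density n F \<le> 1 - \<epsilon>"
  shows "card (snd (two_core n F)) \<le> (1 - \<epsilon>) * card (fst (two_core n F))"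
proof (cases "fst (two_core n F) = {}")
  case True
  have "snd (two_core n F) = {}"
  proof (rule ccontr)
    assume "snd (two_core n F) \<noteq> {}"
    then obtain e where e: "e \<in> snd (two_core n F)" by blast
    then have "set (fst e) \<subseteq> {}" using core_equation_vars[OF F e] True by simp
    moreover have "length (fst e) = k" using e core_subset(1)[of n F] F equations_iff by blast
    ultimately show False using k by simp
  qed
  then show ?thesis using True by simp
next
  case False
  have "finite (fst (two_core n F))" using core_subset(2) finite_subset by blast
  then have "0 < card (fst (two_core n F))" using False by (simp add: card_gt_0_iff)
  then show ?thesis using d by (simp add: core_density_def pos_divide_le_eq)
qed

text \<open>A kernel vector is supported on the core, so the core has at least
  \<open>3 / 5 * n\<close> equations and, its density being below 1, at least as many variables. The
  surplus of variables over equations is a fraction \<open>\<epsilon>\<close> of the variables and,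
  up to one, counts only non-frozen ones; each of these either fails to survive \<open>t\<close>
  rounds or survives without being frozen.\<close>

lemma good_core_bound:
  fixes \<epsilon> :: real
  assumes k: "k \<ge> 16" and n: "n > 0" and F: "F \<subseteq> equations k n" and \<epsilon>: "\<epsilon> > 0"
    and good: "good k n F" and circuit: "\<not> has_small_circuit (circuit_size k * n) F"
    and d: "core_density n F \<le> 1 - \<epsilon>"
  shows "3 / 5 * \<epsilon> * n \<le> 1 + card (fst (two_core n F) - live n t F) + card (live n t F - frozen k n F)"
proof -
  let ?V = "fst (two_core n F)" and ?C = "snd (two_core n F)" and ?L = "live n t F" and ?B = "frozen k n F"
  have finF: "finite F" using F finite_equations finite_subset by blast
  have finV: "finite ?V" using core_subset(2) finite_subset by blast
  have finC: "finite ?C" using core_subset(1) finF finite_subset by blast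
  obtain l where l: "l \<in> left_ker F" "supp F l \<noteq> {}"
    using good dependent_2_iff[OF finF] by (auto simp: good_def)
  then have "circuit_size k * n < card (supp F l)"
    using circuit unfolding has_small_circuit_def by (meson not_le)
  also have "card (supp F l) \<le> card ?C" using supp_subset_core[OF finF l(1)] finC card_mono by blast
  finally have "circuit_size k * n < card ?C" by simp
  moreover have "3 / 5 * real n \<le> circuit_size k * n"
    using circuit_size_bounds(3)[OF k] by (intro mult_right_mono) auto
  ultimately have C: "3 / 5 * real n \<le> card ?C" by linarith
  have dens: "card ?C \<le> (1 - \<epsilon>) * card ?V" using k F d by (intro core_density_leD) auto
  have "card ?V \<le> card (?V \<inter> ?B) + card (?V - ?L) + card (?L - ?B)"
  proof -
    have "?V \<subseteq> ((?V \<inter> ?B) \<union> (?V - ?L)) \<union> (?L - ?B)" by blast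
    then have "card ?V \<le> card (((?V \<inter> ?B) \<union> (?V - ?L)) \<union> (?L - ?B))"
      using finV live_subset[of n t F] by (intro card_mono) (auto intro: finite_subset)
    also have "\<dots> \<le> card ((?V \<inter> ?B) \<union> (?V - ?L)) + card (?L - ?B)" by (rule card_Un_le)
    also have "\<dots> \<le> card (?V \<inter> ?B) + card (?V - ?L) + card (?L - ?B)"
      by (intro add_right_mono card_Un_le)
    finally show ?thesis .
  qed
  moreover have "card (?V \<inter> ?B) \<le> card ?C + 1" using k n F by (intro frozen_core_card) auto
  ultimately have "real (card ?V) \<le> card ?C + 1 + card (?V - ?L) + card (?L - ?B)" by linarith
  then have 1: "\<epsilon> * card ?V \<le> 1 + card (?V - ?L) + card (?L - ?B)"
    using dens by (simp add: left_diff_distrib)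
  have "0 \<le> \<epsilon> * card ?V" using \<epsilon> by simp
  then have "real (card ?C) \<le> card ?V" using dens by (simp add: left_diff_distrib)
  then have "\<epsilon> * (3 / 5 * real n) \<le> \<epsilon> * card ?V" using C \<epsilon> by (intro mult_left_mono) auto
  then show ?thesis using 1 by (simp add: mult_ac)
qed

text \<open>The bound of \<open>good_core_bound\<close> is divided by \<open>n\<close>, the two
  exceptional events are added, and the average is taken. Below the threshold only the term
  \<open>(1 / 2) ^ t\<close> does not vanish as \<open>n\<close> grows.\<close>

lemma good_expect_le:
  fixes c \<epsilon> :: real
  assumes k: "k \<ge> 16" and c: "3 / 10 \<le> c" "c \<le> 1 / 3" and n: "n \<ge> 2" and \<epsilon>: "\<epsilon> > 0"
  defines "a \<equiv> 3 / 5 * \<epsilon>"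
  shows "a * prob_of c k (good k) n \<le> (1 / 2) ^ t + ((1 + cycle_bound k t) / n
    + 2 * ((2 * deletion_error k n + (real k)\<^sup>2) / n)
    + a * (prob_of c k (\<lambda>n. has_small_circuit (circuit_size k * n)) n
      + prob_of c k (\<lambda>n F. \<not> core_density n F \<le> 1 - \<epsilon>) n))"
proof -
  let ?p = "c / real n ^ (k - 1)" and ?E = "equations k n"
  let ?S = "\<lambda>F. has_small_circuit (circuit_size k * n) F" and ?D = "\<lambda>F. \<not> core_density n F \<le> 1 - \<epsilon>"
  have c0: "0 \<le> c" using c by simp
  have p: "0 \<le> ?p" "?p \<le> 1" using edge_probability[of c n "k - 1"] c by auto
  have n0: "n > 0" using n by simp
  have a: "a > 0" using \<epsilon> by (simp add: a_def)
  let ?rhs = "\<lambda>F. 1 / n + 1 / n * real (card (fst (two_core n F) - live n t F)) + discrepancy k n t F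
      + a * (of_bool (?S F) + of_bool (?D F))"
  have "a * prob_of c k (good k) n = expect ?p ?E (\<lambda>F. a * of_bool (good k n F))"
    by (simp only: prob_of_def expect_cmult)
  also have "\<dots> \<le> expect ?p ?E ?rhs"
  proof (rule expect_mono[OF p])
    fix F assume F: "F \<subseteq> ?E"
    have nn: "0 \<le> 1 / n + 1 / n * real (card (fst (two_core n F) - live n t F)) + discrepancy k n t F"
      using discrepancy_bounds[of k n t F] by simp
    consider "\<not> good k n F" | "?S F" | "?D F" | "good k n F" "\<not> ?S F" "core_density n F \<le> 1 - \<epsilon>" by blast
    then show "a * of_bool (good k n F) \<le> ?rhs F"
    proof cases
      case 1
      then show ?thesis using nn a by simp
    next
      case 2
      then have "a * of_bool (good k n F) \<le> a * (of_bool (?S F) + of_bool (?D F))" using a by simp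
      then show ?thesis using nn by linarith
    next
      case 3
      then have "a * of_bool (good k n F) \<le> a * (of_bool (?S F) + of_bool (?D F))" using a by simp
      then show ?thesis using nn by linarith
    next
      case 4
      have "a * n \<le> 1 + card (fst (two_core n F) - live n t F) + card (live n t F - frozen k n F)"
        unfolding a_def using 4 by (intro good_core_bound k n0 F \<epsilon>) auto
      then have "a \<le> (1 + card (fst (two_core n F) - live n t F) + card (live n t F - frozen k n F)) / n"
        using n0 by (simp add: pos_le_divide_eq)
      also have "\<dots> = 1 / n + 1 / n * real (card (fst (two_core n F) - live n t F)) + discrepancy k n t F"
        using 4 by (simp add: discrepancy_def add_divide_distrib)
      finally have "a \<le> 1 / n + 1 / n * real (card (fst (two_core n F) - live n t F)) + discrepancy k n t F" .
      moreover have "0 \<le> a * (of_bool (?S F) + of_bool (?D F))" using a by simp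
      moreover have "a * of_bool (good k n F) = a" using 4 by simp
      ultimately show ?thesis by linarith
    qed
  qed
  also have "\<dots> = 1 / n + 1 / n * expect ?p ?E (\<lambda>F. real (card (fst (two_core n F) - live n t F)))
      + expect ?p ?E (discrepancy k n t)
      + a * (prob_of c k (\<lambda>n. has_small_circuit (circuit_size k * n)) n + prob_of c k (\<lambda>n F. ?D F) n)"
    by (simp only: expect_add expect_cmult expect_const[OF finite_equations] prob_of_def)
  also have "\<dots> \<le> 1 / n + 1 / n * cycle_bound k t
      + ((1 / 2) ^ t + 2 * ((2 * deletion_error k n + (real k)\<^sup>2) / n))
      + a * (prob_of c k (\<lambda>n. has_small_circuit (circuit_size k * n)) n + prob_of c k (\<lambda>n F. ?D F) n)"
    using k c c0 n n0 contraction_le_half[OF k c]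
    by (intro add_mono mult_left_mono expect_core_not_live discrepancy_le order_refl) auto
  finally show ?thesis by (simp add: prob_of_def add_divide_distrib)
qed

text \<open>Two limits in order: \<open>t\<close> is chosen to make \<open>b t\<close> small, then
  \<open>n\<close> to make \<open>g t n\<close> small for this \<open>t\<close>.\<close>

lemma tendsto_0_family:
  fixes f :: "nat \<Rightarrow> real" and g :: "nat \<Rightarrow> nat \<Rightarrow> real"
  assumes "\<And>n. 0 \<le> f n" "\<And>t n. n \<ge> N \<Longrightarrow> f n \<le> b t + g t n" "b \<longlonglongrightarrow> 0" "\<And>t. g t \<longlonglongrightarrow> 0"
  shows "f \<longlonglongrightarrow> 0"
proof (rule LIMSEQ_I)
  fix r :: real assume r: "0 < r"
  have "eventually (\<lambda>t. b t < r / 2) sequentially"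
    using order_tendstoD(2)[OF assms(3), of "r / 2"] r by simp
  then obtain t where t: "b t < r / 2" by (metis eventually_happens' sequentially_bot)
  have "eventually (\<lambda>n. g t n < r / 2) sequentially"
    using order_tendstoD(2)[OF assms(4), of "r / 2"] r by simp
  then obtain M where M: "\<And>n. n \<ge> M \<Longrightarrow> g t n < r / 2" by (auto simp: eventually_sequentially)
  have "norm (f n - 0) < r" if "n \<ge> max M N" for n
  proof -
    have "f n \<le> b t + g t n" "g t n < r / 2" using that assms(2) M by auto
    then show ?thesis using assms(1)[of n] t by simp
  qed
  then show "\<exists>no. \<forall>n\<ge>no. norm (f n - 0) < r" by blast
qed

lemma good_many_equations:
  assumes k: "k \<ge> 16" and n: "n > 0" and F: "F \<subseteq> equations k n" and good: "good k n F"
  shows "63 / 64 * real n \<le> card F + 1"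
proof -
  have finF: "finite F" using F finite_equations finite_subset by blast
  have "1 / (4 * real k) \<le> 1 / (4 * 16)" using k by (intro divide_left_mono) auto
  then have "63 / 64 * real n \<le> (1 - 1 / (4 * real k)) * n" by (intro mult_right_mono) auto
  also have "\<dots> \<le> card (frozen k n F)" using good by (simp add: good_def)
  finally have B: "63 / 64 * real n \<le> card (frozen k n F)" .
  then have "card (frozen k n F) > 0" using n by (cases "card (frozen k n F) = 0") auto
  then obtain z where z: "z \<in> frozen k n F" by (metis card.empty less_irrefl equals0I)
  have "card (frozen k n F) \<le> card F + 1"
  proof (rule card_equivalent_le[OF finF _ z])
    show "finite (frozen k n F)" by (simp add: frozen_def)
    fix x assume "x \<in> frozen k n F"
    then show "in_span F (\<lambda>y. unit x y - unit z y)"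
      using frozen_linked[of k n x F z] k n z by (simp add: linked_def)
  qed
  then show ?thesis using B by linarith
qed

text \<open>For \<open>c \<ge> 3 / 10\<close> the contraction applies. For smaller \<open>c\<close>
  the mean number of equations is below \<open>9 / 10 * n\<close>, too few to link the at least
  \<open>63 / 64 * n\<close> frozen variables of a good formula.\<close>

lemma good_tendsto:
  fixes c \<epsilon> :: real
  assumes k: "k \<ge> 16" and c: "0 \<le> c" "c \<le> 1 / 3" and \<epsilon>: "\<epsilon> > 0"
    and dens: "prob_of c k (\<lambda>n F. \<not> core_density n F \<le> 1 - \<epsilon>) \<longlonglongrightarrow> 0"
  shows "prob_of c k (good k) \<longlonglongrightarrow> 0"
proof (cases "3 / 10 \<le> c")
  case True
  define a where "a = 3 / 5 * \<epsilon>"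
  have a: "a > 0" using \<epsilon> by (simp add: a_def)
  define g where "g t n = ((1 + cycle_bound k t) / n
    + 2 * ((2 * deletion_error k n + (real k)\<^sup>2) / n)
    + a * (prob_of c k (\<lambda>n. has_small_circuit (circuit_size k * n)) n
      + prob_of c k (\<lambda>n F. \<not> core_density n F \<le> 1 - \<epsilon>) n)) / a" for t n
  have c1: "c \<le> 1" using c by simp
  show ?thesis
  proof (rule tendsto_0_family[where b = "\<lambda>t. (1 / 2) ^ t / a" and g = g and N = 2])
    show "0 \<le> prob_of c k (good k) n" for n using prob_of_nonneg c(1) c1 by blast
    show "prob_of c k (good k) n \<le> (1 / 2) ^ t / a + g t n" if "n \<ge> 2" for t n
    proof -
      have "prob_of c k (good k) n \<le> ((1 / 2) ^ t + g t n * a) / a"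
        using good_expect_le[OF k True c(2) that \<epsilon>, of t] a
        unfolding a_def[symmetric] by (simp add: pos_le_divide_eq g_def mult.commute)
      then show ?thesis using a by (simp add: add_divide_distrib)
    qed
    have "(\<lambda>t. (1 / 2 :: real) ^ t) \<longlonglongrightarrow> 0" by (rule LIMSEQ_power_zero) simp
    then show "(\<lambda>t. (1 / 2) ^ t / a) \<longlonglongrightarrow> 0" by (auto intro: tendsto_divide_zero)
    show "g t \<longlonglongrightarrow> 0" for t
    proof -
      have 1: "(\<lambda>n. (1 + cycle_bound k t) / real n) \<longlonglongrightarrow> 0" by real_asymp
      have 2: "(\<lambda>n. 2 * ((2 * deletion_error k n + (real k)\<^sup>2) / real n)) \<longlonglongrightarrow> 0"
        unfolding deletion_error_def by real_asymp
      have "(\<lambda>n. g t n) \<longlonglongrightarrow> (0 + 0 + a * (0 + 0)) / a"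
        unfolding g_def using 1 2 small_circuit_tendsto[OF k c] dens a by (intro tendsto_intros) auto
      then show ?thesis by simp
    qed
  qed
next
  case False
  have c1: "c \<le> 1" using c by simp
  show ?thesis
  \<comment> \<open>From \<open>n = 30\<close> on, \<open>63 / 64 * n - 1\<close> exceeds
    \<open>9 / 10 * n\<close> by at least \<open>n / 20\<close>; Chebyshev's inequality with this
    deviation gives \<open>400 / n\<close>.\<close>
  proof (rule tendsto_0_family[where b = "\<lambda>t. 0" and g = "\<lambda>t n. 400 / real n" and N = 30])
    show "0 \<le> prob_of c k (good k) n" for n using prob_of_nonneg c(1) c1 by blast
    show "prob_of c k (good k) n \<le> 0 + 400 / real n" if n: "n \<ge> 30" for n
    proof -
      let ?p = "c / real n ^ (k - 1)" and ?E = "equations k n"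
      have p: "0 \<le> ?p" "?p \<le> 1" using edge_probability[of c n "k - 1"] c by auto
      have mean: "?p * card ?E = 3 * c * n" using k n by (intro edge_mean) auto
      have "prob_of c k (good k) n \<le> expect ?p ?E (\<lambda>F. of_bool (\<bar>real (card F) - ?p * card ?E\<bar> \<ge> n / 20))"
        unfolding prob_of_def
      proof (rule expect_mono[OF p])
        fix F assume F: "F \<subseteq> ?E"
        have "n / 20 \<le> \<bar>real (card F) - ?p * card ?E\<bar>" if "good k n F"
        proof -
          have "63 / 64 * real n \<le> card F + 1" using k n F that by (intro good_many_equations) auto
          moreover have "3 * c * n \<le> 9 / 10 * real n" using False by (intro mult_right_mono) auto
          moreover have "30 \<le> real n" using n by simp
          ultimately show ?thesis unfolding mean by linarith
        qed
        then show "of_bool (good k n F) \<le> (of_bool (\<bar>real (card F) - ?p * card ?E\<bar> \<ge> n / 20) :: real)" by simp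
      qed
      also have "\<dots> \<le> ?p * card ?E / (n / 20)\<^sup>2"
        using n p by (intro expect_card_deviation finite_equations) auto
      also have "\<dots> = 400 * (3 * c) / n" unfolding mean using n by (simp add: power2_eq_square)
      also have "\<dots> \<le> 400 * 1 / n" using c by (intro divide_right_mono mult_left_mono) auto
      finally show ?thesis by simp
    qed
    show "(\<lambda>n. 400 / real n) \<longlonglongrightarrow> 0" by real_asymp
  qed simp
qed

text \<open>Leaf removal never decreases the excess of equations over variables, so a core of
  density below 1 leaves at most \<open>n\<close> equations in total. For \<open>c > 1 / 3\<close>
  the mean \<open>3 * c * n\<close> is larger by a linear amount, and such a deviation has
  probability of order \<open>1 / n\<close>.\<close>

lemma threshold_le_third:
  fixes c \<epsilon> :: real
  assumes k: "k \<ge> 16" and c: "0 \<le> c" and \<epsilon>: "\<epsilon> > 0"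
    and dens: "(\<lambda>n. measure_pmf.prob (random_formula k n (c / real n ^ (k - 1))) {F. core_density n F \<le> 1 - \<epsilon>}) \<longlonglongrightarrow> 1"
  shows "c \<le> 1 / 3"
proof (rule ccontr)
  assume "\<not> c \<le> 1 / 3"
  then have c3: "3 * c - 1 > 0" by simp
  define K where "K = 3 * c / (3 * c - 1)\<^sup>2"
  have bound: "measure_pmf.prob (random_formula k n (c / real n ^ (k - 1))) {F. core_density n F \<le> 1 - \<epsilon>} \<le> K / real n"
    if n: "n > 0" "c \<le> n" for n
  proof -
    let ?p = "c / real n ^ (k - 1)" and ?E = "equations k n"
    \<comment> \<open>From \<open>n \<ge> c\<close> on, the quotient \<open>c / n ^ (k - 1)\<close>
      is a probability; here \<open>c\<close> may exceed 1.\<close>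
    have "real n \<le> real n ^ (k - 1)" using power_increasing[of 1 "k - 1" "real n"] n k by simp
    then have "c \<le> real n ^ (k - 1)" using n(2) by linarith
    then have "?p \<le> 1" using n(1) by (simp add: divide_le_eq_1)
    then have p: "0 \<le> ?p" "?p \<le> 1" using c by auto
    have mean: "?p * card ?E = 3 * c * n" using k n by (intro edge_mean) auto
    have "measure_pmf.prob (random_formula k n ?p) {F. core_density n F \<le> 1 - \<epsilon>}
        = expect ?p ?E (\<lambda>F. of_bool (core_density n F \<le> 1 - \<epsilon>))"
      using prob_random_formula[OF p] by simp
    also have "\<dots> \<le> expect ?p ?E (\<lambda>F. of_bool (\<bar>real (card F) - ?p * card ?E\<bar> \<ge> (3 * c - 1) * n))"
    proof (rule expect_mono[OF p])
      fix F assume F: "F \<subseteq> ?E"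
      have "(3 * c - 1) * n \<le> \<bar>real (card F) - ?p * card ?E\<bar>" if d: "core_density n F \<le> 1 - \<epsilon>"
      proof -
        have "real (card (snd (two_core n F))) \<le> (1 - \<epsilon>) * card (fst (two_core n F))"
          using k F d by (intro core_density_leD) auto
        moreover have "0 \<le> \<epsilon> * card (fst (two_core n F))" using \<epsilon> by simp
        ultimately have "real (card (snd (two_core n F))) \<le> card (fst (two_core n F))"
          by (simp add: left_diff_distrib)
        moreover have "card F + card (fst (two_core n F)) \<le> n + card (snd (two_core n F))"
          using F finite_equations finite_subset by (intro core_card) blast
        ultimately have "real (card F) \<le> n" by linarith
        then show ?thesis unfolding mean by (simp add: algebra_simps)
      qed
      then show "of_bool (core_density n F \<le> 1 - \<epsilon>) \<le> (of_bool (\<bar>real (card F) - ?p * card ?E\<bar> \<ge> (3 * c - 1) * n) :: real)" by simp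
    qed
    also have "\<dots> \<le> ?p * card ?E / ((3 * c - 1) * n)\<^sup>2"
      using n p c3 by (intro expect_card_deviation finite_equations) auto
    also have "\<dots> = K / n" unfolding mean K_def using n c3 by (simp add: power2_eq_square)
    finally show ?thesis .
  qed
  have "eventually (\<lambda>n. measure_pmf.prob (random_formula k n (c / real n ^ (k - 1))) {F. core_density n F \<le> 1 - \<epsilon>} \<le> K / real n) sequentially"
    using eventually_ge_at_top[of "nat \<lceil>c\<rceil>"] eventually_gt_at_top[of 0]
  proof eventually_elim
    case (elim n)
    have "c \<le> real n" using elim(1) by linarith
    then show ?case using elim(2) by (intro bound) auto
  qed
  moreover have "(\<lambda>n. K / real n) \<longlonglongrightarrow> 0" by real_asymp
  ultimately have "(1::real) \<le> 0"
    using tendsto_le[OF sequentially_bot _ dens] by blast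
  then show False by simp
qed

unused_thms

theorem theorem1:
  fixes k :: nat and \<epsilon> T :: real and p :: "nat \<Rightarrow> real"
  assumes "k > 15"
    and "\<epsilon> > 0"
    and "core_threshold k T"
    and "\<And>n. p n \<in> {0..1}"
    and "\<And>n. n \<ge> 1 \<Longrightarrow> p n < (T - \<epsilon>) / real n ^ (k - 1)"
  shows "(\<lambda>n. measure_pmf.prob (random_formula k n (p n)) {F. satisfiable n F}) \<longlonglongrightarrow> 1"
proof -
  define c where "c = T - \<epsilon>"
  have k: "k \<ge> 16" using assms(1) by simp
  \<comment> \<open>At \<open>n = 1\<close> the upper bound for \<open>p\<close> is
    \<open>T - \<epsilon>\<close> itself, and \<open>p 1\<close> is nonnegative.\<close>
  have c0: "0 \<le> c" using assms(4)[of 1] assms(5)[of 1] by (simp add: c_def)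
  have dens: "(\<lambda>n. measure_pmf.prob (random_formula k n (c / real n ^ (k - 1))) {F. core_density n F \<le> 1 - \<epsilon>}) \<longlonglongrightarrow> 1"
    using assms(2,3) c0 unfolding core_threshold_def c_def by blast
  have c: "0 \<le> c" "c \<le> 1 / 3" "c \<le> 1" using c0 threshold_le_third[OF k c0 assms(2) dens] by auto
  have prob: "measure_pmf.prob (random_formula k n (c / real n ^ (k - 1))) {F. P n F} = prob_of c k P n" for P n
    unfolding prob_of_def using prob_random_formula edge_probability[OF c(1,3)] by simp
  have compl: "prob_of c k (\<lambda>n F. \<not> P n F) n = 1 - prob_of c k P n" for P n
  proof -
    have "prob_of c k (\<lambda>n F. \<not> P n F) n = expect (c / real n ^ (k - 1)) (equations k n) (\<lambda>F. 1 - of_bool (P n F))"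
      unfolding prob_of_def by (intro expect_cong) simp
    then show ?thesis by (simp add: expect_diff finite_equations prob_of_def)
  qed
  have "(\<lambda>n. 1 - prob_of c k (\<lambda>n F. core_density n F \<le> 1 - \<epsilon>) n) \<longlonglongrightarrow> 1 - 1"
    using dens unfolding prob[of _ "\<lambda>n F. core_density n F \<le> 1 - \<epsilon>"] by (intro tendsto_diff tendsto_const) simp
  then have "prob_of c k (\<lambda>n F. \<not> core_density n F \<le> 1 - \<epsilon>) \<longlonglongrightarrow> 0"
    unfolding compl[symmetric, of "\<lambda>n F. core_density n F \<le> 1 - \<epsilon>"] by simp
  then have good: "prob_of c k (good k) \<longlonglongrightarrow> 0" by (rule good_tendsto[OF k c(1,2) assms(2)])
  have "prob_of c k (\<lambda>n F. dependent 2 F \<and> almost_spanning k n F) \<longlonglongrightarrow> 0"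
  proof (rule tendsto_0_le[OF good])
    fix n :: nat assume n: "n > 0"
    show "prob_of c k (\<lambda>n F. dependent 2 F \<and> almost_spanning k n F) n \<le> prob_of c k (good k) n"
      using almost_spanning_frozen[OF k n] by (intro prob_of_mono c) (auto simp: good_def)
  qed (rule prob_of_nonneg[OF c(1,3)])
  then have dep: "prob_of c k (\<lambda>n. dependent 2) \<longlonglongrightarrow> 0" by (rule dependent_tendsto[OF k c(1,2)])
  then have lower: "(\<lambda>n. 1 - prob_of c k (\<lambda>n. dependent 2) n) \<longlonglongrightarrow> 1"
    using tendsto_diff[OF tendsto_const dep, of 1] by simp
  show ?thesis
  proof (rule tendsto_sandwich[OF _ _ lower tendsto_const])
    show "\<forall>\<^sub>F n in sequentially. measure_pmf.prob (random_formula k n (p n)) {F. satisfiable n F} \<le> 1"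
      by simp
    show "\<forall>\<^sub>F n in sequentially. 1 - prob_of c k (\<lambda>n. dependent 2) n \<le> measure_pmf.prob (random_formula k n (p n)) {F. satisfiable n F}"
      using eventually_ge_at_top[of 1]
    proof eventually_elim
      case (elim n)
      let ?E = "equations k n" and ?q = "c / real n ^ (k - 1)"
      have p: "0 \<le> p n" "p n \<le> 1" "p n \<le> ?q"
        using assms(4)[of n] assms(5)[OF elim] by (auto simp: c_def)
      have q: "0 \<le> ?q" "?q \<le> 1" using edge_probability[OF c(1,3)] by auto
      have "1 - prob_of c k (\<lambda>n. dependent 2) n = expect ?q ?E (\<lambda>F. 1 - of_bool (dependent 2 F))"
        by (simp add: prob_of_def expect_diff finite_equations)
      also have "\<dots> \<le> expect ?q ?E (\<lambda>F. of_bool (satisfiable n F))"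
      proof (rule expect_mono[OF q])
        fix F assume F: "F \<subseteq> ?E"
        then have "finite F" using finite_equations finite_subset by blast
        then have "\<not> satisfiable n F \<Longrightarrow> dependent 2 F"
          using unsatisfiable_left_ker[OF F] dependent_2_iff by blast
        then show "1 - of_bool (dependent 2 F) \<le> (of_bool (satisfiable n F) :: real)" by auto
      qed
      also have "\<dots> \<le> expect (p n) ?E (\<lambda>F. of_bool (satisfiable n F))"
      proof (rule expect_antimono_p[OF finite_equations p(1,3) q(2)])
        fix F G :: "equation set" assume "F \<subseteq> G"
        then have "satisfiable n G \<Longrightarrow> satisfiable n F" unfolding satisfiable_def by blast
        then show "of_bool (satisfiable n G) \<le> (of_bool (satisfiable n F) :: real)" by simp
      qed
      also have "\<dots> = measure_pmf.prob (random_formula k n (p n)) {F. satisfiable n F}"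
        using prob_random_formula[OF p(1,2)] by simp
      finally show ?case .
    qed
  qed
qed

end
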